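(* Let $\eta$ be a Poisson point process on a measurable space $(\mathbb{X},\mathcal{X})$ with $\sigma$-finite intensity measure $\lambda$. Let $F:\mathbf{N}\to\mathbb{R}$ be measurable with $\mathbb{E}[F(\eta)^2]<\infty$ and $\mathbb{E}\int_{\mathbb{X}}(D_xF(\eta))^2\,\lambda(\mathrm{d}x)<\infty$. Then $$\operatorname{Var}(F(\eta))=\int_0^\infty \mathbb{E}\Big[\sum_{x\in\eta\cap\eta^t}D_x^-F(\eta)\,D_x^-F(\eta^t)\Big]\,\mathrm{d}t .$$
   Context: $\mathbf{N}$ is the space of $\sigma$-finite counting measures on $\mathbb{X}$ with the $\sigma$-algebra generated by $\mu\mapsto\mu(A)$, $A\in\mathcal X$; $\eta$ is viewed as a random element of $\mathbf N$. For $\mu\in\mathbf N$ and $x\in\mathbb X$, the add-one cost is $D_xF(\mu)=F(\mu+\delta_x)-F(\mu)$, and for $x\in\mu$ the remove-one cost is $D_x^-F(\mu)=F(\mu)-F(\mu-\delta_x)$. For $t\ge 0$, $\eta^t:=\eta_{e^{-t}}+\eta'_{1-e^{-t}}$, where $\eta_{e^{-t}}$ is obtained from $\eta$ by keeping each point independently with probability $e^{-t}$, and $\eta'_{1-e^{-t}}$ is a Poisson process with intensity $(1-e^{-t})\lambda$ independent of $(\eta,\eta_{e^{-t}})$. The sum over $x\in\eta\cap\eta^t$ runs over the points of $\eta$ that are retained in $\eta^t$ (i.e. the points of $\eta_{e^{-t}}$). *)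

theory Defs
  imports "HOL-Probability.Probability"
begin

definition counting_measures :: "'a measure \<Rightarrow> 'a measure set" where
  "counting_measures X = {\<mu>. sets \<mu> = sets X \<and> sigma_finite_measure \<mu> \<and>
      (\<forall>A\<in>sets X. emeasure \<mu> A \<in> range of_nat \<union> {\<infinity>})}"

definition N_alg :: "'a measure \<Rightarrow> 'a measure measure" where
  "N_alg X = (SUP A \<in> sets X. vimage_algebra (counting_measures X) (\<lambda>\<mu>. emeasure \<mu> A) borel)"

definition add_pt :: "'a measure \<Rightarrow> 'a measure \<Rightarrow> 'a \<Rightarrow> 'a measure" where
  "add_pt X \<mu> x = measure_of (space X) (sets X) (\<lambda>A. emeasure \<mu> A + indicator A x)"

definition rem_pt :: "'a measure \<Rightarrow> 'a measure \<Rightarrow> 'a \<Rightarrow> 'a measure" where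
  "rem_pt X \<mu> x = measure_of (space X) (sets X) (\<lambda>A. emeasure \<mu> A - indicator A x)"

definition sum_msr :: "'a measure \<Rightarrow> 'a measure \<Rightarrow> 'a measure \<Rightarrow> 'a measure" where
  "sum_msr X \<mu> \<nu> = measure_of (space X) (sets X) (\<lambda>A. emeasure \<mu> A + emeasure \<nu> A)"

definition add_cost :: "'a measure \<Rightarrow> ('a measure \<Rightarrow> real) \<Rightarrow> 'a measure \<Rightarrow> 'a \<Rightarrow> real" where
  "add_cost X F \<mu> x = F (add_pt X \<mu> x) - F \<mu>"

definition rem_cost :: "'a measure \<Rightarrow> ('a measure \<Rightarrow> real) \<Rightarrow> 'a measure \<Rightarrow> 'a \<Rightarrow> real" where
  "rem_cost X F \<mu> x = F \<mu> - F (rem_pt X \<mu> x)"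

definition pts_measure :: "'a measure \<Rightarrow> enat \<Rightarrow> (nat \<Rightarrow> bool) \<Rightarrow> (nat \<Rightarrow> 'a) \<Rightarrow> 'a measure" where
  "pts_measure X k S xs = measure_of (space X) (sets X)
      (\<lambda>A. \<Sum>n. if enat n < k \<and> S n then indicator A (xs n) else 0)"

text \<open>Poisson point process (Last--Penrose, Def. 3.1) on X with intensity lam.\<close>
definition poisson_process ::
  "'w measure \<Rightarrow> 'a measure \<Rightarrow> 'a measure \<Rightarrow> ('w \<Rightarrow> 'a measure) \<Rightarrow> bool" where
  "poisson_process M X lam \<eta> \<longleftrightarrow>
     prob_space M \<and> \<eta> \<in> measurable M (N_alg X) \<and>
     (\<forall>A\<in>sets X.
        (emeasure lam A < \<infinity> \<longrightarrow> (\<forall>k::nat.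
            measure M {\<omega>\<in>space M. emeasure (\<eta> \<omega>) A = of_nat k}
              = exp (- enn2real (emeasure lam A)) * enn2real (emeasure lam A) ^ k / fact k)) \<and>
        (emeasure lam A = \<infinity> \<longrightarrow> (AE \<omega> in M. emeasure (\<eta> \<omega>) A = \<infinity>))) \<and>
     (\<forall>(B::nat \<Rightarrow> 'a set) m. (\<forall>i<m. B i \<in> sets X) \<and> disjoint_family_on B {..<m} \<longrightarrow>
        prob_space.indep_vars M (\<lambda>_. borel) (\<lambda>i \<omega>. emeasure (\<eta> \<omega>) (B i)) {..<m})"

end

theory Submission
  imports Defs
begin

text \<open>
  Every law is handled through its generating functional \<open>z \<mapsto> \<^bold>E \<Prod> z x\<close>, the product running over the points
  of the configuration. The joint law of \<open>\<eta>\<close> and \<open>\<eta>\<^sup>t\<close> has generating functional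
  \<open>exp (\<integral>(z - 1) + \<integral>(w - 1) + exp (- t) \<integral>(z - 1) (w - 1))\<close>, whose derivative in \<open>t\<close> comes from the last
  term only; it is \<open>- exp (- t)\<close> times the integral over \<open>x\<close> of \<open>\<^bold>E (D\<^sub>x gen z)(\<eta>) (D\<^sub>x gen w)(\<eta>\<^sup>t)\<close>. By a functional
  monotone class argument this survives for bounded functionals as long as points are resampled only inside a
  set of finite intensity. Exhausting the space and truncating \<open>F\<close> gives
  \<open>Var F = \<integral> exp (- t) \<integral> \<^bold>E D\<^sub>x F(\<eta>) D\<^sub>x F(\<eta>\<^sup>t) \<lambda>(dx) dt\<close>. The reduced Mecke equation for the retained points, obtained
  by differentiating the generating functional in \<open>z\<close>, turns the inner integral into the sum of remove-one costs.
\<close>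

section \<open>Functional monotone class theorem\<close>

text \<open>The derivative in time is used only in integrated form, with \<open>exp (- t) dt\<close>
  read as a probability law: the pair is fully dependent at time 0 and independent at infinity.
  Passing from generating functionals to other functionals needs both sides to be linear and
  continuous under bounded pointwise convergence. Hence the product of add-one costs is first
  replaced by a mixed second difference, which is linear in a functional of two configurations. Such
  a difference is bounded for bounded functionals, but need not be integrable over an infinite
  intensity; this forces the localisation. Localising means that off a set \<open>B\<close> the
  second configuration is replaced by the first one, and the glued configuration is again Poisson.
  When \<open>B\<close> grows and the truncation is lifted, \<open>2 |a b| <= a^2 + b^2\<close> and
  equality of all marginal laws yield the dominating function \<open>E (D_x F)^2\<close>, uniform in
  time. The weight \<open>exp (- t)\<close> is also the retention probability, so it is exactly the
  factor absorbed by the sum over retained points. The hypotheses describe each time separately;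
  measurability in time is read off the explicit generating functional.\<close>

definition bounded_measurable :: "'b measure \<Rightarrow> real \<Rightarrow> ('b \<Rightarrow> real) \<Rightarrow> bool" where
  "bounded_measurable E b f \<longleftrightarrow> f \<in> borel_measurable E \<and> (\<forall>x\<in>space E. \<bar>f x\<bar> \<le> b)"

lemma bounded_measurableD:
  assumes "bounded_measurable E b f"
  shows "f \<in> borel_measurable E" "x \<in> space E \<Longrightarrow> \<bar>f x\<bar> \<le> b"
  using assms by (auto simp: bounded_measurable_def)

lemma bounded_measurable_lin:
  assumes f: "bounded_measurable E a f" and g: "bounded_measurable E b g"
  shows "bounded_measurable E (a + \<bar>r\<bar> * b) (\<lambda>x. f x + r * g x)"
proof -
  have "\<bar>f x + r * g x\<bar> \<le> a + \<bar>r\<bar> * b" if "x \<in> space E" for x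
    using abs_triangle_ineq[of "f x" "r * g x"] bounded_measurableD(2)[OF f that]
      mult_left_mono[OF bounded_measurableD(2)[OF g that], of "\<bar>r\<bar>"] by (simp add: abs_mult)
  then show ?thesis
    using bounded_measurableD(1)[OF f] bounded_measurableD(1)[OF g] by (simp add: bounded_measurable_def)
qed

lemma bounded_measurable_lim:
  assumes f: "\<And>n::nat. bounded_measurable E b (f n)" and l: "\<And>x. x \<in> space E \<Longrightarrow> (\<lambda>n. f n x) \<longlonglongrightarrow> g x"
  shows "bounded_measurable E b g"
proof -
  have "g \<in> borel_measurable E"
    using l bounded_measurableD(1)[OF f] by (rule borel_measurable_LIMSEQ_real)
  moreover have "\<bar>g x\<bar> \<le> b" if "x \<in> space E" for x
    using LIMSEQ_le_const2[OF tendsto_rabs[OF l[OF that]]] bounded_measurableD(2)[OF f that] by blast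
  ultimately show ?thesis by (simp add: bounded_measurable_def)
qed

text \<open>Since \<open>H\<close> is not assumed to be closed under products, the argument runs
  through multipliers: multiplying repeatedly by members of \<open>C\<close> gives polynomials, then
  continuous functions, then indicators of level sets. Finite intersections of level sets form a
  generating pi-system, and the rest is Dynkin induction followed by monotone approximation.\<close>

theorem functional_monotone_class:
  fixes E :: "'b measure" and C :: "('b \<Rightarrow> real) set" and H :: "('b \<Rightarrow> real) \<Rightarrow> bool"
  assumes C_meas: "\<And>c. c \<in> C \<Longrightarrow> c \<in> borel_measurable E"
    and C_bounds: "\<And>c x. c \<in> C \<Longrightarrow> x \<in> space E \<Longrightarrow> 0 \<le> c x \<and> c x \<le> 1"
    and C_one: "(\<lambda>_. 1) \<in> C"
    and C_mult: "\<And>c d. c \<in> C \<Longrightarrow> d \<in> C \<Longrightarrow> \<exists>e\<in>C. \<forall>x\<in>space E. e x = c x * d x"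
    and C_gen: "sets E \<subseteq> sigma_sets (space E) {{x \<in> space E. a < c x} | c a. c \<in> C}"
    and H_C: "\<And>c. c \<in> C \<Longrightarrow> H c"
    and H_lin: "\<And>f g a b r. H f \<Longrightarrow> H g \<Longrightarrow> bounded_measurable E a f \<Longrightarrow> bounded_measurable E b g \<Longrightarrow>
        H (\<lambda>x. f x + r * g x)"
    and H_lim: "\<And>f g b. (\<And>n::nat. H (f n)) \<Longrightarrow> (\<And>n. bounded_measurable E b (f n)) \<Longrightarrow>
        bounded_measurable E b g \<Longrightarrow> (\<And>x. x \<in> space E \<Longrightarrow> (\<lambda>n. f n x) \<longlonglongrightarrow> g x) \<Longrightarrow> H g"
    and f: "bounded_measurable E b f"
  shows "H f"
proof -
  \<comment> \<open>A bound is carried along because \<open>H_lin\<close> and \<open>H_lim\<close>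
    are available only for functions with explicit bounds.\<close>
  define Hb where "Hb f \<longleftrightarrow> H f \<and> (\<exists>b. bounded_measurable E b f)" for f
  have Hb_C: "Hb c" if "c \<in> C" for c
    using H_C[OF that] C_meas[OF that] C_bounds[OF that]
    by (auto simp: Hb_def bounded_measurable_def intro!: exI[of _ 1])
  have Hb_lin: "Hb (\<lambda>x. f x + r * g x)" if "Hb f" "Hb g" for f g r
  proof -
    from that obtain a b where "bounded_measurable E a f" "bounded_measurable E b g"
      unfolding Hb_def by blast
    then show ?thesis
      using that H_lin bounded_measurable_lin unfolding Hb_def by blast
  qed
  have Hb_lim: "Hb g" if "\<And>n::nat. Hb (f n)" "\<And>n x. x \<in> space E \<Longrightarrow> \<bar>f n x\<bar> \<le> b"
    "\<And>x. x \<in> space E \<Longrightarrow> (\<lambda>n. f n x) \<longlonglongrightarrow> g x" for f g b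
  proof -
    have fb: "bounded_measurable E b (f n)" for n
      using that(1)[of n] that(2) by (auto simp: Hb_def bounded_measurable_def)
    have "H (f n)" for n using that(1) by (simp add: Hb_def)
    then show ?thesis
      unfolding Hb_def using H_lim[OF _ fb bounded_measurable_lim[OF fb that(3)] that(3)]
        bounded_measurable_lim[OF fb that(3)] by blast
  qed
  have Hb_cong: "Hb g" if f: "Hb f" and eq: "\<And>x. x \<in> space E \<Longrightarrow> f x = g x" for f g
  proof -
    obtain b where b: "bounded_measurable E b f" using f unfolding Hb_def by blast
    show ?thesis
      by (rule Hb_lim[where f="\<lambda>_. f" and b=b]) (simp_all add: f eq[symmetric] bounded_measurableD(2)[OF b])
  qed
  have Hb_scale: "Hb (\<lambda>x. r * f x)" if "Hb f" for f r
    using Hb_lin[OF that that, of "r - 1"] by (simp add: algebra_simps)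
  \<comment> \<open>Multipliers of \<open>C\<close> into \<open>Hb\<close>. By \<open>C_mult\<close>
    this class is stable under multiplication by members of \<open>C\<close>, a property not known
    for \<open>Hb\<close> itself.\<close>
  define A where "A m \<longleftrightarrow> (\<forall>c\<in>C. Hb (\<lambda>x. m x * c x))" for m
  have A_one: "A (\<lambda>_. 1)"
    using Hb_C by (simp add: A_def)
  have Hb_A: "Hb m" if "A m" for m
  proof -
    have "Hb (\<lambda>x. m x * 1)" using that C_one unfolding A_def by (rule bspec)
    then show ?thesis by simp
  qed
  have A_bound: "\<exists>b. \<forall>x\<in>space E. \<bar>m x\<bar> \<le> b" if "A m" for m
    using Hb_A[OF that] by (auto simp: Hb_def bounded_measurable_def)
  have A_C: "A (\<lambda>x. m x * d x)" if "A m" "d \<in> C" for m d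
    unfolding A_def
  proof
    fix c assume "c \<in> C"
    then obtain e where e: "e \<in> C" "\<forall>x\<in>space E. e x = d x * c x" using C_mult[OF \<open>d \<in> C\<close>] by blast
    show "Hb (\<lambda>x. m x * d x * c x)"
      by (rule Hb_cong[where f="\<lambda>x. m x * e x"]) (use \<open>A m\<close> e in \<open>auto simp: A_def\<close>)
  qed
  have A_lin: "A (\<lambda>x. m x + r * l x)" if "A m" "A l" for m l r
    unfolding A_def
  proof
    fix c assume "c \<in> C"
    then have "Hb (\<lambda>x. m x * c x + r * (l x * c x))" using that by (intro Hb_lin) (simp_all add: A_def)
    then show "Hb (\<lambda>x. (m x + r * l x) * c x)" by (simp add: distrib_right mult.assoc)
  qed
  have A_lim: "A g" if "\<And>n::nat. A (m n)" "\<And>n x. x \<in> space E \<Longrightarrow> \<bar>m n x\<bar> \<le> b"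
    "\<And>x. x \<in> space E \<Longrightarrow> (\<lambda>n. m n x) \<longlonglongrightarrow> g x" for m g b
    unfolding A_def
  proof
    fix c assume c: "c \<in> C"
    show "Hb (\<lambda>x. g x * c x)"
    proof (rule Hb_lim[where f="\<lambda>n x. m n x * c x" and b=b])
      show "Hb (\<lambda>x. m n x * c x)" for n using that(1)[of n] c by (simp add: A_def)
      show "\<bar>m n x * c x\<bar> \<le> b" if "x \<in> space E" for n x
        using C_bounds[OF c that] \<open>\<And>n x. x \<in> space E \<Longrightarrow> \<bar>m n x\<bar> \<le> b\<close>[OF that, of n]
          mult_mono[of "\<bar>m n x\<bar>" b "c x" 1] by (force simp: abs_mult)
      show "(\<lambda>n. m n x * c x) \<longlonglongrightarrow> g x * c x" if "x \<in> space E" for x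
        using \<open>x \<in> space E \<Longrightarrow> (\<lambda>n. m n x) \<longlonglongrightarrow> g x\<close>[OF that] by (intro tendsto_intros)
    qed
  qed
  have A_sum: "A (\<lambda>x. \<Sum>k\<le>n. r k * l k x)" if "\<And>k. A (l k)" for n :: nat and l and r :: "nat \<Rightarrow> real"
  proof (induction n)
    case 0
    then show ?case using A_lin[OF that[of 0] that[of 0], of "r 0 - 1"] by (simp add: algebra_simps)
  next
    case (Suc n)
    then show ?case using A_lin[OF Suc that] by simp
  qed
  \<comment> \<open>Bernstein polynomials in \<open>d\<close> involve only the products
    \<open>m * d^k * (1 - d)^j\<close>, all reached from \<open>m\<close> by multiplying with
    \<open>d\<close> and subtracting; their uniform convergence on the unit interval supplies the
    common bound that \<open>A_lim\<close> asks for.\<close>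
  have A_cont: "A (\<lambda>x. m x * \<phi> (d x))" if m: "A m" and d: "d \<in> C" and \<phi>: "continuous_on {0..1} \<phi>"
    for m d \<phi>
  proof -
    have pow1: "A (\<lambda>x. m x * d x ^ k)" for k
    proof (induction k)
      case (Suc k)
      then show ?case using A_C[OF Suc d] by (simp add: mult_ac)
    qed (use m in simp)
    have pow2: "A (\<lambda>x. m x * d x ^ k * (1 - d x) ^ j)" for k j
    proof (induction j)
      case (Suc j)
      have "A (\<lambda>x. m x * d x ^ k * (1 - d x) ^ j + (-1) * (m x * d x ^ k * (1 - d x) ^ j * d x))"
        by (rule A_lin[OF Suc A_C[OF Suc d]])
      then show ?case by (simp add: algebra_simps)
    qed (use pow1 in simp)
    have AB: "A (\<lambda>x. m x * (\<Sum>k\<le>n. \<phi> (k/n) * Bernstein n k (d x)))" for n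
    proof -
      have "A (\<lambda>x. \<Sum>k\<le>n. (\<phi> (k/n) * of_nat (n choose k)) * (m x * d x ^ k * (1 - d x) ^ (n - k)))"
        by (rule A_sum[OF pow2])
      then show ?thesis
        by (simp add: Bernstein_def sum_distrib_left mult_ac)
    qed
    obtain bm where bm: "\<And>x. x \<in> space E \<Longrightarrow> \<bar>m x\<bar> \<le> bm" using A_bound[OF m] by blast
    have "compact (\<phi> ` {0..1})" using \<phi> by (intro compact_continuous_image) auto
    then obtain b\<phi> where b\<phi>: "\<And>y. y \<in> {0..1} \<Longrightarrow> \<bar>\<phi> y\<bar> \<le> b\<phi>"
      using compact_imp_bounded[THEN bounded_iff[THEN iffD1]] by force
    have "\<exists>n. \<forall>y\<in>{0..1}. \<bar>\<phi> y - (\<Sum>k\<le>n. \<phi> (k/n) * Bernstein n k y)\<bar> < inverse (Suc j)" for j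
      using Bernstein_Weierstrass[OF \<phi>, of "inverse (Suc j)"] by fastforce
    then obtain n where n: "\<And>j y. y \<in> {0..1} \<Longrightarrow>
        \<bar>\<phi> y - (\<Sum>k\<le>n j. \<phi> (k/n j) * Bernstein (n j) k y)\<bar> < inverse (Suc j)"
      by metis
    define p where "p j y = (\<Sum>k\<le>n j. \<phi> (k/n j) * Bernstein (n j) k y)" for j and y :: real
    show ?thesis
    proof (rule A_lim[where m="\<lambda>j x. m x * p j (d x)" and b="bm * (b\<phi> + 1)"])
      show "A (\<lambda>x. m x * p j (d x))" for j using AB[of "n j"] by (simp add: p_def)
      fix x assume x: "x \<in> space E"
      have dx: "d x \<in> {0..1}" using C_bounds[OF d x] by auto
      have pd: "\<bar>\<phi> (d x) - p j (d x)\<bar> \<le> inverse (Suc j)" for j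
        using n[OF dx, of j] by (simp add: p_def)
      have i1: "inverse (real (Suc j)) \<le> 1" for j by (simp add: field_simps)
      show "\<bar>m x * p j (d x)\<bar> \<le> bm * (b\<phi> + 1)" for j
        unfolding abs_mult using bm[OF x] b\<phi>[OF dx] pd[of j] i1[of j] by (intro mult_mono) auto
      have "(\<lambda>j. p j (d x) - \<phi> (d x)) \<longlonglongrightarrow> 0"
        by (rule Lim_null_comparison[OF _ LIMSEQ_inverse_real_of_nat])
          (use pd in \<open>auto simp: abs_minus_commute\<close>)
      then have "(\<lambda>j. p j (d x)) \<longlonglongrightarrow> \<phi> (d x)" by (simp add: LIM_zero_iff)
      then show "(\<lambda>j. m x * p j (d x)) \<longlonglongrightarrow> m x * \<phi> (d x)" by (intro tendsto_intros)
    qed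
  qed
  have A_ind: "A (\<lambda>x. m x * of_bool (a < d x))" if m: "A m" and d: "d \<in> C" for m d a
  proof -
    obtain bm where bm: "\<And>x. x \<in> space E \<Longrightarrow> \<bar>m x\<bar> \<le> bm" using A_bound[OF m] by blast
    \<comment> \<open>Ramps of slope \<open>k\<close> starting at \<open>a\<close>. They vanish at
      \<open>a\<close> itself, so the limit is the indicator of the strict inequality.\<close>
    define \<phi> where "\<phi> k y = min 1 (max 0 (real k * (y - a)))" for k y
    show ?thesis
    proof (rule A_lim[where m="\<lambda>k x. m x * \<phi> k (d x)" and b=bm])
      show "A (\<lambda>x. m x * \<phi> k (d x))" for k
        by (rule A_cont[OF m d]) (auto simp: \<phi>_def intro!: continuous_intros)
      fix x assume x: "x \<in> space E"
      have "0 \<le> \<phi> k (d x) \<and> \<phi> k (d x) \<le> 1" for k by (auto simp: \<phi>_def)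
      then show "\<bar>m x * \<phi> k (d x)\<bar> \<le> bm" for k
        using bm[OF x] mult_mono[of "\<bar>m x\<bar>" bm "\<phi> k (d x)" 1] by (force simp: abs_mult)
      have "(\<lambda>k. \<phi> k (d x)) \<longlonglongrightarrow> of_bool (a < d x)"
      proof (cases "a < d x")
        case True
        then obtain k0 :: nat where "1 / (d x - a) \<le> k0" using real_arch_simple by blast
        then have "\<phi> k (d x) = 1" if "k \<ge> k0" for k
        proof -
          have "1 / (d x - a) \<le> k" using \<open>1 / (d x - a) \<le> k0\<close> that by linarith
          then have "1 \<le> real k * (d x - a)" using True by (simp add: pos_divide_le_eq)
          then show ?thesis unfolding \<phi>_def by linarith
        qed
        then have "\<forall>\<^sub>F k in sequentially. \<phi> k (d x) = of_bool (a < d x)"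
          using True unfolding eventually_sequentially by auto
        then show ?thesis by (rule tendsto_eventually)
      next
        case False
        then have "\<phi> k (d x) = 0" for k
          using mult_nonneg_nonpos[of "real k" "d x - a"] unfolding \<phi>_def by linarith
        then show ?thesis using False by simp
      qed
      then show "(\<lambda>k. m x * \<phi> k (d x)) \<longlonglongrightarrow> m x * of_bool (a < d x)" by (intro tendsto_intros)
    qed
  qed
  \<comment> \<open>The pi-system of finite intersections of strict upper level sets. Repeated use
    of \<open>A_ind\<close> starting from the constant 1 handles each member.\<close>
  define G where "G = {{x \<in> space E. \<forall>(c, a)\<in>J. a < c x} | J. finite J \<and> J \<subseteq> C \<times> (UNIV :: real set)}"
  have A_G: "A (\<lambda>x. of_bool (\<forall>(c, a)\<in>J. a < c x))" if "finite J" "J \<subseteq> C \<times> UNIV"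
    for J :: "(('b \<Rightarrow> real) \<times> real) set"
    using that
  proof (induction J rule: finite_induct)
    case empty
    then show ?case using A_one by simp
  next
    case (insert p J)
    obtain c a where p: "p = (c, a)" by force
    have "A (\<lambda>x. of_bool (\<forall>(c, a)\<in>J. a < c x) * of_bool (a < c x))"
      using insert p by (intro A_ind) auto
    then show ?case by (simp add: p of_bool_conj[symmetric] conj_commute)
  qed
  have Int: "Int_stable G"
  proof (rule Int_stableI)
    fix S T assume "S \<in> G" "T \<in> G"
    obtain J where J: "finite J" "J \<subseteq> C \<times> UNIV" "S = {x \<in> space E. \<forall>(c, a)\<in>J. a < c x}"
      using \<open>S \<in> G\<close> unfolding G_def by blast
    obtain K where K: "finite K" "K \<subseteq> C \<times> UNIV" "T = {x \<in> space E. \<forall>(c, a)\<in>K. a < c x}"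
      using \<open>T \<in> G\<close> unfolding G_def by blast
    have "S \<inter> T = {x \<in> space E. \<forall>(c, a)\<in>J \<union> K. a < c x}"
      unfolding J(3) K(3) by blast
    moreover have "finite (J \<union> K)" "J \<union> K \<subseteq> C \<times> UNIV"
      using J K by simp_all
    ultimately show "S \<inter> T \<in> G" unfolding G_def by blast
  qed
  have G_Pow: "G \<subseteq> Pow (space E)" unfolding G_def by blast
  have "{{x \<in> space E. a < c x} | c a. c \<in> C} \<subseteq> G"
  proof clarify
    fix c a assume "c \<in> C"
    then show "{x \<in> space E. a < c x} \<in> G"
      unfolding G_def by (intro CollectI exI[of _ "{(c, a)}"]) simp
  qed
  then have E_sub: "sets E \<subseteq> sigma_sets (space E) G"
    by (rule order.trans[OF C_gen sigma_sets_mono'])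
  have Hb_zero: "Hb (\<lambda>_. 0)"
    using Hb_scale[OF Hb_C[OF C_one], of 0] by simp
  have Hb_ind: "Hb (indicator S :: 'b \<Rightarrow> real)" if "S \<in> sigma_sets (space E) G" for S
    using Int G_Pow that
  proof (induction rule: sigma_sets_induct_disjoint)
    case (basic S)
    then obtain J where J: "finite J" "J \<subseteq> C \<times> UNIV" "S = {x \<in> space E. \<forall>(c, a)\<in>J. a < c x}"
      unfolding G_def by blast
    show ?case
      by (rule Hb_cong[OF Hb_A[OF A_G[OF J(1,2)]]]) (simp add: J(3) indicator_def)
  next
    case empty
    show ?case by (rule Hb_cong[OF Hb_zero]) simp
  next
    case (compl S)
    show ?case
      by (rule Hb_cong[OF Hb_lin[OF Hb_C[OF C_one] compl(2), of "-1"]]) (simp add: indicator_def)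
  next
    case (union S)
    have "Hb (indicator (\<Union>i<n. S i) :: 'b \<Rightarrow> real)" for n
    proof (induction n)
      case 0
      show ?case by (rule Hb_cong[OF Hb_zero]) simp
    next
      case (Suc n)
      have "x \<notin> S i" if "x \<in> S n" "i < n" for x i
        using union(1) that disjoint_family_onD[of S UNIV i n] by auto
      then show ?case
        by (intro Hb_cong[OF Hb_lin[OF Suc union(3)[of n], of 1]]) (auto simp: indicator_def less_Suc_eq)
    qed
    then show ?case
      by (rule Hb_lim[where f="\<lambda>n. indicator (\<Union>i<n. S i)" and b=1])
        (simp add: indicator_def, rule LIMSEQ_indicator_UN)
  qed
  have Hb_nonneg: "Hb u" if u: "u \<in> borel_measurable E" "\<And>x. 0 \<le> u x" "\<And>x. x \<in> space E \<Longrightarrow> u x \<le> b" for u b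
  proof -
    have "\<forall>b. (\<forall>x\<in>space E. u x \<le> b) \<longrightarrow> Hb u"
      using u(1,2)
    proof (induction rule: borel_measurable_induct_real)
      case (set S)
      then show ?case using Hb_ind E_sub by auto
    next
      case (mult u c)
      show ?case
      proof (cases "c = 0")
        case True
        then show ?thesis using Hb_zero by simp
      next
        case False
        with mult have c: "0 < c" by simp
        { fix b assume "\<forall>x\<in>space E. c * u x \<le> b"
          then have "\<forall>x\<in>space E. u x \<le> b / c" using c by (auto simp: field_simps)
          then have "Hb u" using mult by blast }
        then show ?thesis using Hb_scale by blast
      qed
    next
      case (add u v)
      { fix b assume b: "\<forall>x\<in>space E. v x + u x \<le> b"
        then have "\<forall>x\<in>space E. u x \<le> b" "\<forall>x\<in>space E. v x \<le> b"
          using add by (smt (verit))+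
        then have "Hb u" "Hb v" using add by blast+
        then have "Hb (\<lambda>x. v x + u x)" using Hb_lin[of v u 1] by simp }
      then show ?case by blast
    next
      case (seq U)
      { fix b assume b: "\<forall>x\<in>space E. u x \<le> b"
        have le: "U i x \<le> b" if "x \<in> space E" for i x
        proof -
          have "U i x \<le> u x"
            using \<open>incseq U\<close> \<open>x \<in> space E \<Longrightarrow> (\<lambda>i. U i x) \<longlonglongrightarrow> u x\<close>[OF that]
            by (intro incseq_le) (auto simp: incseq_def le_fun_def)
          then show ?thesis using b that by force
        qed
        then have "\<And>i. Hb (U i)" using seq by blast
        then have "Hb u" by (rule Hb_lim[where f=U and b=b]) (use le seq in auto) }
      then show ?case by blast
    qed
    then show ?thesis using u by blast
  qed
  note fD = bounded_measurableD[OF f]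
  \<comment> \<open>The induction behind \<open>Hb_nonneg\<close> wants nonnegativity on the whole
    type, whereas \<open>f + b\<close> is nonnegative only on \<open>space E\<close>; hence the
    maximum. The absolute value in the bound covers an empty space with negative
    \<open>b\<close>.\<close>
  have "max 0 (f x + b) \<le> \<bar>2 * b\<bar>" if "x \<in> space E" for x
    using fD(2)[OF that] by linarith
  then have "Hb (\<lambda>x. max 0 (f x + b))"
    by (intro Hb_nonneg[where b="\<bar>2 * b\<bar>"]) (use fD(1) in auto)
  from Hb_lin[OF this Hb_C[OF C_one], of "- b"] have "Hb f"
  proof (rule Hb_cong)
    show "max 0 (f x + b) + - b * 1 = f x" if "x \<in> space E" for x
      using fD(2)[OF that] by linarith
  qed
  then show ?thesis by (simp add: Hb_def)
qed

section \<open>Counting measures\<close>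

text \<open>The case distinction is needed because \<^term>\<open>enn2real \<top> = 0\<close>.\<close>

definition exp_neg :: "ennreal \<Rightarrow> real" where
  "exp_neg x = (if x = \<top> then 0 else exp (- enn2real x))"

section \<open>The function exp(-x) on the extended half-line\<close>

lemma exp_neg_nonneg [simp]: "0 \<le> exp_neg x"
  by (simp add: exp_neg_def)

lemma exp_neg_le_1 [simp]: "exp_neg x \<le> 1"
  by (simp add: exp_neg_def)

lemma exp_neg_ennreal: "0 \<le> r \<Longrightarrow> exp_neg (ennreal r) = exp (- r)"
  by (simp add: exp_neg_def)

lemma exp_neg_0 [simp]: "exp_neg 0 = 1"
  by (simp add: exp_neg_def)

lemma exp_neg_add: "exp_neg (x + y) = exp_neg x * exp_neg y"
  by (cases x; cases y) (auto simp: exp_neg_def enn2real_plus less_top[symmetric] ennreal_plus[symmetric]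
      exp_add[symmetric] simp del: ennreal_plus)

lemma exp_neg_antimono: "x \<le> y \<Longrightarrow> exp_neg y \<le> exp_neg x"
  by (auto simp: exp_neg_def top_unique less_top intro!: enn2real_mono)

lemma measurable_exp_neg [measurable]: "exp_neg \<in> borel_measurable borel"
  unfolding exp_neg_def[abs_def] by measurable

text \<open>Continuity at infinity is the point: it lets finite products over the listed points
  converge to 0 when the sum of their logarithms diverges.\<close>

lemma tendsto_exp_neg:
  assumes "(f \<longlongrightarrow> a) F"
  shows "((\<lambda>x. exp_neg (f x)) \<longlongrightarrow> exp_neg a) F"
proof (cases "a = \<top>")
  case False
  then have "\<forall>\<^sub>F x in F. f x < \<top>"
    using assms by (intro order_tendstoD) (auto simp: less_top)
  then have "\<forall>\<^sub>F x in F. exp (- enn2real (f x)) = exp_neg (f x)"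
    by eventually_elim (auto simp: exp_neg_def)
  moreover have "((\<lambda>x. exp (- enn2real (f x))) \<longlongrightarrow> exp (- enn2real a)) F"
    using assms False by (intro tendsto_intros) (auto simp: less_top)
  ultimately show ?thesis
    using False by (auto simp: exp_neg_def[of a] dest: Lim_transform_eventually)
next
  case True
  show ?thesis
  proof (rule tendstoI)
    fix e :: real assume e: "0 < e"
    define r where "r = max 0 (- ln e) + 1"
    have r: "0 \<le> r" "- ln e < r" by (auto simp: r_def)
    have "exp (- r) < e"
      using r e by (metis exp_less_cancel_iff exp_ln minus_less_iff)
    have "\<forall>\<^sub>F x in F. ennreal r < f x"
      using assms True by (intro order_tendstoD) auto
    then show "\<forall>\<^sub>F x in F. dist (exp_neg (f x)) (exp_neg a) < e"
    proof eventually_elim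
      case (elim x)
      have "exp_neg (f x) \<le> exp (- r)"
        using exp_neg_antimono[of "ennreal r" "f x"] elim r by (simp add: exp_neg_ennreal)
      then show ?case using \<open>exp (- r) < e\<close> True by (simp add: exp_neg_def[of \<top>])
    qed
  qed
qed

text \<open>Countable additivity of \<open>f\<close> need not be checked, because agreement with the
  measure \<open>P\<close> on all measurable sets already supplies it.\<close>

lemma measure_of_sets_eqI:
  assumes "sets P = sets X" "\<And>A. A \<in> sets X \<Longrightarrow> f A = emeasure P A"
  shows "measure_of (space X) (sets X) f = P"
proof -
  have "measure_of (space X) (sets X) f = measure_of (space X) (sets X) (emeasure P)"
    using assms(2) by (intro measure_of_eq) (auto simp: sets.space_closed sets.sigma_sets_eq)
  also have "\<dots> = measure_of (space P) (sets P) (emeasure P)"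
    using assms(1) sets_eq_imp_space_eq[OF assms(1)] by simp
  also have "\<dots> = P" by (rule measure_of_of_measure)
  finally show ?thesis .
qed

section \<open>Superpositions and point lists as measures\<close>

lemma sets_sum_msr [simp, measurable_cong]: "sets (sum_msr X \<mu> \<nu>) = sets X"
  by (simp add: sum_msr_def)

lemma space_sum_msr [simp]: "space (sum_msr X \<mu> \<nu>) = space X"
  by (simp add: sum_msr_def)

lemma emeasure_sum_msr:
  assumes "sets \<mu> = sets X" "sets \<nu> = sets X" "A \<in> sets X"
  shows "emeasure (sum_msr X \<mu> \<nu>) A = emeasure \<mu> A + emeasure \<nu> A"
  unfolding sum_msr_def
proof (rule emeasure_measure_of_sigma)
  show "sigma_algebra (space X) (sets X)" ..
  show "positive (sets X) (\<lambda>A. emeasure \<mu> A + emeasure \<nu> A)" by (simp add: positive_def)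
  show "countably_additive (sets X) (\<lambda>A. emeasure \<mu> A + emeasure \<nu> A)"
  proof (rule countably_additiveI)
    fix A :: "nat \<Rightarrow> 'a set" assume A: "range A \<subseteq> sets X" "disjoint_family A"
    have "(\<Sum>i. emeasure \<mu> (A i) + emeasure \<nu> (A i)) = (\<Sum>i. emeasure \<mu> (A i)) + (\<Sum>i. emeasure \<nu> (A i))"
      by (intro suminf_add[symmetric]) auto
    then show "(\<Sum>i. emeasure \<mu> (A i) + emeasure \<nu> (A i)) = emeasure \<mu> (\<Union> (range A)) + emeasure \<nu> (\<Union> (range A))"
      using A assms by (simp add: suminf_emeasure)
  qed
qed fact

lemma nn_integral_sum_msr:
  assumes \<mu>: "sets \<mu> = sets X" and \<nu>: "sets \<nu> = sets X" and f: "f \<in> borel_measurable X"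
  shows "(\<integral>\<^sup>+x. f x \<partial>sum_msr X \<mu> \<nu>) = (\<integral>\<^sup>+x. f x \<partial>\<mu>) + (\<integral>\<^sup>+x. f x \<partial>\<nu>)"
  using f
proof (induction rule: borel_measurable_induct)
  case (cong f g)
  have "space \<mu> = space X" "space \<nu> = space X" using \<mu> \<nu> by (auto dest: sets_eq_imp_space_eq)
  then show ?case using cong(4) by (simp add: cong(3) cong: nn_integral_cong_simp)
next
  case (set A)
  then show ?case using \<mu> \<nu> by (simp add: emeasure_sum_msr)
next
  case (mult u c)
  then show ?case using \<mu> \<nu> by (simp add: nn_integral_cmult distrib_left cong: measurable_cong_sets)
next
  case (add u v)
  then show ?case using \<mu> \<nu>
    by (simp add: nn_integral_add ac_simps cong: measurable_cong_sets)
next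
  case (seq U)
  have [simp]: "(\<integral>\<^sup>+x. (SUP i. U i x) \<partial>m) = (SUP i. \<integral>\<^sup>+x. U i x \<partial>m)" if "sets m = sets X" for m
    using seq that by (intro nn_integral_monotone_convergence_SUP) (auto cong: measurable_cong_sets)
  have "incseq (\<lambda>i. \<integral>\<^sup>+x. U i x \<partial>m)" for m
    using seq by (auto simp: incseq_def le_fun_def intro!: nn_integral_mono)
  then show ?case
    using seq \<mu> \<nu> by (simp add: SUP_apply[abs_def] image_comp ennreal_SUP_add)
qed

text \<open>Adding a point is superposition with a Dirac mass, so measurability and the counting
  property have to be proved for superpositions only.\<close>

lemma add_pt_eq_sum_msr: "add_pt X \<mu> x = sum_msr X \<mu> (return X x)"
  unfolding add_pt_def sum_msr_def
  by (intro measure_of_eq) (auto simp: sets.space_closed sets.sigma_sets_eq indicator_def)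

lemma sets_add_pt [simp, measurable_cong]: "sets (add_pt X \<mu> x) = sets X"
  by (simp add: add_pt_def)

text \<open>A point list is the push-forward of counting measure on its selected indices; coinciding
  positions are thereby counted with multiplicity.\<close>

lemma pts_measure_eq_distr:
  assumes "\<And>n. xs n \<in> space X"
  shows "pts_measure X k S xs =
    distr (density (count_space UNIV) (\<lambda>n. of_bool (enat n < k \<and> S n))) X xs"
  unfolding pts_measure_def
proof (rule measure_of_sets_eqI)
  fix A assume A: "A \<in> sets X"
  have "emeasure (distr (density (count_space UNIV) (\<lambda>n. of_bool (enat n < k \<and> S n))) X xs) A
     = (\<integral>\<^sup>+n. of_bool (enat n < k \<and> S n) * indicator (xs -` A) n \<partial>count_space UNIV)"
    using A assms by (simp add: emeasure_distr emeasure_density)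
  also have "\<dots> = (\<Sum>n. of_bool (enat n < k \<and> S n) * indicator (xs -` A) n)"
    by (rule nn_integral_count_space_nat)
  also have "\<dots> = (\<Sum>n. if enat n < k \<and> S n then indicator A (xs n) else 0)"
    by (intro arg_cong[where f=suminf]) (auto simp: fun_eq_iff indicator_def)
  finally show "(\<Sum>n. if enat n < k \<and> S n then indicator A (xs n) else 0) =
    emeasure (distr (density (count_space UNIV) (\<lambda>n. of_bool (enat n < k \<and> S n))) X xs) A" by simp
qed simp

lemma sets_pts_measure [simp, measurable_cong]: "sets (pts_measure X k S xs) = sets X"
  by (simp add: pts_measure_def)

lemma nn_integral_pts_measure:
  assumes "\<And>n. xs n \<in> space X" "f \<in> borel_measurable X"
  shows "(\<integral>\<^sup>+x. f x \<partial>pts_measure X k S xs) = (\<Sum>n. if enat n < k \<and> S n then f (xs n) else 0)"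
proof -
  have "(\<integral>\<^sup>+x. f x \<partial>pts_measure X k S xs)
     = (\<integral>\<^sup>+n. of_bool (enat n < k \<and> S n) * f (xs n) \<partial>count_space UNIV)"
    using assms by (simp add: pts_measure_eq_distr nn_integral_distr nn_integral_density)
  also have "\<dots> = (\<Sum>n. of_bool (enat n < k \<and> S n) * f (xs n))"
    by (rule nn_integral_count_space_nat)
  also have "\<dots> = (\<Sum>n. if enat n < k \<and> S n then f (xs n) else 0)"
    by (intro arg_cong[where f=suminf]) (auto simp: fun_eq_iff)
  finally show ?thesis .
qed

lemma emeasure_pts_measure:
  assumes "\<And>n. xs n \<in> space X" "A \<in> sets X"
  shows "emeasure (pts_measure X k S xs) A = (\<Sum>n. if enat n < k \<and> S n then indicator A (xs n) else 0)"
  using nn_integral_pts_measure[OF assms(1), of "indicator A"] assms(2) by simp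

section \<open>The measurable space of sigma-finite counting measures\<close>

lemma space_N_alg: "space (N_alg X) = counting_measures X"
proof -
  have "space (SUP A \<in> sets X. vimage_algebra (counting_measures X) (\<lambda>\<mu>. emeasure \<mu> A) borel)
      = (\<Union>A\<in>sets X. counting_measures X)"
    by (simp add: space_Sup_eq_UN image_image)
  then show ?thesis unfolding N_alg_def by blast
qed

lemma sets_counting: "\<mu> \<in> space (N_alg X) \<Longrightarrow> sets \<mu> = sets X"
  by (simp add: space_N_alg counting_measures_def)

lemma measurable_N_algI:
  assumes "\<And>s. s \<in> space S \<Longrightarrow> f s \<in> counting_measures X"
    and "\<And>A. A \<in> sets X \<Longrightarrow> (\<lambda>s. emeasure (f s) A) \<in> borel_measurable S"
  shows "f \<in> S \<rightarrow>\<^sub>M N_alg X"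
  unfolding N_alg_def
proof (rule measurable_SUP2)
  show "sets X \<noteq> {}" by blast
  show "f \<in> S \<rightarrow>\<^sub>M vimage_algebra (counting_measures X) (\<lambda>\<mu>. emeasure \<mu> A) borel" if "A \<in> sets X" for A
    using assms that by (intro measurable_vimage_algebra2) auto
qed simp

lemma measurable_emeasure_N_alg [measurable]:
  assumes "A \<in> sets X"
  shows "(\<lambda>\<mu>. emeasure \<mu> A) \<in> borel_measurable (N_alg X)"
  unfolding N_alg_def using assms
  by (intro measurable_SUP1[where i=A]) (auto intro!: measurable_vimage_algebra1)

lemma measurable_nn_integral_N_alg:
  assumes "f \<in> borel_measurable X"
  shows "(\<lambda>\<mu>. \<integral>\<^sup>+x. f x \<partial>\<mu>) \<in> borel_measurable (N_alg X)"
  using assms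
proof (induction rule: borel_measurable_induct)
  case (cong f g)
  have "(\<integral>\<^sup>+x. f x \<partial>\<mu>) = (\<integral>\<^sup>+x. g x \<partial>\<mu>)" if "\<mu> \<in> space (N_alg X)" for \<mu>
    using sets_eq_imp_space_eq[OF sets_counting[OF that]] cong(3) by (intro nn_integral_cong) auto
  then show ?case using cong(4) by (simp cong: measurable_cong)
next
  case (set A)
  have "(\<integral>\<^sup>+x. indicator A x \<partial>\<mu>) = emeasure \<mu> A" if "\<mu> \<in> space (N_alg X)" for \<mu>
    using set sets_counting[OF that] by simp
  then show ?case using set by (simp cong: measurable_cong)
next
  case (mult u c)
  have "(\<integral>\<^sup>+x. c * u x \<partial>\<mu>) = c * (\<integral>\<^sup>+x. u x \<partial>\<mu>)" if "\<mu> \<in> space (N_alg X)" for \<mu>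
    using mult sets_counting[OF that] by (intro nn_integral_cmult) (simp cong: measurable_cong_sets)
  then show ?case using mult by (simp cong: measurable_cong)
next
  case (add u v)
  have "(\<integral>\<^sup>+x. v x + u x \<partial>\<mu>) = (\<integral>\<^sup>+x. v x \<partial>\<mu>) + (\<integral>\<^sup>+x. u x \<partial>\<mu>)" if "\<mu> \<in> space (N_alg X)" for \<mu>
    using add sets_counting[OF that] by (intro nn_integral_add) (simp_all cong: measurable_cong_sets)
  then show ?case using add by (simp cong: measurable_cong)
next
  case (seq U)
  have "(\<integral>\<^sup>+x. (SUP i. U i) x \<partial>\<mu>) = (SUP i. \<integral>\<^sup>+x. U i x \<partial>\<mu>)" if "\<mu> \<in> space (N_alg X)" for \<mu>
    unfolding SUP_apply using seq sets_counting[OF that]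
    by (intro nn_integral_monotone_convergence_SUP) (auto cong: measurable_cong_sets)
  then show ?case using seq by (simp cong: measurable_cong)
qed

lemma counting_value_add:
  "a \<in> range of_nat \<union> {\<infinity>} \<Longrightarrow> b \<in> range of_nat \<union> {\<infinity>} \<Longrightarrow> a + b \<in> range of_nat \<union> {\<infinity> :: ennreal}"
  by (auto simp: of_nat_add[symmetric] simp del: of_nat_add)

lemma sum_msr_counting:
  assumes \<mu>: "\<mu> \<in> counting_measures X" and \<nu>: "\<nu> \<in> counting_measures X"
  shows "sum_msr X \<mu> \<nu> \<in> counting_measures X"
proof -
  have s: "sets \<mu> = sets X" "sets \<nu> = sets X" using assms by (auto simp: counting_measures_def)
  then have sp: "space \<mu> = space X" "space \<nu> = space X" by (auto dest: sets_eq_imp_space_eq)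
  interpret \<mu>: sigma_finite_measure \<mu> using \<mu> by (simp add: counting_measures_def)
  interpret \<nu>: sigma_finite_measure \<nu> using \<nu> by (simp add: counting_measures_def)
  obtain A where A: "countable A" "A \<subseteq> sets \<mu>" "\<Union>A = space \<mu>" "\<forall>a\<in>A. emeasure \<mu> a \<noteq> \<infinity>"
    using \<mu>.sigma_finite_countable by blast
  obtain B where B: "countable B" "B \<subseteq> sets \<nu>" "\<Union>B = space \<nu>" "\<forall>b\<in>B. emeasure \<nu> b \<noteq> \<infinity>"
    using \<nu>.sigma_finite_countable by blast
  have "sigma_finite_measure (sum_msr X \<mu> \<nu>)"
  proof
    show "\<exists>C. countable C \<and> C \<subseteq> sets (sum_msr X \<mu> \<nu>) \<and> \<Union>C = space (sum_msr X \<mu> \<nu>) \<and>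
        (\<forall>c\<in>C. emeasure (sum_msr X \<mu> \<nu>) c \<noteq> \<infinity>)"
    proof (intro exI conjI ballI)
      \<comment> \<open>Pairwise intersections of the two countable covers: each piece has finite
        mass for both summands.\<close>
      let ?C = "(\<lambda>(a, b). a \<inter> b) ` (A \<times> B)"
      show "countable ?C" using A B by auto
      show "?C \<subseteq> sets (sum_msr X \<mu> \<nu>)" using A B s by auto
      show "\<Union>?C = space (sum_msr X \<mu> \<nu>)" using A(3) B(3) sp by fastforce
      fix c assume "c \<in> ?C"
      then obtain a b where ab: "a \<in> A" "b \<in> B" "c = a \<inter> b" by auto
      have *: "a \<in> sets X" "b \<in> sets X" using ab A B s by auto
      have "emeasure \<mu> c \<le> emeasure \<mu> a" "emeasure \<nu> c \<le> emeasure \<nu> b"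
        using ab * s by (auto intro!: emeasure_mono)
      moreover have "emeasure \<mu> a < \<infinity>" "emeasure \<nu> b < \<infinity>" using A(4) B(4) ab by (auto simp: less_top)
      ultimately show "emeasure (sum_msr X \<mu> \<nu>) c \<noteq> \<infinity>"
        using * ab s by (auto simp: emeasure_sum_msr top_unique)
    qed
  qed
  moreover have "emeasure (sum_msr X \<mu> \<nu>) A \<in> range of_nat \<union> {\<infinity>}" if "A \<in> sets X" for A
    unfolding emeasure_sum_msr[OF s that]
    using assms that by (intro counting_value_add) (auto simp: counting_measures_def)
  ultimately show ?thesis by (simp add: counting_measures_def)
qed

text \<open>Integer values alone do not make a measure sigma-finite; the property is inherited from
  a dominating counting measure. This serves restrictions to a set and thinned point lists.\<close>

lemma counting_submeasure:
  assumes \<mu>: "\<mu> \<in> counting_measures X" and \<nu>: "sets \<nu> = sets X"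
    and le: "\<And>A. A \<in> sets X \<Longrightarrow> emeasure \<nu> A \<le> emeasure \<mu> A"
    and count: "\<And>A. A \<in> sets X \<Longrightarrow> emeasure \<nu> A \<in> range of_nat \<union> {\<infinity>}"
  shows "\<nu> \<in> counting_measures X"
proof -
  have s: "sets \<mu> = sets X" using assms by (auto simp: counting_measures_def)
  then have sp: "space \<mu> = space X" "space \<nu> = space X" using \<nu> by (auto dest: sets_eq_imp_space_eq)
  interpret \<mu>: sigma_finite_measure \<mu> using \<mu> by (simp add: counting_measures_def)
  obtain A where A: "countable A" "A \<subseteq> sets \<mu>" "\<Union>A = space \<mu>" "\<forall>a\<in>A. emeasure \<mu> a \<noteq> \<infinity>"
    using \<mu>.sigma_finite_countable by blast
  have "\<forall>a\<in>A. emeasure \<nu> a \<noteq> \<infinity>"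
    using A le s by (metis infinity_ennreal_def neq_top_trans subsetD)
  then have "sigma_finite_measure \<nu>"
    using A s sp \<nu> by unfold_locales auto
  then show ?thesis using \<nu> count by (simp add: counting_measures_def)
qed

lemma return_counting:
  assumes "x \<in> space X" shows "return X x \<in> counting_measures X"
proof -
  interpret prob_space "return X x" using assms by (rule prob_space_return)
  have "indicator A x \<in> range of_nat \<union> {\<infinity> :: ennreal}" for A
    by (cases "x \<in> A") (auto intro!: image_eqI[of _ _ "1::nat"] image_eqI[of _ _ "0::nat"])
  then show ?thesis
    using sigma_finite_measure_axioms by (auto simp: counting_measures_def)
qed

lemma pts_measure_counting_value:
  assumes "\<And>n. xs n \<in> space X" "A \<in> sets X"
  shows "emeasure (pts_measure X k S xs) A \<in> range of_nat \<union> {\<infinity>}"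
proof -
  have "emeasure (pts_measure X k S xs) A = (\<Sum>n. indicator {n. enat n < k \<and> S n \<and> xs n \<in> A} n)"
    unfolding emeasure_pts_measure[OF assms]
    by (intro arg_cong[where f=suminf]) (auto simp: fun_eq_iff indicator_def)
  also have "\<dots> = (\<integral>\<^sup>+n. indicator {n. enat n < k \<and> S n \<and> xs n \<in> A} n \<partial>count_space UNIV)"
    by (rule nn_integral_count_space_nat[symmetric])
  also have "\<dots> = emeasure (count_space UNIV) {n. enat n < k \<and> S n \<and> xs n \<in> A}" by simp
  finally show ?thesis by (auto simp: emeasure_count_space)
qed

lemma pts_measure_counting_mono:
  assumes xs: "\<And>n. xs n \<in> space X" and "pts_measure X k T xs \<in> counting_measures X"
    and "\<And>n. S n \<Longrightarrow> T n"
  shows "pts_measure X k S xs \<in> counting_measures X"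
proof (rule counting_submeasure[OF assms(2)])
  fix A assume A: "A \<in> sets X"
  show "emeasure (pts_measure X k S xs) A \<le> emeasure (pts_measure X k T xs) A"
    unfolding emeasure_pts_measure[OF xs A] using assms(3) by (intro suminf_le) auto
  show "emeasure (pts_measure X k S xs) A \<in> range of_nat \<union> {\<infinity>}"
    by (rule pts_measure_counting_value[OF xs A])
qed simp

lemma measurable_sum_msr:
  "(\<lambda>(\<mu>, \<nu>). sum_msr X \<mu> \<nu>) \<in> N_alg X \<Otimes>\<^sub>M N_alg X \<rightarrow>\<^sub>M N_alg X"
proof (rule measurable_N_algI)
  fix p assume "p \<in> space (N_alg X \<Otimes>\<^sub>M N_alg X)"
  then show "(case p of (\<mu>, \<nu>) \<Rightarrow> sum_msr X \<mu> \<nu>) \<in> counting_measures X"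
    by (auto simp: space_pair_measure space_N_alg intro!: sum_msr_counting)
next
  fix A assume [measurable]: "A \<in> sets X"
  have "(\<lambda>p. emeasure (fst p) A + emeasure (snd p) A) \<in> borel_measurable (N_alg X \<Otimes>\<^sub>M N_alg X)"
    by measurable
  then show "(\<lambda>p. emeasure (case p of (\<mu>, \<nu>) \<Rightarrow> sum_msr X \<mu> \<nu>) A) \<in> borel_measurable (N_alg X \<Otimes>\<^sub>M N_alg X)"
    by (rule measurable_cong[THEN iffD1, rotated])
      (auto simp: space_pair_measure emeasure_sum_msr sets_counting)
qed

lemma measurable_return_N_alg: "return X \<in> X \<rightarrow>\<^sub>M N_alg X"
proof (rule measurable_N_algI)
  fix A assume [measurable]: "A \<in> sets X"
  have "(\<lambda>x. indicator A x :: ennreal) \<in> borel_measurable X" by measurable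
  then show "(\<lambda>x. emeasure (return X x) A) \<in> borel_measurable X"
    by simp
qed (rule return_counting)

lemma measurable_add_pt [measurable (raw)]:
  assumes f: "f \<in> S \<rightarrow>\<^sub>M N_alg X" and g: "g \<in> S \<rightarrow>\<^sub>M X"
  shows "(\<lambda>s. add_pt X (f s) (g s)) \<in> S \<rightarrow>\<^sub>M N_alg X"
  unfolding add_pt_eq_sum_msr
  using measurable_compose[OF measurable_Pair[OF f measurable_compose[OF g measurable_return_N_alg]] measurable_sum_msr]
  by simp

lemma add_pt_counting: "\<mu> \<in> space (N_alg X) \<Longrightarrow> x \<in> space X \<Longrightarrow> add_pt X \<mu> x \<in> space (N_alg X)"
  by (simp add: add_pt_eq_sum_msr space_N_alg sum_msr_counting return_counting)

text \<open>The configuration that agrees with \<open>\<nu>\<close> on \<open>B\<close> and with \<open>\<mu>\<close> off \<open>B\<close>.\<close>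

definition glue :: "'a measure \<Rightarrow> 'a set \<Rightarrow> 'a measure \<Rightarrow> 'a measure \<Rightarrow> 'a measure" where
  "glue X B \<mu> \<nu> = sum_msr X (density \<nu> (indicator B)) (density \<mu> (indicator (space X - B)))"

lemma restrict_counting:
  assumes "\<mu> \<in> counting_measures X" "B \<in> sets X"
  shows "density \<mu> (indicator B) \<in> counting_measures X"
proof (rule counting_submeasure[OF assms(1)])
  have s: "sets \<mu> = sets X" using assms by (simp add: counting_measures_def)
  then show "sets (density \<mu> (indicator B)) = sets X" by simp
  fix A assume A: "A \<in> sets X"
  have eq: "emeasure (density \<mu> (indicator B)) A = emeasure \<mu> (A \<inter> B)"
    using A s assms by (simp add: emeasure_density indicator_inter_arith[symmetric] mult.commute cong: measurable_cong_sets)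
  show "emeasure (density \<mu> (indicator B)) A \<le> emeasure \<mu> A"
    unfolding eq using A s assms by (intro emeasure_mono) auto
  show "emeasure (density \<mu> (indicator B)) A \<in> range of_nat \<union> {\<infinity>}"
    unfolding eq using assms A by (auto simp: counting_measures_def)
qed

lemma measurable_restrict_N_alg:
  assumes [measurable]: "B \<in> sets X"
  shows "(\<lambda>\<mu>. density \<mu> (indicator B)) \<in> N_alg X \<rightarrow>\<^sub>M N_alg X"
proof (rule measurable_N_algI)
  fix A assume [measurable]: "A \<in> sets X"
  have "(\<lambda>\<mu>. emeasure \<mu> (A \<inter> B)) \<in> borel_measurable (N_alg X)" by measurable
  then show "(\<lambda>\<mu>. emeasure (density \<mu> (indicator B)) A) \<in> borel_measurable (N_alg X)"
    by (rule measurable_cong[THEN iffD1, rotated])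
      (simp add: emeasure_density sets_counting indicator_inter_arith[symmetric] mult.commute cong: measurable_cong_sets)
qed (use assms in \<open>simp add: space_N_alg restrict_counting\<close>)

lemma measurable_glue [measurable (raw)]:
  assumes f: "f \<in> S \<rightarrow>\<^sub>M N_alg X" and g: "g \<in> S \<rightarrow>\<^sub>M N_alg X" and B: "B \<in> sets X"
  shows "(\<lambda>s. glue X B (f s) (g s)) \<in> S \<rightarrow>\<^sub>M N_alg X"
proof -
  have B': "space X - B \<in> sets X" using B by auto
  show ?thesis
    unfolding glue_def
    using measurable_compose[OF measurable_Pair[OF
        measurable_compose[OF g measurable_restrict_N_alg[OF B]]
        measurable_compose[OF f measurable_restrict_N_alg[OF B']]] measurable_sum_msr]
    by simp
qed

section \<open>Generating functionals\<close>

text \<open>For a point configuration \<open>\<mu>\<close> this is the product of \<open>z x\<close> over the points \<open>x\<close> of \<open>\<mu>\<close>; the integral form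
  makes sense for every measure in \<open>\<^bold>N\<close>.\<close>

definition gen :: "('a \<Rightarrow> real) \<Rightarrow> 'a measure \<Rightarrow> real" where
  "gen z \<mu> = exp_neg (\<integral>\<^sup>+x. ennreal (- ln (z x)) \<partial>\<mu>)"

lemma gen_nonneg [simp]: "0 \<le> gen z \<mu>"
  by (simp add: gen_def)

lemma gen_le_1 [simp]: "gen z \<mu> \<le> 1"
  by (simp add: gen_def)

lemma abs_gen_le_1 [simp]: "\<bar>gen z \<mu>\<bar> \<le> 1"
  by (simp add: abs_le_iff order.trans[OF _ gen_nonneg])

lemma gen_one [simp]: "gen (\<lambda>_. 1) \<mu> = 1"
  by (simp add: gen_def)

lemma measurable_gen [measurable]:
  assumes "z \<in> borel_measurable X"
  shows "gen z \<in> borel_measurable (N_alg X)"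
proof -
  have [measurable]: "(\<lambda>\<mu>. \<integral>\<^sup>+x. ennreal (- ln (z x)) \<partial>\<mu>) \<in> borel_measurable (N_alg X)"
    using assms by (intro measurable_nn_integral_N_alg) measurable
  show ?thesis unfolding gen_def[abs_def] by measurable
qed

lemma gen_mult:
  assumes "z \<in> borel_measurable X" "w \<in> borel_measurable X" "sets \<mu> = sets X"
    and "\<And>x. 0 < z x \<and> z x \<le> 1" "\<And>x. 0 < w x \<and> w x \<le> 1"
  shows "gen (\<lambda>x. z x * w x) \<mu> = gen z \<mu> * gen w \<mu>"
proof -
  have [measurable]: "z \<in> borel_measurable \<mu>" "w \<in> borel_measurable \<mu>"
    using assms(1-3) by (simp_all cong: measurable_cong_sets)
  have "ennreal (- ln (z x * w x)) = ennreal (- ln (z x)) + ennreal (- ln (w x))" for x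
    using assms(4)[of x] assms(5)[of x] by (subst ennreal_plus[symmetric]) (auto simp: ln_mult_pos)
  then have "(\<integral>\<^sup>+x. ennreal (- ln (z x * w x)) \<partial>\<mu>)
      = (\<integral>\<^sup>+x. ennreal (- ln (z x)) \<partial>\<mu>) + (\<integral>\<^sup>+x. ennreal (- ln (w x)) \<partial>\<mu>)"
    by (simp add: nn_integral_add)
  then show ?thesis by (simp add: gen_def exp_neg_add)
qed

lemma gen_sum_msr:
  assumes "sets \<mu> = sets X" "sets \<nu> = sets X" "z \<in> borel_measurable X"
  shows "gen z (sum_msr X \<mu> \<nu>) = gen z \<mu> * gen z \<nu>"
proof -
  have "(\<lambda>x. ennreal (- ln (z x))) \<in> borel_measurable X" using assms by measurable
  then show ?thesis using assms by (simp add: gen_def nn_integral_sum_msr exp_neg_add)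
qed

lemma gen_add_pt:
  assumes "sets \<mu> = sets X" "z \<in> borel_measurable X" "x \<in> space X" "0 < z x" "z x \<le> 1"
  shows "gen z (add_pt X \<mu> x) = z x * gen z \<mu>"
proof -
  have m: "(\<lambda>x. ennreal (- ln (z x))) \<in> borel_measurable X" using assms by measurable
  have "gen z (return X x) = z x"
    using assms by (simp add: gen_def nn_integral_return[OF _ m] exp_neg_ennreal ln_le_zero_iff)
  then show ?thesis using assms by (simp add: add_pt_eq_sum_msr gen_sum_msr)
qed

lemma gen_glue:
  assumes "sets \<mu> = sets X" "sets \<nu> = sets X" "z \<in> borel_measurable X" "B \<in> sets X"
  shows "gen z (glue X B \<mu> \<nu>) = gen (\<lambda>x. if x \<in> B then 1 else z x) \<mu> * gen (\<lambda>x. if x \<in> B then z x else 1) \<nu>"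
proof -
  have sp: "space \<mu> = space X" "space \<nu> = space X" using assms by (auto dest: sets_eq_imp_space_eq)
  have m: "(\<lambda>x. ennreal (- ln (z x))) \<in> borel_measurable \<mu>" "(\<lambda>x. ennreal (- ln (z x))) \<in> borel_measurable \<nu>"
    using assms by (auto cong: measurable_cong_sets)
  have "gen z (density \<nu> (indicator B)) = gen (\<lambda>x. if x \<in> B then z x else 1) \<nu>"
    unfolding gen_def using assms m
    by (subst nn_integral_density)
      (auto intro!: arg_cong[where f=exp_neg] nn_integral_cong simp: indicator_def cong: measurable_cong_sets)
  moreover have "gen z (density \<mu> (indicator (space X - B))) = gen (\<lambda>x. if x \<in> B then 1 else z x) \<mu>"
    unfolding gen_def using assms m sp
    by (subst nn_integral_density)
      (auto intro!: arg_cong[where f=exp_neg] nn_integral_cong simp: indicator_def cong: measurable_cong_sets)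
  ultimately show ?thesis
    unfolding glue_def using assms by (subst gen_sum_msr) auto
qed

text \<open>This identifies \<open>gen\<close> with the product over the listed points. It is a
  limit of finite products because independence of the marks yields expectations of finite products
  only.\<close>

lemma gen_pts_measure:
  assumes xs: "\<And>n. xs n \<in> space X" and z: "z \<in> borel_measurable X" "\<And>x. 0 < z x \<and> z x \<le> 1"
  shows "(\<lambda>N. \<Prod>n<N. if enat n < k \<and> S n then z (xs n) else 1) \<longlonglongrightarrow> gen z (pts_measure X k S xs)"
proof -
  define a where "a n = (if enat n < k \<and> S n then ennreal (- ln (z (xs n))) else 0)" for n
  have "(\<integral>\<^sup>+x. ennreal (- ln (z x)) \<partial>pts_measure X k S xs) = (\<Sum>n. a n)"
    unfolding a_def using xs z by (intro nn_integral_pts_measure) auto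
  then have lim: "(\<lambda>N. exp_neg (\<Sum>n<N. a n)) \<longlonglongrightarrow> gen z (pts_measure X k S xs)"
    unfolding gen_def by (auto intro!: tendsto_exp_neg summable_LIMSEQ)
  have "exp_neg (a n) = (if enat n < k \<and> S n then z (xs n) else 1)" for n
    using z(2)[of "xs n"] by (simp add: a_def exp_neg_ennreal)
  then have "exp_neg (\<Sum>n<N. a n) = (\<Prod>n<N. if enat n < k \<and> S n then z (xs n) else 1)" for N
    by (induction N) (simp_all add: exp_neg_add)
  then show ?thesis using lim by simp
qed

text \<open>The exhaustion \<open>Bn\<close> is a parameter, since the class of test functions and
  the localised identity both refer to it.\<close>

locale intensity =
  fixes X lam :: "'a measure" and Bn :: "nat \<Rightarrow> 'a set"
  assumes lam_sets: "sets lam = sets X"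
    and Bn_sets [measurable]: "\<And>n. Bn n \<in> sets X"
    and Bn_inc: "incseq Bn"
    and Bn_UN: "(\<Union>n. Bn n) = space X"
    and Bn_fin: "\<And>n. emeasure lam (Bn n) < \<infinity>"
begin

lemma lam_space: "space lam = space X"
  using lam_sets by (rule sets_eq_imp_space_eq)

lemma lam_measurable: "measurable lam = measurable X"
  by (rule ext, rule measurable_cong_sets) (simp_all add: lam_sets)

sublocale lam: sigma_finite_measure lam
proof
  show "\<exists>A. countable A \<and> A \<subseteq> sets lam \<and> \<Union> A = space lam \<and> (\<forall>a\<in>A. emeasure lam a \<noteq> \<infinity>)"
  proof (intro exI[of _ "range Bn"] conjI ballI)
    show "\<Union> (range Bn) = space lam" using Bn_UN lam_space by simp
    show "emeasure lam a \<noteq> \<infinity>" if "a \<in> range Bn" for a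
      using that Bn_fin by (metis imageE less_irrefl)
  qed (auto simp: lam_sets)
qed

text \<open>Simplicity reduces the expectation of \<open>gen z\<close> to finitely many independent
  counts and keeps \<open>z\<close> away from 0 on the space. The value 1 off some
  \<open>Bn n\<close> makes \<open>z - 1\<close> integrable even if the intensity is
  infinite.\<close>

definition test :: "('a \<Rightarrow> real) \<Rightarrow> bool" where
  "test z \<longleftrightarrow> simple_function X z \<and> (\<forall>x. 0 < z x \<and> z x \<le> 1) \<and> (\<exists>n. \<forall>x\<in>space X - Bn n. z x = 1)"

lemma testD:
  assumes "test z"
  shows "simple_function X z" "z \<in> borel_measurable X" "\<And>x. 0 < z x" "\<And>x. z x \<le> 1"
    "\<And>x. 0 < z x \<and> z x \<le> 1"
  using assms by (auto simp: test_def intro: borel_measurable_simple_function)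

lemma test_one: "test (\<lambda>_. 1)"
  by (simp add: test_def)

lemma Bn_mono: "m \<le> n \<Longrightarrow> x \<in> Bn m \<Longrightarrow> x \<in> Bn n"
  using Bn_inc by (auto simp: incseq_def)

lemma test_comb:
  assumes z: "test z" and w: "test w" and f: "\<And>x y. 0 < x \<Longrightarrow> x \<le> 1 \<Longrightarrow> 0 < y \<Longrightarrow> y \<le> 1 \<Longrightarrow> 0 < f x y \<and> f x y \<le> 1"
    and 1: "f 1 1 = 1"
  shows "test (\<lambda>x. f (z x) (w x))"
proof -
  obtain m where m: "\<forall>x\<in>space X - Bn m. z x = 1" using z unfolding test_def by blast
  obtain n where n: "\<forall>x\<in>space X - Bn n. w x = 1" using w unfolding test_def by blast
  have "f (z x) (w x) = 1" if "x \<in> space X - Bn (max m n)" for x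
  proof -
    have "x \<in> space X - Bn m" "x \<in> space X - Bn n"
      using that Bn_mono[of m "max m n" x] Bn_mono[of n "max m n" x] by auto
    then show ?thesis using m n 1 by simp
  qed
  then have "\<forall>x\<in>space X - Bn (max m n). f (z x) (w x) = 1" by blast
  moreover have "simple_function X (\<lambda>x. f (z x) (w x))"
    by (rule simple_function_compose2[OF testD(1)[OF z] testD(1)[OF w]])
  moreover have "0 < f (z x) (w x) \<and> f (z x) (w x) \<le> 1" for x
    by (rule f[OF testD(3)[OF z] testD(4)[OF z] testD(3)[OF w] testD(4)[OF w]])
  ultimately show ?thesis
    unfolding test_def by (intro conjI allI exI[of _ "max m n"]) simp_all
qed

lemma test_mult: "test z \<Longrightarrow> test w \<Longrightarrow> test (\<lambda>x. z x * w x)"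
  by (rule test_comb) (auto intro: mult_le_one)

text \<open>Such mixtures arise when a Bernoulli mark chooses between the weight of a retained point
  and that of a deleted one.\<close>

lemma test_mix:
  assumes "test z" "test w" "0 \<le> s" "s \<le> 1"
  shows "test (\<lambda>x. s * z x + (1 - s) * w x)"
proof (rule test_comb[OF assms(1,2)])
  fix x y :: real assume *: "0 < x" "x \<le> 1" "0 < y" "y \<le> 1"
  have "s * x \<le> s * 1" "(1 - s) * y \<le> (1 - s) * 1"
    using * assms(3,4) by (intro mult_left_mono; simp)+
  moreover have "0 < s * x + (1 - s) * y"
  proof (cases "s = 0")
    case False
    then have "0 < s * x" "0 \<le> (1 - s) * y" using * assms(3,4) by auto
    then show ?thesis by linarith
  qed (use * in simp)
  ultimately show "0 < s * x + (1 - s) * y \<and> s * x + (1 - s) * y \<le> 1" by simp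
qed simp

lemma test_if:
  assumes "test z" "B \<in> sets X"
  shows "test (\<lambda>x. if x \<in> B then z x else 1)" "test (\<lambda>x. if x \<in> B then 1 else z x)"
proof -
  have "simple_function X (\<lambda>x. if x \<in> B then z x else 1)" "simple_function X (\<lambda>x. if x \<in> B then 1 else z x)"
    using assms testD(1)[OF assms(1)]
    by (auto intro!: simple_function_If simp: sets.Int_space_eq2 Collect_conj_eq)
  then show "test (\<lambda>x. if x \<in> B then z x else 1)" "test (\<lambda>x. if x \<in> B then 1 else z x)"
    using assms(1) by (auto simp: test_def)
qed

lemma test_indicator:
  assumes "A \<in> sets X" "A \<subseteq> Bn n" "0 \<le> (c::real)" "c < 1"
  shows "test (\<lambda>x. 1 - c * indicator A x)"
proof -
  have "simple_function X (\<lambda>x. 1 - c * indicator A x)"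
    using assms by (intro simple_function_diff simple_function_mult simple_function_const simple_function_indicator)
  moreover have "\<forall>x\<in>space X - Bn n. 1 - c * indicator A x = 1"
    using assms by (auto simp: indicator_def)
  ultimately show ?thesis using assms by (auto simp: test_def indicator_def)
qed

lemma integrable_supported:
  fixes g :: "'a \<Rightarrow> real"
  assumes "g \<in> borel_measurable X" "\<And>x. \<bar>g x\<bar> \<le> b" "\<And>x. x \<in> space X - Bn n \<Longrightarrow> g x = 0"
  shows "integrable lam g"
proof (rule integrableI_bounded_set[where A="Bn n" and B=b])
  show "AE x in lam. x \<notin> Bn n \<longrightarrow> g x = 0"
    using assms(3) lam_space by (intro AE_I2) auto
qed (use assms Bn_fin in \<open>auto simp: lam_sets lam_measurable\<close>)

lemma integrable_test:
  assumes z: "test z"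
  shows "integrable lam (\<lambda>x. z x - 1)"
proof -
  obtain n where n: "\<forall>x\<in>space X - Bn n. z x = 1" using z unfolding test_def by blast
  show ?thesis
    by (rule integrable_supported[where b=1 and n=n])
      (use n testD[OF z] in \<open>auto simp: abs_le_iff intro: less_imp_le add_increasing\<close>)
qed

lemma integrable_test2:
  assumes z: "test z" and w: "test w"
  shows "integrable lam (\<lambda>x. (z x - 1) * (w x - 1))"
proof -
  obtain n where n: "\<forall>x\<in>space X - Bn n. z x = 1" using z unfolding test_def by blast
  note [measurable] = testD(2)[OF z] testD(2)[OF w]
  have "\<bar>(z x - 1) * (w x - 1)\<bar> \<le> 1" for x
    using testD(3,4)[OF z, of x] testD(3,4)[OF w, of x] by (auto simp: abs_mult intro!: mult_le_one)
  then show ?thesis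
    by (intro integrable_supported[where b=1 and n=n]) (use n in auto)
qed

lemma measurable_gen_test: "test z \<Longrightarrow> gen z \<in> borel_measurable (N_alg X)"
  by (rule measurable_gen) (rule testD)

lemma gen_test_mult:
  "test z \<Longrightarrow> test w \<Longrightarrow> sets \<mu> = sets X \<Longrightarrow> gen (\<lambda>x. z x * w x) \<mu> = gen z \<mu> * gen w \<mu>"
  by (rule gen_mult) (auto dest: testD)

text \<open>With the weight 1/2 on a set of finite intensity, the generating functional is 2 to the
  power minus the number of points there, so the count can be recovered from it. Hence generating
  functionals of test functions generate the sigma-algebra on configurations.\<close>

lemma measurable_N_alg_gen:
  assumes f: "\<And>s. s \<in> space S \<Longrightarrow> f s \<in> counting_measures X"
    and gen: "\<And>z. test z \<Longrightarrow> (\<lambda>s. gen z (f s)) \<in> borel_measurable S"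
  shows "f \<in> S \<rightarrow>\<^sub>M N_alg X"
proof (rule measurable_N_algI[OF f])
  fix A assume A: "A \<in> sets X"
  \<comment> \<open>Minus the logarithm to base 2; the value 0 decodes an infinite count.\<close>
  define inv where "inv y = (if y = 0 then \<top> else ennreal (- ln y / ln 2))" for y :: real
  have inv: "inv (exp_neg (ennreal (ln 2) * x)) = x" for x
  proof (cases x)
    case (real r)
    then show ?thesis
      by (simp add: inv_def ennreal_mult[symmetric] exp_neg_ennreal)
  qed (simp add: inv_def ennreal_mult_top exp_neg_def)
  have [measurable]: "inv \<in> borel_measurable borel" unfolding inv_def by measurable
  have meas: "(\<lambda>s. emeasure (f s) (A \<inter> Bn n)) \<in> borel_measurable S" for n
  proof -
    have t: "test (\<lambda>x. 1 - (1/2) * indicator (A \<inter> Bn n) x)"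
      using A by (intro test_indicator[where n=n]) auto
    have "gen (\<lambda>x. 1 - (1/2) * indicator (A \<inter> Bn n) x) (f s) = exp_neg (ennreal (ln 2) * emeasure (f s) (A \<inter> Bn n))"
      if s: "s \<in> space S" for s
    proof -
      have "A \<inter> Bn n \<in> sets (f s)" using f[OF s] A by (auto simp: counting_measures_def)
      moreover have "ennreal (- ln (1 - (1/2) * indicator (A \<inter> Bn n) x)) = ennreal (ln 2) * indicator (A \<inter> Bn n) x" for x
        by (auto simp: indicator_def ln_div)
      ultimately show ?thesis
        by (simp add: gen_def nn_integral_cmult_indicator)
    qed
    then have "emeasure (f s) (A \<inter> Bn n) = inv (gen (\<lambda>x. 1 - (1/2) * indicator (A \<inter> Bn n) x) (f s))"
      if "s \<in> space S" for s using that inv by simp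
    moreover have "(\<lambda>s. inv (gen (\<lambda>x. 1 - (1/2) * indicator (A \<inter> Bn n) x) (f s))) \<in> borel_measurable S"
      by (rule measurable_compose[OF gen[OF t]]) measurable
    ultimately show ?thesis by (simp cong: measurable_cong)
  qed
  have "emeasure (f s) A = (SUP n. emeasure (f s) (A \<inter> Bn n))" if s: "s \<in> space S" for s
  proof -
    have "A = (\<Union>n. A \<inter> Bn n)" using A Bn_UN sets.sets_into_space[OF A] by auto
    moreover have "(SUP n. emeasure (f s) (A \<inter> Bn n)) = emeasure (f s) (\<Union>n. A \<inter> Bn n)"
      using f[OF s] A Bn_inc by (intro SUP_emeasure_incseq) (auto simp: counting_measures_def incseq_def)
    ultimately show ?thesis by simp
  qed
  then show "(\<lambda>s. emeasure (f s) A) \<in> borel_measurable S"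
    using meas by (simp cong: measurable_cong)
qed

abbreviation "N \<equiv> N_alg X"
abbreviation "N2 \<equiv> N_alg X \<Otimes>\<^sub>M N_alg X"

lemma measurable_gen_fst_snd:
  assumes "test z" "test w"
  shows "(\<lambda>p. gen z (fst p) * gen w (snd p)) \<in> borel_measurable N2"
  by (intro borel_measurable_times measurable_compose[OF measurable_fst measurable_gen_test[OF assms(1)]]
    measurable_compose[OF measurable_snd measurable_gen_test[OF assms(2)]])

text \<open>Products of one generating functional in each coordinate form a multiplicative class,
  since multiplying generating functionals multiplies the test functions, and they contain the
  constant 1.\<close>

theorem monotone_class_pair:
  fixes f :: "'a measure \<times> 'a measure \<Rightarrow> real" and H :: "('a measure \<times> 'a measure \<Rightarrow> real) \<Rightarrow> bool"
  assumes f: "bounded_measurable N2 b f"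
    and H_gen: "\<And>z w. test z \<Longrightarrow> test w \<Longrightarrow> H (\<lambda>p. gen z (fst p) * gen w (snd p))"
    and H_lin: "\<And>f g a b r. H f \<Longrightarrow> H g \<Longrightarrow> bounded_measurable N2 a f \<Longrightarrow> bounded_measurable N2 b g \<Longrightarrow>
        H (\<lambda>x. f x + r * g x)"
    and H_lim: "\<And>f g b. (\<And>n::nat. H (f n)) \<Longrightarrow> (\<And>n. bounded_measurable N2 b (f n)) \<Longrightarrow>
        bounded_measurable N2 b g \<Longrightarrow> (\<And>x. x \<in> space N2 \<Longrightarrow> (\<lambda>n. f n x) \<longlonglongrightarrow> g x) \<Longrightarrow> H g"
  shows "H f"
proof -
  define C where "C = {(\<lambda>p. gen z (fst p) * gen w (snd p)) | z w. test z \<and> test w}"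
  have C_gen_one: "(\<lambda>p. gen z (fst p)) \<in> C" "(\<lambda>p. gen z (snd p)) \<in> C" if "test z" for z
  proof -
    have "(\<lambda>p. gen z (fst p) * gen (\<lambda>_. 1) (snd p)) \<in> C" "(\<lambda>p. gen (\<lambda>_. 1) (fst p) * gen z (snd p)) \<in> C"
      unfolding C_def using that test_one by blast+
    then show "(\<lambda>p. gen z (fst p)) \<in> C" "(\<lambda>p. gen z (snd p)) \<in> C" by simp_all
  qed
  show ?thesis
  proof (rule functional_monotone_class[where C=C and E=N2 and H=H])
    show "c \<in> borel_measurable N2" "H c" if "c \<in> C" for c
      using that measurable_gen_fst_snd H_gen unfolding C_def by blast+
    show "0 \<le> c x \<and> c x \<le> 1" if "c \<in> C" for c x
      using that by (auto simp: C_def intro!: mult_le_one)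
    show "(\<lambda>_. 1) \<in> C"
      using C_gen_one(1)[OF test_one] by simp
    show "\<exists>e\<in>C. \<forall>x\<in>space N2. e x = c x * d x" if "c \<in> C" "d \<in> C" for c d
    proof -
      obtain z w where c: "test z" "test w" "c = (\<lambda>p. gen z (fst p) * gen w (snd p))"
        using \<open>c \<in> C\<close> unfolding C_def by blast
      obtain z' w' where d: "test z'" "test w'" "d = (\<lambda>p. gen z' (fst p) * gen w' (snd p))"
        using \<open>d \<in> C\<close> unfolding C_def by blast
      have "(\<lambda>p. gen (\<lambda>x. z x * z' x) (fst p) * gen (\<lambda>x. w x * w' x) (snd p)) \<in> C"
        unfolding C_def using c d test_mult by blast
      then show ?thesis
        by (rule bexI[rotated]) (auto simp: c d gen_test_mult space_pair_measure sets_counting)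
    qed
    \<comment> \<open>The sigma-algebra generated by \<open>C\<close>. Both projections are
      measurable from \<open>S\<close> by \<open>measurable_N_alg_gen\<close>, so the identity is
      measurable from \<open>S\<close> to \<open>N2\<close>; this is the inclusion required by
      \<open>C_gen\<close>.\<close>
    define S where "S = sigma (space N2) {{x \<in> space N2. a < c x} | c a. c \<in> C}"
    have sp: "space S = space N2" unfolding S_def by (intro space_measure_of) blast
    have sS: "sets S = sigma_sets (space N2) {{x \<in> space N2. a < c x} | c a. c \<in> C}"
      unfolding S_def by (intro sets_measure_of) blast
    have cS: "c \<in> borel_measurable S" if "c \<in> C" for c
    proof -
      have "{x \<in> space S. a < c x} \<in> sets S" for a
        unfolding sp sS using that by (intro sigma_sets.Basic) blast
      then show ?thesis by (simp add: borel_measurable_iff_greater)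
    qed
    have "fst \<in> S \<rightarrow>\<^sub>M N" "snd \<in> S \<rightarrow>\<^sub>M N"
      by (auto intro!: measurable_N_alg_gen cS C_gen_one simp: sp space_pair_measure space_N_alg)
    then have id: "(\<lambda>p. (fst p, snd p)) \<in> S \<rightarrow>\<^sub>M N2" by (rule measurable_Pair)
    show "sets N2 \<subseteq> sigma_sets (space N2) {{x \<in> space N2. a < c x} | c a. c \<in> C}"
    proof
      fix A assume A: "A \<in> sets N2"
      have "(\<lambda>p. (fst p, snd p)) -` A \<inter> space S = A"
        using sets.sets_into_space[OF A] sp by auto
      then show "A \<in> sigma_sets (space N2) {{x \<in> space N2. a < c x} | c a. c \<in> C}"
        using measurable_sets[OF id A] sS by simp
    qed
  qed (fact H_lin H_lim f)+
qed

end

section \<open>Poisson laws and their couplings\<close>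

lemma (in finite_measure) bounded_convergence:
  fixes f :: "nat \<Rightarrow> 'a \<Rightarrow> real"
  assumes f: "\<And>n. f n \<in> borel_measurable M"
    and bound: "\<And>n x. x \<in> space M \<Longrightarrow> \<bar>f n x\<bar> \<le> b"
    and lim: "\<And>x. x \<in> space M \<Longrightarrow> (\<lambda>n. f n x) \<longlonglongrightarrow> g x"
  shows "(\<lambda>n. \<integral>x. f n x \<partial>M) \<longlonglongrightarrow> (\<integral>x. g x \<partial>M)"
proof (rule integral_dominated_convergence[where w="\<lambda>_. b"])
  show "g \<in> borel_measurable M" using lim f by (rule borel_measurable_LIMSEQ_real)
qed (use f bound lim in auto)

lemma (in finite_measure) integrable_bounded:
  fixes f :: "'a \<Rightarrow> real"
  assumes "f \<in> borel_measurable M" "\<And>x. x \<in> space M \<Longrightarrow> \<bar>f x\<bar> \<le> b"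
  shows "integrable M f"
  by (rule integrable_const_bound[where B=b]) (use assms in auto)

text \<open>The Poisson weights of the finite values already sum to 1, which leaves no mass for
  infinity or for non-integers.\<close>

lemma AE_poisson_finite:
  fixes N :: "'w \<Rightarrow> ennreal"
  assumes M: "prob_space M" and N [measurable]: "N \<in> borel_measurable M"
    and p: "\<And>k::nat. measure M {\<omega> \<in> space M. N \<omega> = of_nat k} = exp (- l) * l ^ k / fact k"
  shows "AE \<omega> in M. \<exists>k::nat. N \<omega> = of_nat k"
proof -
  interpret prob_space M by fact
  define E where "E k = {\<omega> \<in> space M. N \<omega> = of_nat k}" for k :: nat
  have [measurable]: "E k \<in> sets M" for k unfolding E_def by measurable
  have "disjoint_family E" by (auto simp: disjoint_family_on_def E_def)
  then have "(\<lambda>k. prob (E k)) sums prob (\<Union>k. E k)"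
    by (intro finite_measure_UNION) auto
  moreover have pE: "prob (E k) = exp (- l) * (l ^ k /\<^sub>R fact k)" for k
    using p[of k] by (simp add: E_def divide_inverse mult_ac)
  have "(\<lambda>k. prob (E k)) sums (exp (- l) * exp l)"
    unfolding pE by (intro sums_mult exp_converges)
  then have "(\<lambda>k. prob (E k)) sums 1"
    by (simp add: exp_add[symmetric])
  ultimately have "prob (\<Union>k. E k) = 1" by (rule sums_unique2)
  then have "AE \<omega> in M. \<omega> \<in> (\<Union>k. E k)" by (rule AE_prob_1)
  then show ?thesis by eventually_elim (auto simp: E_def)
qed

text \<open>The Laplace transform of a Poisson variable, for counts that may be infinite on a null
  set; the sum is the exponential series at \<open>l * exp (- c)\<close>.\<close>

lemma expectation_poisson:
  fixes N :: "'w \<Rightarrow> ennreal"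
  assumes M: "prob_space M" and N [measurable]: "N \<in> borel_measurable M"
    and p: "\<And>k::nat. measure M {\<omega> \<in> space M. N \<omega> = of_nat k} = exp (- l) * l ^ k / fact k"
    and c: "0 \<le> c"
  shows "(\<integral>\<omega>. exp_neg (ennreal c * N \<omega>) \<partial>M) = exp (l * (exp (- c) - 1))"
proof -
  interpret prob_space M by fact
  define E where "E k = {\<omega> \<in> space M. N \<omega> = of_nat k}" for k :: nat
  have [measurable]: "E k \<in> sets M" for k unfolding E_def by measurable
  have pE: "prob (E k) = exp (- l) * (l ^ k /\<^sub>R fact k)" for k
    using p[of k] by (simp add: E_def divide_inverse mult_ac)
  have AE: "AE \<omega> in M. \<omega> \<in> (\<Union>k. E k)"
    using AE_poisson_finite[OF M N p] AE_space by eventually_elim (auto simp: E_def)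
  have val: "ennreal (exp_neg (ennreal c * N \<omega>)) = (\<Sum>k. ennreal (exp (- (c * k))) * indicator (E k) \<omega>)"
    if \<omega>: "\<omega> \<in> (\<Union>k. E k)" for \<omega>
  proof -
    obtain j where j: "\<omega> \<in> E j" using \<omega> by blast
    have "(\<Sum>k. ennreal (exp (- (c * k))) * indicator (E k) \<omega>) = (\<Sum>k\<in>{j}. ennreal (exp (- (c * k))) * indicator (E k) \<omega>)"
      using j by (intro suminf_finite) (auto simp: E_def)
    also have "\<dots> = ennreal (exp (- (c * j)))" using j by simp
    also have "\<dots> = ennreal (exp_neg (ennreal c * N \<omega>))"
      using j c by (simp add: E_def ennreal_of_nat_eq_real_of_nat ennreal_mult[symmetric] exp_neg_ennreal)
    finally show ?thesis by simp
  qed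
  have weight: "exp (- (c * k)) * prob (E k) = exp (- l) * ((l * exp (- c)) ^ k /\<^sub>R fact k)" for k :: nat
  proof -
    have "exp (- (c * k)) = exp (- c) ^ k" by (simp add: exp_of_nat_mult[symmetric] mult.commute)
    then show ?thesis by (simp add: pE power_mult_distrib mult_ac)
  qed
  have "(\<integral>\<^sup>+\<omega>. ennreal (exp_neg (ennreal c * N \<omega>)) \<partial>M)
      = (\<integral>\<^sup>+\<omega>. (\<Sum>k. ennreal (exp (- (c * k))) * indicator (E k) \<omega>) \<partial>M)"
    using AE by (intro nn_integral_cong_AE) (auto simp: val)
  also have "\<dots> = (\<Sum>k. ennreal (exp (- (c * k))) * emeasure M (E k))"
    by (simp add: nn_integral_suminf nn_integral_cmult_indicator)
  also have "\<dots> = (\<Sum>k. ennreal (exp (- l) * ((l * exp (- c)) ^ k /\<^sub>R fact k)))"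
    by (simp only: weight[symmetric] emeasure_eq_measure ennreal_mult[OF exp_ge_zero measure_nonneg])
  also have "\<dots> = ennreal (exp (- l) * exp (l * exp (- c)))"
  proof (rule suminf_ennreal_eq)
    show "0 \<le> exp (- l) * ((l * exp (- c)) ^ k /\<^sub>R fact k)" for k
      unfolding weight[symmetric] by simp
    show "(\<lambda>k. exp (- l) * ((l * exp (- c)) ^ k /\<^sub>R fact k)) sums (exp (- l) * exp (l * exp (- c)))"
      by (intro sums_mult exp_converges)
  qed
  also have "exp (- l) * exp (l * exp (- c)) = exp (l * (exp (- c) - 1))"
    by (simp add: exp_add[symmetric] algebra_simps)
  finally show ?thesis
    by (subst integral_eq_nn_integral) auto
qed

context intensity
begin

text \<open>The level sets of \<open>z\<close> for its finitely many values other than 1 are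
  disjoint and of finite intensity, so \<open>gen z\<close> is a product of functions of independent
  Poisson counts. The factor \<open>c\<close> covers both the original process and the added one of
  intensity \<open>1 - exp (- t)\<close>.\<close>

lemma expectation_gen_poisson_process:
  assumes PP: "poisson_process M X (scale_measure (ennreal c) lam) \<eta>" and c: "0 \<le> c" and z: "test z"
  shows "(\<integral>\<omega>. gen z (\<eta> \<omega>) \<partial>M) = exp (c * (\<integral>x. z x - 1 \<partial>lam))"
proof -
  interpret prob_space M using PP by (simp add: poisson_process_def)
  have \<eta> [measurable]: "\<eta> \<in> M \<rightarrow>\<^sub>M N" using PP by (simp add: poisson_process_def)
  define V where "V = z ` space X - {1}"
  have "finite V" using testD(1)[OF z] by (simp add: V_def simple_function_def)
  then obtain v where v: "bij_betw v {0..<card V} V" using ex_bij_betw_nat_finite by blast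
  define m where "m = card V"
  have vV: "v i \<in> V" if "i < m" for i using v that by (auto simp: bij_betw_def m_def)
  have v_inj: "i = j" if "i < m" "j < m" "v i = v j" for i j
    using v that by (auto simp: bij_betw_def m_def inj_on_def)
  have v01: "0 < v i" "v i \<le> 1" "v i \<noteq> 1" if "i < m" for i
    using vV[OF that] testD(3,4)[OF z] by (auto simp: V_def)
  define B where "B i = z -` {v i} \<inter> space X" for i
  have B [measurable]: "B i \<in> sets X" for i
    using testD(1)[OF z] unfolding B_def by (rule simple_functionD)
  have disj: "disjoint_family_on B {..<m}"
    using v_inj by (auto simp: disjoint_family_on_def B_def)
  obtain n where n: "\<forall>x\<in>space X - Bn n. z x = 1" using z unfolding test_def by blast
  have B_fin: "emeasure lam (B i) < \<infinity>" if "i < m" for i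
  proof -
    have "B i \<subseteq> Bn n"
    proof
      fix x assume "x \<in> B i"
      then have "x \<in> space X" "z x \<noteq> 1" using v01(3)[OF that] by (simp_all add: B_def)
      then show "x \<in> Bn n" using n by blast
    qed
    then show ?thesis using emeasure_mono[of "B i" "Bn n" lam] Bn_fin[of n] by (simp add: lam_sets)
  qed
  \<comment> \<open>One expansion over level sets serves two purposes: with \<open>- ln\<close> it
    rewrites the exponent of \<open>gen\<close>, and with \<open>y - 1\<close> the intensity
    integral. Both functions vanish at 1, so the level set of 1, possibly of infinite intensity,
    drops out.\<close>
  have expand: "\<phi> (z x) = (\<Sum>i<m. \<phi> (v i) * indicator (B i) x)" if x: "x \<in> space X" and "\<phi> 1 = 0"
    for x and \<phi> :: "real \<Rightarrow> 'c :: semiring_1"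
  proof (cases "z x = 1")
    case True
    then have "indicator (B i) x = (0 :: 'c)" if "i < m" for i using v01(3)[OF that] by (auto simp: B_def)
    then show ?thesis using True \<open>\<phi> 1 = 0\<close> by simp
  next
    case False
    then have "z x \<in> V" using x by (simp add: V_def)
    then have "z x \<in> v ` {0..<card V}" using v by (simp add: bij_betw_def)
    then obtain j where j: "j < m" "z x = v j" by (auto simp: m_def)
    have "(\<Sum>i<m. \<phi> (v i) * indicator (B i) x) = (\<Sum>i<m. if i = j then \<phi> (v j) else 0)"
      using j x v_inj by (intro sum.cong) (auto simp: B_def indicator_def)
    then show ?thesis using j by simp
  qed
  define e where "e i y = exp_neg (ennreal (- ln (v i)) * y)" for i and y :: ennreal
  have [measurable]: "e i \<in> borel_measurable borel" for i unfolding e_def[abs_def] by measurable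
  have gen: "gen z (\<eta> \<omega>) = (\<Prod>i<m. e i (emeasure (\<eta> \<omega>) (B i)))" if \<omega>: "\<omega> \<in> space M" for \<omega>
  proof -
    have s: "sets (\<eta> \<omega>) = sets X" using measurable_space[OF \<eta> \<omega>] by (rule sets_counting)
    have "(\<integral>\<^sup>+x. ennreal (- ln (z x)) \<partial>\<eta> \<omega>) = (\<integral>\<^sup>+x. (\<Sum>i<m. ennreal (- ln (v i)) * indicator (B i) x) \<partial>\<eta> \<omega>)"
      using sets_eq_imp_space_eq[OF s] by (intro nn_integral_cong expand[of _ "\<lambda>y. ennreal (- ln y)"]) auto
    also have "\<dots> = (\<Sum>i<m. \<integral>\<^sup>+x. ennreal (- ln (v i)) * indicator (B i) x \<partial>\<eta> \<omega>)"
    proof (rule nn_integral_sum)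
      have "B i \<in> sets (\<eta> \<omega>)" for i using s B by simp
      then show "(\<lambda>x. ennreal (- ln (v i)) * indicator (B i) x) \<in> borel_measurable (\<eta> \<omega>)" for i
        by measurable
    qed
    also have "\<dots> = (\<Sum>i<m. ennreal (- ln (v i)) * emeasure (\<eta> \<omega>) (B i))"
      using s B by (intro sum.cong refl nn_integral_cmult_indicator) simp
    finally have "gen z (\<eta> \<omega>) = exp_neg (\<Sum>i<m. ennreal (- ln (v i)) * emeasure (\<eta> \<omega>) (B i))"
      by (simp add: gen_def)
    also have "\<dots> = (\<Prod>i<m. e i (emeasure (\<eta> \<omega>) (B i)))"
      unfolding e_def by (induction m) (simp_all add: exp_neg_add)
    finally show ?thesis .
  qed
  have ind: "indep_vars (\<lambda>_. borel) (\<lambda>i \<omega>. emeasure (\<eta> \<omega>) (B i)) {..<m}"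
    using PP disj B unfolding poisson_process_def by blast
  have ind': "indep_vars (\<lambda>_. borel) (\<lambda>i \<omega>. e i (emeasure (\<eta> \<omega>) (B i))) {..<m}"
    by (rule indep_vars_compose2[OF ind]) measurable
  have "(\<integral>\<omega>. gen z (\<eta> \<omega>) \<partial>M) = (\<integral>\<omega>. (\<Prod>i<m. e i (emeasure (\<eta> \<omega>) (B i))) \<partial>M)"
    by (intro Bochner_Integration.integral_cong gen refl)
  also have "\<dots> = (\<Prod>i<m. \<integral>\<omega>. e i (emeasure (\<eta> \<omega>) (B i)) \<partial>M)"
  proof (rule indep_vars_lebesgue_integral[OF _ ind'])
    show "integrable M (\<lambda>\<omega>. e i (emeasure (\<eta> \<omega>) (B i)))" for i
      by (rule integrable_bounded[where b=1]) (auto simp: e_def abs_le_iff intro: order.trans[OF _ exp_neg_nonneg])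
  qed simp
  also have "\<dots> = (\<Prod>i<m. exp (c * (measure lam (B i) * (v i - 1))))"
  proof (intro prod.cong refl)
    fix i assume "i \<in> {..<m}"
    then have i: "i < m" by simp
    have "emeasure (scale_measure (ennreal c) lam) (B i) < \<infinity>"
      using B_fin[OF i] by (auto simp: ennreal_mult_less_top)
    then have p: "measure M {\<omega> \<in> space M. emeasure (\<eta> \<omega>) (B i) = of_nat k}
        = exp (- (c * measure lam (B i))) * (c * measure lam (B i)) ^ k / fact k" for k :: nat
      using PP B[of i] c unfolding poisson_process_def
      by (auto simp: enn2real_mult measure_def)
    have "(\<integral>\<omega>. e i (emeasure (\<eta> \<omega>) (B i)) \<partial>M) = exp (c * measure lam (B i) * (exp (- (- ln (v i))) - 1))"
      unfolding e_def using v01[OF i]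
      by (intro expectation_poisson[OF prob_space_axioms _ p]) (auto simp: ln_le_zero_iff)
    then show "(\<integral>\<omega>. e i (emeasure (\<eta> \<omega>) (B i)) \<partial>M) = exp (c * (measure lam (B i) * (v i - 1)))"
      using v01[OF i] by (simp add: mult.assoc)
  qed
  also have "\<dots> = exp (c * (\<Sum>i<m. measure lam (B i) * (v i - 1)))"
    by (simp add: exp_sum sum_distrib_left)
  also have "(\<Sum>i<m. measure lam (B i) * (v i - 1)) = (\<integral>x. (\<Sum>i<m. (v i - 1) * indicator (B i) x) \<partial>lam)"
    using B_fin by (subst Bochner_Integration.integral_sum)
      (auto simp: lam_sets mult.commute integrable_indicator_iff intro!: integrable_mult_right)
  also have "\<dots> = (\<integral>x. z x - 1 \<partial>lam)"
    using lam_space by (intro Bochner_Integration.integral_cong refl) (subst expand[of _ "\<lambda>y. y - 1"], auto)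
  finally show ?thesis .
qed

text \<open>The Poisson property is encoded by the generating functional alone, which is easy to
  compute for marginals and glued configurations; \<open>poisson_law_unique\<close> shows that it
  determines the law.\<close>

definition poisson_law :: "'a measure measure \<Rightarrow> bool" where
  "poisson_law \<pi> \<longleftrightarrow> prob_space \<pi> \<and> sets \<pi> = sets N \<and>
     (\<forall>z. test z \<longrightarrow> (\<integral>\<mu>. gen z \<mu> \<partial>\<pi>) = exp (\<integral>x. z x - 1 \<partial>lam))"

text \<open>The law of \<open>(\<eta>, \<eta>\<^sup>t)\<close> for \<open>s = exp (- t)\<close>, and of two independent copies for \<open>s = 0\<close>.\<close>

definition coupling :: "real \<Rightarrow> ('a measure \<times> 'a measure) measure \<Rightarrow> bool" where
  "coupling s P \<longleftrightarrow> prob_space P \<and> sets P = sets N2 \<and>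
     (\<forall>z w. test z \<longrightarrow> test w \<longrightarrow> (\<integral>p. gen z (fst p) * gen w (snd p) \<partial>P) =
        exp ((\<integral>x. z x - 1 \<partial>lam) + (\<integral>x. w x - 1 \<partial>lam) + s * (\<integral>x. (z x - 1) * (w x - 1) \<partial>lam)))"

section \<open>Laws determined by their generating functionals\<close>

lemma abs_gen_mult_le_1: "\<bar>gen z \<mu> * gen w \<nu>\<bar> \<le> 1"
  by (simp add: abs_mult mult_le_one)

text \<open>Both integrals are linear and continuous under bounded convergence, so agreement on
  generating functionals spreads by the monotone class theorem. General finite measures are allowed
  because the Mecke equation compares measures of mass \<open>s * measure lam A\<close>.\<close>

lemma distr_pair_eqI:
  assumes P: "finite_measure P" and Q: "finite_measure Q"
    and p [measurable]: "p \<in> P \<rightarrow>\<^sub>M N2" and q [measurable]: "q \<in> Q \<rightarrow>\<^sub>M N2"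
    and eq: "\<And>z w. test z \<Longrightarrow> test w \<Longrightarrow>
      (\<integral>x. gen z (fst (p x)) * gen w (snd (p x)) \<partial>P) = (\<integral>x. gen z (fst (q x)) * gen w (snd (q x)) \<partial>Q)"
  shows "distr P N2 p = distr Q N2 q"
proof (rule measure_eqI)
  interpret P: finite_measure P by fact
  interpret Q: finite_measure Q by fact
  have int: "integrable P (\<lambda>x. f (p x))" "integrable Q (\<lambda>x. f (q x))"
    if "bounded_measurable N2 b f" for f b
    by (auto intro!: P.integrable_bounded[where b=b] Q.integrable_bounded[where b=b]
        measurable_compose[OF p] measurable_compose[OF q] bounded_measurableD[OF that]
        measurable_space[OF p] measurable_space[OF q])
  have H: "(\<integral>x. f (p x) \<partial>P) = (\<integral>x. f (q x) \<partial>Q)" if "bounded_measurable N2 b f" for f b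
    using that
  proof (rule monotone_class_pair[where H="\<lambda>f. (\<integral>x. f (p x) \<partial>P) = (\<integral>x. f (q x) \<partial>Q)"])
    fix f g :: "'a measure \<times> 'a measure \<Rightarrow> real" and a b r
    assume "(\<integral>x. f (p x) \<partial>P) = (\<integral>x. f (q x) \<partial>Q)" "(\<integral>x. g (p x) \<partial>P) = (\<integral>x. g (q x) \<partial>Q)"
      and "bounded_measurable N2 a f" "bounded_measurable N2 b g"
    then show "(\<integral>x. f (p x) + r * g (p x) \<partial>P) = (\<integral>x. f (q x) + r * g (q x) \<partial>Q)"
      using int by simp
  next
    fix f :: "nat \<Rightarrow> 'a measure \<times> 'a measure \<Rightarrow> real" and g b
    assume eq: "\<And>n. (\<integral>x. f n (p x) \<partial>P) = (\<integral>x. f n (q x) \<partial>Q)" and f: "\<And>n. bounded_measurable N2 b (f n)"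
      and l: "\<And>x. x \<in> space N2 \<Longrightarrow> (\<lambda>n. f n x) \<longlonglongrightarrow> g x"
    have "(\<lambda>n. \<integral>x. f n (p x) \<partial>P) \<longlonglongrightarrow> (\<integral>x. g (p x) \<partial>P)"
      using bounded_measurableD[OF f] l measurable_space[OF p] by (intro P.bounded_convergence[where b=b]) auto
    moreover have "(\<lambda>n. \<integral>x. f n (p x) \<partial>P) \<longlonglongrightarrow> (\<integral>x. g (q x) \<partial>Q)"
      unfolding eq using bounded_measurableD[OF f] l measurable_space[OF q]
      by (intro Q.bounded_convergence[where b=b]) auto
    ultimately show "(\<integral>x. g (p x) \<partial>P) = (\<integral>x. g (q x) \<partial>Q)" by (rule LIMSEQ_unique)
  qed (rule eq)
  fix A assume "A \<in> sets (distr P N2 p)"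
  then have A [measurable]: "A \<in> sets N2" by simp
  have "(\<integral>x. indicator A (p x) \<partial>P) = (\<integral>x. indicator A (q x) \<partial>Q :: real)"
    by (rule H[where b=1]) (simp add: bounded_measurable_def indicator_def)
  then have "(\<integral>x. indicator (p -` A \<inter> space P) x \<partial>P) = (\<integral>x. indicator (q -` A \<inter> space Q) x \<partial>Q :: real)"
    by (simp add: indicator_def cong: Bochner_Integration.integral_cong)
  then have "measure P (p -` A \<inter> space P) = measure Q (q -` A \<inter> space Q)" by simp
  then show "emeasure (distr P N2 p) A = emeasure (distr Q N2 q) A"
    by (simp add: emeasure_distr P.emeasure_eq_measure Q.emeasure_eq_measure)
qed simp

lemma poisson_lawD:
  assumes "poisson_law \<pi>"
  shows "prob_space \<pi>" "sets \<pi> = sets N" "\<And>z. test z \<Longrightarrow> (\<integral>\<mu>. gen z \<mu> \<partial>\<pi>) = exp (\<integral>x. z x - 1 \<partial>lam)"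
  using assms by (auto simp: poisson_law_def)

lemma couplingD:
  assumes "coupling s P"
  shows "prob_space P" "sets P = sets N2" "\<And>z w. test z \<Longrightarrow> test w \<Longrightarrow> (\<integral>p. gen z (fst p) * gen w (snd p) \<partial>P) =
        exp ((\<integral>x. z x - 1 \<partial>lam) + (\<integral>x. w x - 1 \<partial>lam) + s * (\<integral>x. (z x - 1) * (w x - 1) \<partial>lam))"
  using assms unfolding coupling_def by blast+

text \<open>The diagonal embedding reduces the claim to pairs: on the diagonal the product of
  \<open>gen z\<close> and \<open>gen w\<close> is the generating functional of
  \<open>z * w\<close>, whose expectation is prescribed.\<close>

lemma poisson_law_unique:
  assumes \<pi>: "poisson_law \<pi>" and \<rho>: "poisson_law \<rho>"
  shows "\<pi> = \<rho>"
proof -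
  interpret \<pi>: prob_space \<pi> by (rule poisson_lawD[OF \<pi>])
  interpret \<rho>: prob_space \<rho> by (rule poisson_lawD[OF \<rho>])
  have m: "(\<lambda>\<mu>. (\<mu>, \<mu>)) \<in> N \<rightarrow>\<^sub>M N2" by measurable
  have m\<pi>: "(\<lambda>\<mu>. (\<mu>, \<mu>)) \<in> \<pi> \<rightarrow>\<^sub>M N2"
    unfolding measurable_cong_sets[OF poisson_lawD(2)[OF \<pi>] refl] by (rule m)
  have m\<rho>: "(\<lambda>\<mu>. (\<mu>, \<mu>)) \<in> \<rho> \<rightarrow>\<^sub>M N2"
    unfolding measurable_cong_sets[OF poisson_lawD(2)[OF \<rho>] refl] by (rule m)
  have "distr \<pi> N2 (\<lambda>\<mu>. (\<mu>, \<mu>)) = distr \<rho> N2 (\<lambda>\<mu>. (\<mu>, \<mu>))"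
  proof (rule distr_pair_eqI)
    fix z w assume zw: "test z" "test w"
    have *: "(\<integral>\<mu>. gen z (fst (\<mu>, \<mu>)) * gen w (snd (\<mu>, \<mu>)) \<partial>\<rho>') = exp (\<integral>x. z x * w x - 1 \<partial>lam)"
      if \<rho>': "poisson_law \<rho>'" for \<rho>'
    proof -
      have "(\<integral>\<mu>. gen z (fst (\<mu>, \<mu>)) * gen w (snd (\<mu>, \<mu>)) \<partial>\<rho>') = (\<integral>\<mu>. gen (\<lambda>x. z x * w x) \<mu> \<partial>\<rho>')"
        using zw sets_eq_imp_space_eq[OF poisson_lawD(2)[OF \<rho>']]
        by (intro Bochner_Integration.integral_cong) (auto simp: gen_test_mult sets_counting)
      then show ?thesis using poisson_lawD(3)[OF \<rho>' test_mult[OF zw]] by simp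
    qed
    show "(\<integral>\<mu>. gen z (fst (\<mu>, \<mu>)) * gen w (snd (\<mu>, \<mu>)) \<partial>\<pi>) = (\<integral>\<mu>. gen z (fst (\<mu>, \<mu>)) * gen w (snd (\<mu>, \<mu>)) \<partial>\<rho>)"
      by (simp only: *[OF \<pi>] *[OF \<rho>])
  qed (rule \<pi>.finite_measure_axioms \<rho>.finite_measure_axioms m\<pi> m\<rho>)+
  then have eq: "distr (distr \<pi> N2 (\<lambda>\<mu>. (\<mu>, \<mu>))) N fst = distr (distr \<rho> N2 (\<lambda>\<mu>. (\<mu>, \<mu>))) N fst"
    by (rule arg_cong[where f="\<lambda>m. distr m N fst"])
  have id: "distr (distr \<rho>' N2 (\<lambda>\<mu>. (\<mu>, \<mu>))) N fst = \<rho>'"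
    if "(\<lambda>\<mu>. (\<mu>, \<mu>)) \<in> \<rho>' \<rightarrow>\<^sub>M N2" "sets \<rho>' = sets N" for \<rho>'
  proof -
    have "distr (distr \<rho>' N2 (\<lambda>\<mu>. (\<mu>, \<mu>))) N fst = distr \<rho>' N (\<lambda>\<mu>. \<mu>)"
      by (simp only: distr_distr[OF measurable_fst that(1)] comp_def fst_conv)
    also have "\<dots> = \<rho>'" by (rule distr_id2[OF that(2)[symmetric]])
    finally show ?thesis .
  qed
  show ?thesis
    using eq id[OF m\<pi> poisson_lawD(2)[OF \<pi>]] id[OF m\<rho> poisson_lawD(2)[OF \<rho>]] by (simp only:)
qed

lemma poisson_law_distr:
  assumes P: "prob_space P" and f: "f \<in> P \<rightarrow>\<^sub>M N"
    and gen: "\<And>z. test z \<Longrightarrow> (\<integral>p. gen z (f p) \<partial>P) = exp (\<integral>x. z x - 1 \<partial>lam)"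
  shows "poisson_law (distr P N f)"
proof -
  interpret prob_space P by fact
  show ?thesis
    unfolding poisson_law_def using f gen
    by (auto simp: prob_space_distr integral_distr measurable_gen_test)
qed

lemma coupling_fst:
  assumes P: "coupling s P" shows "poisson_law (distr P N fst)"
proof (rule poisson_law_distr[OF couplingD(1)[OF P]])
  note [measurable_cong] = couplingD(2)[OF P]
  show "fst \<in> P \<rightarrow>\<^sub>M N" by measurable
  show "(\<integral>p. gen z (fst p) \<partial>P) = exp (\<integral>x. z x - 1 \<partial>lam)" if "test z" for z
    using couplingD(3)[OF P that test_one] by simp
qed

lemma integral_combine:
  fixes f g h k :: "'b \<Rightarrow> real"
  assumes "integrable m f" "integrable m g" "integrable m h" "integrable m k"
  shows "(\<integral>x. f x + g x + h x + s * k x \<partial>m)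
    = (\<integral>x. f x \<partial>m) + (\<integral>x. g x \<partial>m) + (\<integral>x. h x \<partial>m) + s * (\<integral>x. k x \<partial>m)"
  using assms by simp

text \<open>Gluing lets the part \<open>w0\<close> of \<open>w\<close> off \<open>B\<close> act on
  the first configuration and the part \<open>w1\<close> inside \<open>B\<close> on the second, so
  the coupling formula applies to \<open>z * w0\<close> and \<open>w1\<close>. The cross term then
  has coefficient 1 off \<open>B\<close>, where the configurations coincide, and \<open>s\<close>
  inside.\<close>

lemma integral_gen_glue:
  assumes P: "coupling s P" and z: "test z" and w: "test w" and B: "B \<in> sets X"
  shows "(\<integral>p. gen z (fst p) * gen w (glue X B (fst p) (snd p)) \<partial>P) =
    exp ((\<integral>x. z x - 1 \<partial>lam) + (\<integral>x. w x - 1 \<partial>lam)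
      + (\<integral>x. indicator (space X - B) x * ((z x - 1) * (w x - 1)) \<partial>lam)
      + s * (\<integral>x. indicator B x * ((z x - 1) * (w x - 1)) \<partial>lam))"
proof -
  define w1 where "w1 x = (if x \<in> B then w x else 1)" for x
  define w0 where "w0 x = (if x \<in> B then 1 else w x)" for x
  have t: "test w1" "test w0" unfolding w1_def[abs_def] w0_def[abs_def] using test_if[OF w B] by auto
  have t': "test (\<lambda>x. z x * w0 x)" by (rule test_mult[OF z t(2)])
  have B': "B \<in> sets lam" "space X - B \<in> sets lam" using B lam_sets by auto
  note int = integrable_test[OF z] integrable_test[OF w] integrable_test[OF t'] integrable_test[OF t(1)]
    integrable_test2[OF t' t(1)] integrable_mult_indicator[OF B'(1) integrable_test2[OF z w], unfolded real_scaleR_def]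
    integrable_mult_indicator[OF B'(2) integrable_test2[OF z w], unfolded real_scaleR_def]
  have "(\<integral>p. gen z (fst p) * gen w (glue X B (fst p) (snd p)) \<partial>P)
      = (\<integral>p. gen (\<lambda>x. z x * w0 x) (fst p) * gen w1 (snd p) \<partial>P)"
  proof (intro Bochner_Integration.integral_cong refl)
    fix p assume "p \<in> space P"
    then have "p \<in> space N2" using sets_eq_imp_space_eq[OF couplingD(2)[OF P]] by simp
    then have s: "sets (fst p) = sets X" "sets (snd p) = sets X" by (auto simp: space_pair_measure sets_counting)
    show "gen z (fst p) * gen w (glue X B (fst p) (snd p)) = gen (\<lambda>x. z x * w0 x) (fst p) * gen w1 (snd p)"
      unfolding gen_glue[OF s testD(2)[OF w] B] gen_test_mult[OF z t(2) s(1)]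
      by (simp add: w1_def[abs_def] w0_def[abs_def])
  qed
  also have "\<dots> = exp ((\<integral>x. z x * w0 x - 1 \<partial>lam) + (\<integral>x. w1 x - 1 \<partial>lam) + s * (\<integral>x. (z x * w0 x - 1) * (w1 x - 1) \<partial>lam))"
    by (rule couplingD(3)[OF P t' t(1)])
  also have "(\<integral>x. z x * w0 x - 1 \<partial>lam) + (\<integral>x. w1 x - 1 \<partial>lam) + s * (\<integral>x. (z x * w0 x - 1) * (w1 x - 1) \<partial>lam)
      = (\<integral>x. (z x * w0 x - 1) + (w1 x - 1) + 0 + s * ((z x * w0 x - 1) * (w1 x - 1)) \<partial>lam)"
    using integral_combine[OF int(3,4) integrable_zero int(5), of s] by simp
  also have "\<dots> = (\<integral>x. (z x - 1) + (w x - 1) + indicator (space X - B) x * ((z x - 1) * (w x - 1))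
      + s * (indicator B x * ((z x - 1) * (w x - 1))) \<partial>lam)"
    using lam_space by (intro Bochner_Integration.integral_cong refl) (auto simp: w0_def w1_def algebra_simps)
  also have "\<dots> = (\<integral>x. z x - 1 \<partial>lam) + (\<integral>x. w x - 1 \<partial>lam)
      + (\<integral>x. indicator (space X - B) x * ((z x - 1) * (w x - 1)) \<partial>lam)
      + s * (\<integral>x. indicator B x * ((z x - 1) * (w x - 1)) \<partial>lam)"
    by (rule integral_combine[OF int(1,2,7,6)])
  finally show ?thesis .
qed

text \<open>With \<open>z = 1\<close> both cross terms vanish, whatever the dependence parameter
  \<open>s\<close> is.\<close>

lemma coupling_glue:
  assumes P: "coupling s P" and B: "B \<in> sets X"
  shows "poisson_law (distr P N (\<lambda>p. glue X B (fst p) (snd p)))"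
proof (rule poisson_law_distr[OF couplingD(1)[OF P]])
  note [measurable_cong] = couplingD(2)[OF P]
  show "(\<lambda>p. glue X B (fst p) (snd p)) \<in> P \<rightarrow>\<^sub>M N" using B by measurable
  show "(\<integral>p. gen z (glue X B (fst p) (snd p)) \<partial>P) = exp (\<integral>x. z x - 1 \<partial>lam)" if "test z" for z
    using integral_gen_glue[OF P test_one that B] by simp
qed

lemma coupling_snd:
  assumes P: "coupling s P" shows "poisson_law (distr P N snd)"
proof (rule poisson_law_distr[OF couplingD(1)[OF P]])
  note [measurable_cong] = couplingD(2)[OF P]
  show "snd \<in> P \<rightarrow>\<^sub>M N" by measurable
  show "(\<integral>p. gen z (snd p) \<partial>P) = exp (\<integral>x. z x - 1 \<partial>lam)" if "test z" for z
    using couplingD(3)[OF P test_one that] by simp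
qed

lemma coupling_indep:
  assumes \<pi>: "poisson_law \<pi>"
  shows "coupling 0 (\<pi> \<Otimes>\<^sub>M \<pi>)"
proof -
  interpret \<pi>: prob_space \<pi> by (rule poisson_lawD[OF \<pi>])
  interpret pair_prob_space \<pi> \<pi> ..
  have s: "sets (\<pi> \<Otimes>\<^sub>M \<pi>) = sets N2" using poisson_lawD(2)[OF \<pi>] by (intro sets_pair_measure_cong)
  have "(\<integral>p. gen z (fst p) * gen w (snd p) \<partial>(\<pi> \<Otimes>\<^sub>M \<pi>)) = exp ((\<integral>x. z x - 1 \<partial>lam) + (\<integral>x. w x - 1 \<partial>lam))"
    if zw: "test z" "test w" for z w
  proof -
    have "(\<lambda>p. gen z (fst p) * gen w (snd p)) \<in> borel_measurable (\<pi> \<Otimes>\<^sub>M \<pi>)"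
      using measurable_gen_fst_snd[OF zw] s measurable_cong_sets by blast
    then have "integrable (\<pi> \<Otimes>\<^sub>M \<pi>) (\<lambda>p. gen z (fst p) * gen w (snd p))"
      by (intro integrable_bounded[where b=1] abs_gen_mult_le_1)
    then have "(\<integral>p. gen z (fst p) * gen w (snd p) \<partial>(\<pi> \<Otimes>\<^sub>M \<pi>)) = (\<integral>\<mu>. \<integral>\<nu>. gen z \<mu> * gen w \<nu> \<partial>\<pi> \<partial>\<pi>)"
      by (subst integral_fst'[symmetric]) simp_all
    then show ?thesis using poisson_lawD(3)[OF \<pi>] zw by (simp add: exp_add)
  qed
  then show ?thesis
    unfolding coupling_def using s prob_space_axioms by simp
qed

text \<open>The measures \<open>K t\<close> are specified for each \<open>t\<close> separately, so
  measurability in \<open>t\<close> must come from the law: it is evident from the explicit formula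
  for generating functionals and passes to all bounded functionals by the monotone class
  theorem.\<close>

lemma coupling_kernel:
  assumes K: "\<And>t. t \<in> space T \<Longrightarrow> coupling (r t) (K t)" and r [measurable]: "r \<in> borel_measurable T"
  shows "K \<in> T \<rightarrow>\<^sub>M prob_algebra N2"
proof (rule measurable_prob_algebra_generated)
  show "sets N2 = sigma_sets (space N2) (sets N2)" by (simp add: sets.sigma_sets_eq)
  show "Int_stable (sets N2)" by (auto simp: Int_stable_def)
  show "sets N2 \<subseteq> Pow (space N2)" by (rule sets.space_closed)
  show "prob_space (K t)" "sets (K t) = sets N2" if "t \<in> space T" for t
    using couplingD[OF K[OF that]] by auto
  have int: "integrable (K t) f" if "bounded_measurable N2 b f" "t \<in> space T" for f b t
  proof -
    interpret prob_space "K t" using couplingD(1)[OF K[OF that(2)]] .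
    note s = couplingD(2)[OF K[OF that(2)]]
    show ?thesis
      using bounded_measurableD[OF that(1)]
      by (intro integrable_bounded[where b=b]) (simp_all add: sets_eq_imp_space_eq[OF s] measurable_cong_sets[OF s refl])
  qed
  have H: "(\<lambda>t. \<integral>x. f x \<partial>K t) \<in> borel_measurable T" if "bounded_measurable N2 b f" for f b
    using that
  proof (rule monotone_class_pair[where H="\<lambda>f. (\<lambda>t. \<integral>x. f x \<partial>K t) \<in> borel_measurable T"])
    show "(\<lambda>t. \<integral>p. gen z (fst p) * gen w (snd p) \<partial>K t) \<in> borel_measurable T" if "test z" "test w" for z w
      by (subst measurable_cong[OF couplingD(3)[OF K that]]) measurable
  next
    fix f g :: "'a measure \<times> 'a measure \<Rightarrow> real" and a b r
    assume m: "(\<lambda>t. \<integral>x. f x \<partial>K t) \<in> borel_measurable T" "(\<lambda>t. \<integral>x. g x \<partial>K t) \<in> borel_measurable T"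
      and fg: "bounded_measurable N2 a f" "bounded_measurable N2 b g"
    have "(\<integral>x. f x + r * g x \<partial>K t) = (\<integral>x. f x \<partial>K t) + r * (\<integral>x. g x \<partial>K t)" if "t \<in> space T" for t
      using int[OF fg(1) that] int[OF fg(2) that] by simp
    then show "(\<lambda>t. \<integral>x. f x + r * g x \<partial>K t) \<in> borel_measurable T"
      using m by (simp cong: measurable_cong)
  next
    fix f :: "nat \<Rightarrow> 'a measure \<times> 'a measure \<Rightarrow> real" and g b
    assume m: "\<And>n. (\<lambda>t. \<integral>x. f n x \<partial>K t) \<in> borel_measurable T" and f: "\<And>n. bounded_measurable N2 b (f n)"
      and l: "\<And>x. x \<in> space N2 \<Longrightarrow> (\<lambda>n. f n x) \<longlonglongrightarrow> g x"
    have lim: "(\<lambda>n. \<integral>x. f n x \<partial>K t) \<longlonglongrightarrow> (\<integral>x. g x \<partial>K t)" if t: "t \<in> space T" for t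
    proof -
      interpret prob_space "K t" using couplingD(1)[OF K[OF t]] .
      note s = couplingD(2)[OF K[OF t]]
      show ?thesis
        by (rule bounded_convergence[where b=b])
          (simp_all add: bounded_measurableD[OF f] l sets_eq_imp_space_eq[OF s] measurable_cong_sets[OF s refl])
    qed
    show "(\<lambda>t. \<integral>x. g x \<partial>K t) \<in> borel_measurable T"
      by (rule borel_measurable_LIMSEQ_real[OF lim m])
  qed
  fix A assume A: "A \<in> sets N2"
  have "(\<lambda>t. \<integral>x. indicator A x \<partial>K t :: real) \<in> borel_measurable T"
    using A by (intro H[where b=1]) (simp add: bounded_measurable_def indicator_def)
  then have m: "(\<lambda>t. ennreal (\<integral>x. indicator A x \<partial>K t)) \<in> borel_measurable T" by measurable
  show "(\<lambda>t. emeasure (K t) A) \<in> borel_measurable T"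
  proof (rule measurable_cong[THEN iffD1, OF _ m])
    fix t assume t: "t \<in> space T"
    interpret prob_space "K t" using couplingD(1)[OF K[OF t]] .
    show "ennreal (\<integral>x. indicator A x \<partial>K t) = emeasure (K t) A"
      using A couplingD(2)[OF K[OF t]] by (simp add: emeasure_eq_measure)
  qed
qed

end

section \<open>Resampling on a set of finite intensity\<close>

lemma integral_kernel_measurable:
  fixes f :: "'a \<times> 'b \<Rightarrow> real"
  assumes K: "K \<in> S \<rightarrow>\<^sub>M prob_algebra L" and f [measurable]: "f \<in> borel_measurable (S \<Otimes>\<^sub>M L)"
  shows "(\<lambda>s. \<integral>p. f (s, p) \<partial>K s) \<in> borel_measurable S"
proof -
  note [measurable] = measurable_prob_algebraD[OF K] measurable_distr2
  have "(\<lambda>s. integral\<^sup>L (distr (K s) (S \<Otimes>\<^sub>M L) (\<lambda>p. (s, p))) f) \<in> borel_measurable S"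
    by measurable
  then show ?thesis
    by (rule measurable_cong[THEN iffD1, rotated])
      (simp add: integral_distr measurable_prob_algebraD[OF K, THEN subprob_measurableD(2)]
        cong: measurable_cong_sets)
qed

abbreviation "exp_law \<equiv> density lborel (\<lambda>t. ennreal (exponential_density 1 t))"

lemma prob_space_exp_law: "prob_space exp_law"
  by (rule prob_space_exponential_density) simp

lemma integral_exp_law:
  fixes f :: "real \<Rightarrow> real"
  assumes [measurable]: "f \<in> borel_measurable borel"
  shows "(\<integral>t. f t \<partial>exp_law) = (\<integral>t. indicator {0..} t * (exp (- t) * f t) \<partial>lborel)"
proof -
  have "(\<integral>t. f t \<partial>exp_law) = (\<integral>t. exponential_density 1 t *\<^sub>R f t \<partial>lborel)"
    by (intro integral_density) (auto simp: exponential_density_nonneg)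
  also have "\<dots> = (\<integral>t. indicator {0..} t * (exp (- t) * f t) \<partial>lborel)"
    by (intro Bochner_Integration.integral_cong) (auto simp: exponential_density_def)
  finally show ?thesis .
qed

text \<open>The function \<open>- exp (exp (- t) * c)\<close> is an antiderivative of the weighted
  integrand; it runs from \<open>- exp c\<close> at 0 to \<open>- 1\<close> at infinity.
  Nonnegativity of \<open>c\<close> permits the nonnegative form of the fundamental theorem on a
  half-line.\<close>

lemma integral_exp_law_exp:
  assumes c: "0 \<le> c"
  shows "(\<integral>t. c * exp (exp (- max 0 t) * c) \<partial>exp_law) = exp c - 1"
proof -
  have "(\<integral>\<^sup>+t. ennreal (exp (- t) * (c * exp (exp (- t) * c))) * indicator {0..} t \<partial>lborel)
      = ennreal ((- 1) - (- exp (exp (- 0) * c)))"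
  proof (rule nn_integral_FTC_atLeast)
    show "DERIV (\<lambda>t. - exp (exp (- t) * c)) t :> exp (- t) * (c * exp (exp (- t) * c))" for t
      by (auto intro!: derivative_eq_intros)
    have "((\<lambda>t :: real. exp (- t)) \<longlongrightarrow> 0) at_top"
      using filterlim_compose[OF exp_at_bot filterlim_uminus_at_bot_at_top] by simp
    then have "((\<lambda>t. - exp (exp (- t) * c)) \<longlongrightarrow> - exp (0 * c)) at_top"
      by (intro tendsto_intros)
    then show "((\<lambda>t. - exp (exp (- t) * c)) \<longlongrightarrow> - 1) at_top" by simp
  qed (use c in auto)
  moreover have "(\<integral>\<^sup>+t. ennreal (indicator {0..} t * (exp (- t) * (c * exp (exp (- t) * c)))) \<partial>lborel)
      = (\<integral>\<^sup>+t. ennreal (exp (- t) * (c * exp (exp (- t) * c))) * indicator {0..} t \<partial>lborel)"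
    by (intro nn_integral_cong) (auto split: split_indicator)
  ultimately have nn: "(\<integral>\<^sup>+t. ennreal (indicator {0..} t * (exp (- t) * (c * exp (exp (- t) * c)))) \<partial>lborel) = ennreal (exp c - 1)"
    by simp
  have "(\<integral>t. c * exp (exp (- max 0 t) * c) \<partial>exp_law)
      = (\<integral>t. indicator {0..} t * (exp (- t) * (c * exp (exp (- max 0 t) * c))) \<partial>lborel)"
    by (rule integral_exp_law) measurable
  also have "\<dots> = (\<integral>t. indicator {0..} t * (exp (- t) * (c * exp (exp (- t) * c))) \<partial>lborel)"
    by (intro Bochner_Integration.integral_cong) (auto simp: indicator_def)
  also have "\<dots> = enn2real (ennreal (exp c - 1))"
    using c by (subst integral_eq_nn_integral) (auto simp: nn)
  finally show ?thesis using c by simp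
qed

context intensity
begin

text \<open>The mixed difference that adds the same point once in each coordinate. On a product
  functional it factors into two add-one costs, and in contrast to such a product of costs it is
  linear in \<open>H\<close>.\<close>

definition second_diff :: "('a measure \<times> 'a measure \<Rightarrow> real) \<Rightarrow> 'a \<Rightarrow> 'a measure \<Rightarrow> 'a measure \<Rightarrow> real" where
  "second_diff H x \<mu> \<nu> = H (add_pt X \<mu> x, add_pt X \<nu> x) - H (add_pt X \<mu> x, \<nu>) - H (\<mu>, add_pt X \<nu> x) + H (\<mu>, \<nu>)"

lemma measurable_second_diff [measurable (raw)]:
  assumes H: "H \<in> borel_measurable N2" and a: "a \<in> S \<rightarrow>\<^sub>M X" and f: "f \<in> S \<rightarrow>\<^sub>M N" and g: "g \<in> S \<rightarrow>\<^sub>M N"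
  shows "(\<lambda>s. second_diff H (a s) (f s) (g s)) \<in> borel_measurable S"
  unfolding second_diff_def
  by (intro borel_measurable_add borel_measurable_diff measurable_compose[OF measurable_Pair H]
      measurable_add_pt f g a)

lemma glue_space: "\<mu> \<in> space N \<Longrightarrow> \<nu> \<in> space N \<Longrightarrow> B \<in> sets X \<Longrightarrow> glue X B \<mu> \<nu> \<in> space N"
  using measurable_space[OF measurable_glue[OF measurable_fst measurable_snd], of B X "(\<mu>, \<nu>)"]
  by (simp add: space_pair_measure)

lemma abs_second_diff_le:
  assumes H: "\<And>p. p \<in> space N2 \<Longrightarrow> \<bar>H p\<bar> \<le> b" and "x \<in> space X" "\<mu> \<in> space N" "\<nu> \<in> space N"
  shows "\<bar>second_diff H x \<mu> \<nu>\<bar> \<le> 4 * b"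
proof -
  have "\<bar>H (\<mu>', \<nu>')\<bar> \<le> b" if "\<mu>' \<in> space N" "\<nu>' \<in> space N" for \<mu>' \<nu>'
    using that by (intro H) (simp add: space_pair_measure)
  note this[OF add_pt_counting add_pt_counting] this[OF add_pt_counting] this[OF _ add_pt_counting] this
  then have "\<bar>H (add_pt X \<mu> x, add_pt X \<nu> x)\<bar> \<le> b" "\<bar>H (add_pt X \<mu> x, \<nu>)\<bar> \<le> b"
    "\<bar>H (\<mu>, add_pt X \<nu> x)\<bar> \<le> b" "\<bar>H (\<mu>, \<nu>)\<bar> \<le> b"
    using assms by auto
  then show ?thesis unfolding second_diff_def by linarith
qed

end

text \<open>The truncation \<open>max 0 t\<close> makes \<open>K\<close> total: negative times
  repeat time 0, and the exponential law gives them no mass.\<close>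

locale coupling_family = intensity X lam Bn
  for X lam :: "'a measure" and Bn :: "nat \<Rightarrow> 'a set" +
  fixes \<pi> :: "'a measure measure" and K :: "real \<Rightarrow> ('a measure \<times> 'a measure) measure"
  assumes \<pi>: "poisson_law \<pi>" and K: "\<And>t. coupling (exp (- max 0 t)) (K t)"
begin

sublocale \<pi>: prob_space \<pi> by (rule poisson_lawD[OF \<pi>])
sublocale K: prob_space "K t" for t by (rule couplingD[OF K])
sublocale T: prob_space exp_law by (rule prob_space_exp_law)
sublocale R: pair_sigma_finite exp_law lam ..

lemma sets_\<pi> [measurable_cong]: "sets \<pi> = sets N" by (rule poisson_lawD[OF \<pi>])
lemma sets_K [measurable_cong]: "sets (K t) = sets N2" by (rule couplingD[OF K])
lemma sets_lam [measurable_cong]: "sets lam = sets X" by (rule lam_sets)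
lemma space_\<pi>: "space \<pi> = space N" by (rule sets_eq_imp_space_eq[OF sets_\<pi>])
lemma space_K: "space (K t) = space N2" by (rule sets_eq_imp_space_eq[OF sets_K])

abbreviation "R \<equiv> exp_law \<Otimes>\<^sub>M lam"

lemma K_kernel: "K \<in> borel \<rightarrow>\<^sub>M prob_algebra N2"
  by (rule coupling_kernel[OF K]) measurable

lemma integral_K_measurable:
  fixes f :: "real \<Rightarrow> 'a \<Rightarrow> 'a measure \<times> 'a measure \<Rightarrow> real"
  assumes "(\<lambda>q. f (fst (fst q)) (snd (fst q)) (snd q)) \<in> borel_measurable ((borel \<Otimes>\<^sub>M X) \<Otimes>\<^sub>M N2)"
  shows "(\<lambda>r. \<integral>p. f (fst r) (snd r) p \<partial>K (fst r)) \<in> borel_measurable R"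
proof -
  have k: "(\<lambda>r. K (fst r)) \<in> borel \<Otimes>\<^sub>M X \<rightarrow>\<^sub>M prob_algebra N2"
    by (rule measurable_compose[OF measurable_fst K_kernel])
  have "(\<lambda>r. \<integral>p. f (fst r) (snd r) p \<partial>K (fst r)) \<in> borel_measurable (borel \<Otimes>\<^sub>M X)"
    using integral_kernel_measurable[OF k assms] by simp
  moreover have "sets R = sets (borel \<Otimes>\<^sub>M X)"
    by (intro sets_pair_measure_cong) (auto simp: lam_sets)
  ultimately show ?thesis by (simp cong: measurable_cong_sets)
qed

lemma snd_R: "r \<in> space R \<Longrightarrow> snd r \<in> space X"
  using measurable_space[OF measurable_snd, of r exp_law lam] by (simp only: lam_space)

text \<open>Time has total mass 1, so finiteness of the intensity on \<open>Bn n\<close> makes the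
  whole strip finite. Bounded functions supported there are integrable, which is what the
  localisation is for.\<close>

lemma emeasure_R_strip: "emeasure R (UNIV \<times> Bn n) < \<top>"
  using Bn_fin[of n] T.emeasure_space_1 by (subst lam.emeasure_pair_measure_Times) (auto simp: lam_sets)

text \<open>For \<open>H = gen z \<otimes> gen w\<close> the second difference is \<open>(z x - 1) (w x - 1)\<close> times \<open>H\<close>, so that with
  \<open>c = \<integral>\<^sub>B (z - 1) (w - 1)\<close> the claim becomes \<open>\<integral> exp (- t) c exp (exp (- t) c) dt = exp c - 1\<close> over \<open>t \<ge> 0\<close>. The
  restriction to \<open>Bn n\<close> keeps the right-hand side bounded in \<open>H\<close>, as the monotone class argument requires.\<close>

lemma resampling_identity:
  fixes H :: "'a measure \<times> 'a measure \<Rightarrow> real"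
  assumes H: "bounded_measurable N2 b H"
  shows "(\<integral>\<mu>. H (\<mu>, \<mu>) \<partial>\<pi>) - (\<integral>p. H (fst p, glue X (Bn n) (fst p) (snd p)) \<partial>(\<pi> \<Otimes>\<^sub>M \<pi>)) =
    (\<integral>r. indicator (Bn n) (snd r) *
       (\<integral>p. second_diff H (snd r) (fst p) (glue X (Bn n) (fst p) (snd p)) \<partial>K (fst r)) \<partial>R)"
proof -
  let ?g = "\<lambda>p. glue X (Bn n) (fst p) (snd p)"
  let ?J = "\<lambda>H r. \<integral>p. second_diff H (snd r) (fst p) (?g p) \<partial>K (fst r)"
  interpret pp: pair_prob_space \<pi> \<pi> ..
  have sp: "space (\<pi> \<Otimes>\<^sub>M \<pi>) = space N2" by (simp add: space_pair_measure space_\<pi>)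
  define Q where "Q H \<longleftrightarrow> (\<integral>\<mu>. H (\<mu>, \<mu>) \<partial>\<pi>) - (\<integral>p. H (fst p, ?g p) \<partial>(\<pi> \<Otimes>\<^sub>M \<pi>))
      = (\<integral>r. indicator (Bn n) (snd r) * ?J H r \<partial>R)"
    for H :: "'a measure \<times> 'a measure \<Rightarrow> real"
  have diag: "(\<mu>, \<mu>) \<in> space N2" if "\<mu> \<in> space \<pi>" for \<mu> using that by (simp add: space_pair_measure space_\<pi>)
  have gl: "(fst p, ?g p) \<in> space N2" if "p \<in> space N2" for p
    using that glue_space[of "fst p" "snd p" "Bn n"] by (auto simp: space_pair_measure Bn_sets)
  have sd_bd: "\<bar>second_diff H x (fst p) (?g p)\<bar> \<le> 4 * b"
    if "\<And>p. p \<in> space N2 \<Longrightarrow> \<bar>H p\<bar> \<le> b" "x \<in> space X" "p \<in> space N2" for H b x p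
    using that gl[OF that(3)] by (intro abs_second_diff_le) (auto simp: space_pair_measure)
  have sd_meas: "(\<lambda>p. second_diff H x (fst p) (?g p)) \<in> borel_measurable N2"
    if "H \<in> borel_measurable N2" "x \<in> space X" for H x
    by (intro measurable_second_diff measurable_glue measurable_const measurable_fst measurable_snd Bn_sets that)
  have sd_int: "integrable (K t) (\<lambda>p. second_diff H x (fst p) (?g p))"
    if "H \<in> borel_measurable N2" "x \<in> space X" "\<And>p. p \<in> space N2 \<Longrightarrow> \<bar>H p\<bar> \<le> b" for H x b t
  proof (rule K.integrable_bounded[where b="4*b"])
    show "(\<lambda>p. second_diff H x (fst p) (?g p)) \<in> borel_measurable (K t)"
      unfolding measurable_cong_sets[OF sets_K refl] by (rule sd_meas[OF that(1,2)])
  qed (use sd_bd[OF that(3,2)] in \<open>simp add: space_K\<close>)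
  have J_meas: "?J H \<in> borel_measurable R" if "H \<in> borel_measurable N2" for H
    by (rule integral_K_measurable)
      (intro measurable_second_diff measurable_glue Bn_sets that
        measurable_compose[OF measurable_fst measurable_snd] measurable_compose[OF measurable_snd measurable_fst]
        measurable_compose[OF measurable_snd measurable_snd])
  have J_bd: "\<bar>?J H r\<bar> \<le> 4 * b"
    if m: "H \<in> borel_measurable N2" and b: "\<And>p. p \<in> space N2 \<Longrightarrow> \<bar>H p\<bar> \<le> b" and r: "r \<in> space R" for H b r
  proof -
    have x: "snd r \<in> space X" using r by (rule snd_R)
    then have int: "integrable (K (fst r)) (\<lambda>p. second_diff H (snd r) (fst p) (?g p))"
      by (intro sd_int[OF m _ b])
    have "\<bar>?J H r\<bar> \<le> (\<integral>p. \<bar>second_diff H (snd r) (fst p) (?g p)\<bar> \<partial>K (fst r))"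
      by (rule integral_abs_bound)
    also have "\<dots> \<le> (\<integral>p. 4 * b \<partial>K (fst r))"
      using int sd_bd[OF b x] by (intro integral_mono) (auto simp: space_K)
    finally show ?thesis by (simp add: K.prob_space)
  qed
  have J_int: "integrable R (\<lambda>r. indicator (Bn n) (snd r) * ?J H r)" if H: "bounded_measurable N2 b H" for H b
  proof (rule integrableI_bounded_set[where A="UNIV \<times> Bn n" and B="4*b"])
    show "(\<lambda>r. indicator (Bn n) (snd r) * ?J H r) \<in> borel_measurable R"
      using J_meas[OF bounded_measurableD(1)[OF H]] by measurable
    show "AE r in R. r \<in> UNIV \<times> Bn n \<longrightarrow> norm (indicator (Bn n) (snd r) * ?J H r) \<le> 4 * b"
      using J_bd[OF bounded_measurableD[OF H]] by (intro AE_I2) auto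
  qed (auto simp: emeasure_R_strip lam_sets mem_Times_iff)
  have "Q H"
    using H
  proof (rule monotone_class_pair[where H=Q])
    fix z w assume z: "test z" and w: "test w"
    let ?H = "\<lambda>p :: 'a measure \<times> 'a measure. gen z (fst p) * gen w (snd p)"
    note zm [measurable] = testD(2)[OF z] testD(2)[OF w]
    \<comment> \<open>The cross integral is split into \<open>c\<close> over \<open>Bn n\<close> and
      \<open>c'\<close> off it. Off \<open>Bn n\<close> the two configurations agree, so
      \<open>c'\<close> has coefficient 1 in every term and \<open>exp (a + b + c')\<close> factors
      out; only the coefficient of \<open>c\<close> changes with time.\<close>
    define a b c c' where "a = (\<integral>x. z x - 1 \<partial>lam)" and "b = (\<integral>x. w x - 1 \<partial>lam)"
      and "c = (\<integral>x. indicator (Bn n) x * ((z x - 1) * (w x - 1)) \<partial>lam)"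
      and "c' = (\<integral>x. indicator (space X - Bn n) x * ((z x - 1) * (w x - 1)) \<partial>lam)"
    have int_c: "integrable lam (\<lambda>x. indicator (Bn n) x * ((z x - 1) * (w x - 1)))"
      using integrable_mult_indicator[OF _ integrable_test2[OF z w], of "Bn n"] lam_sets Bn_sets by simp
    have int_c': "integrable lam (\<lambda>x. indicator (space X - Bn n) x * ((z x - 1) * (w x - 1)))"
      using integrable_mult_indicator[OF _ integrable_test2[OF z w], of "space X - Bn n"] lam_sets Bn_sets by simp
    have "0 \<le> (z x - 1) * (w x - 1)" for x
      using testD(4)[OF z, of x] testD(4)[OF w, of x] by (auto intro!: mult_nonpos_nonpos)
    then have c: "0 \<le> c" unfolding c_def by (intro integral_nonneg_AE) auto
    have m: "?H \<in> borel_measurable N2" by (rule measurable_gen_fst_snd[OF z w])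
    have "(\<integral>\<mu>. ?H (\<mu>, \<mu>) \<partial>\<pi>) = (\<integral>\<mu>. gen (\<lambda>x. z x * w x) \<mu> \<partial>\<pi>)"
      by (intro Bochner_Integration.integral_cong) (auto simp: gen_test_mult z w sets_counting space_\<pi>)
    also have "\<dots> = exp (\<integral>x. z x * w x - 1 \<partial>lam)"
      by (rule poisson_lawD(3)[OF \<pi> test_mult[OF z w]])
    also have "(\<integral>x. z x * w x - 1 \<partial>lam) = (\<integral>x. (z x - 1) + (w x - 1)
        + indicator (space X - Bn n) x * ((z x - 1) * (w x - 1)) + 1 * (indicator (Bn n) x * ((z x - 1) * (w x - 1))) \<partial>lam)"
      using lam_space by (intro Bochner_Integration.integral_cong) (auto simp: indicator_def algebra_simps)
    also have "\<dots> = a + b + c' + 1 * c"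
      unfolding a_def b_def c_def c'_def by (rule integral_combine[OF integrable_test[OF z] integrable_test[OF w] int_c' int_c])
    finally have L1: "(\<integral>\<mu>. ?H (\<mu>, \<mu>) \<partial>\<pi>) = exp (a + b + c') * exp c" by (simp add: exp_add)
    have L2: "(\<integral>p. ?H (fst p, ?g p) \<partial>(\<pi> \<Otimes>\<^sub>M \<pi>)) = exp (a + b + c')"
      using integral_gen_glue[OF coupling_indep[OF \<pi>] z w Bn_sets] by (simp add: a_def b_def c'_def)
    have J: "?J ?H r = (z (snd r) - 1) * (w (snd r) - 1) * exp (a + b + c' + exp (- max 0 (fst r)) * c)"
      if r: "r \<in> space R" for r
    proof -
      have x: "snd r \<in> space X" using r by (rule snd_R)
      have "?J ?H r = (\<integral>p. (z (snd r) - 1) * (w (snd r) - 1) * ?H (fst p, ?g p) \<partial>K (fst r))"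
      proof (intro Bochner_Integration.integral_cong refl)
        fix p assume "p \<in> space (K (fst r))"
        then have "(fst p, ?g p) \<in> space N2" by (intro gl) (simp add: space_K)
        then have s: "sets (fst p) = sets X" "sets (?g p) = sets X" by (auto simp: space_pair_measure sets_counting)
        show "second_diff ?H (snd r) (fst p) (?g p) = (z (snd r) - 1) * (w (snd r) - 1) * ?H (fst p, ?g p)"
          unfolding second_diff_def fst_conv snd_conv
            gen_add_pt[OF s(1) zm(1) x testD(3,4)[OF z]] gen_add_pt[OF s(2) zm(2) x testD(3,4)[OF w]]
          by (simp add: algebra_simps)
      qed
      then show ?thesis
        using integral_gen_glue[OF K[of "fst r"] z w Bn_sets, of n] by (simp add: a_def b_def c'_def c_def)
    qed
    have int: "integrable R (\<lambda>r. indicator (Bn n) (snd r) * ?J ?H r)"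
      by (rule J_int[of 1]) (use m abs_gen_mult_le_1 in \<open>unfold bounded_measurable_def, blast\<close>)
    have "(\<integral>r. indicator (Bn n) (snd r) * ?J ?H r \<partial>R)
        = (\<integral>t. \<integral>x. indicator (Bn n) (snd (t, x)) * ?J ?H (t, x) \<partial>lam \<partial>exp_law)"
      by (rule R.integral_fst'[OF int, symmetric])
    also have "\<dots> = (\<integral>t. \<integral>x. indicator (Bn n) x * ((z x - 1) * (w x - 1)) * exp (a + b + c' + exp (- max 0 t) * c) \<partial>lam \<partial>exp_law)"
      by (intro Bochner_Integration.integral_cong refl) (subst J, auto simp: space_pair_measure)
    also have "\<dots> = (\<integral>t. exp (a + b + c') * (c * exp (exp (- max 0 t) * c)) \<partial>exp_law)"
    proof (intro Bochner_Integration.integral_cong refl)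
      fix t :: real
      have "(\<integral>x. indicator (Bn n) x * ((z x - 1) * (w x - 1)) * exp (a + b + c' + exp (- max 0 t) * c) \<partial>lam)
          = c * exp (a + b + c' + exp (- max 0 t) * c)"
        unfolding c_def by (rule integral_mult_left_zero)
      then show "(\<integral>x. indicator (Bn n) x * ((z x - 1) * (w x - 1)) * exp (a + b + c' + exp (- max 0 t) * c) \<partial>lam)
          = exp (a + b + c') * (c * exp (exp (- max 0 t) * c))"
        by (simp add: exp_add mult_ac)
    qed
    also have "\<dots> = exp (a + b + c') * (exp c - 1)"
      using integral_exp_law_exp[OF c] by simp
    finally show "Q ?H"
      unfolding Q_def using L1 L2 by (simp add: algebra_simps)
  next
    fix f g a b and c :: real
    assume fg: "Q f" "Q g" and f: "bounded_measurable N2 a f" and g: "bounded_measurable N2 b g"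
    note fD = bounded_measurableD[OF f] and gD = bounded_measurableD[OF g]
    have I1: "integrable \<pi> (\<lambda>\<mu>. h (\<mu>, \<mu>))" "integrable (\<pi> \<Otimes>\<^sub>M \<pi>) (\<lambda>p. h (fst p, ?g p))"
      if h: "bounded_measurable N2 d h" for h d
    proof -
      note [measurable] = bounded_measurableD(1)[OF h]
      show "integrable \<pi> (\<lambda>\<mu>. h (\<mu>, \<mu>))"
        by (rule \<pi>.integrable_bounded[where b=d]) (use bounded_measurableD(2)[OF h] diag in auto)
      show "integrable (\<pi> \<Otimes>\<^sub>M \<pi>) (\<lambda>p. h (fst p, ?g p))"
        by (rule pp.integrable_bounded[where b=d]) (use bounded_measurableD(2)[OF h] gl sp in auto)
    qed
    have J: "?J (\<lambda>p. f p + c * g p) r = ?J f r + c * ?J g r" if r: "r \<in> space R" for r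
    proof -
      have x: "snd r \<in> space X" using r by (rule snd_R)
      have "second_diff (\<lambda>p. f p + c * g p) (snd r) (fst p) (?g p)
          = second_diff f (snd r) (fst p) (?g p) + c * second_diff g (snd r) (fst p) (?g p)" for p
        by (simp add: second_diff_def algebra_simps)
      then show ?thesis
        using sd_int[OF fD(1) x fD(2), of "fst r"] sd_int[OF gD(1) x gD(2), of "fst r"] by simp
    qed
    have "(\<integral>r. indicator (Bn n) (snd r) * ?J (\<lambda>p. f p + c * g p) r \<partial>R)
        = (\<integral>r. indicator (Bn n) (snd r) * ?J f r + c * (indicator (Bn n) (snd r) * ?J g r) \<partial>R)"
      by (intro Bochner_Integration.integral_cong refl) (simp only: J distrib_left mult.left_commute)
    also have "\<dots> = (\<integral>r. indicator (Bn n) (snd r) * ?J f r \<partial>R) + c * (\<integral>r. indicator (Bn n) (snd r) * ?J g r \<partial>R)"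
      using J_int[OF f] integrable_mult_right[OF J_int[OF g], of c]
      by (simp only: Bochner_Integration.integral_add integral_mult_right_zero)
    finally show "Q (\<lambda>p. f p + c * g p)"
      using fg I1[OF f] I1[OF g] unfolding Q_def by (simp add: algebra_simps)
  next
    fix f :: "nat \<Rightarrow> 'a measure \<times> 'a measure \<Rightarrow> real" and g b
    assume fQ: "\<And>k. Q (f k)" and f: "\<And>k. bounded_measurable N2 b (f k)" and g: "bounded_measurable N2 b g"
      and l: "\<And>p. p \<in> space N2 \<Longrightarrow> (\<lambda>k. f k p) \<longlonglongrightarrow> g p"
    note fm [measurable] = bounded_measurableD(1)[OF f] and b = bounded_measurableD(2)[OF f]
      and gm = bounded_measurableD(1)[OF g]
    have L1: "(\<lambda>k. \<integral>\<mu>. f k (\<mu>, \<mu>) \<partial>\<pi>) \<longlonglongrightarrow> (\<integral>\<mu>. g (\<mu>, \<mu>) \<partial>\<pi>)"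
      by (rule \<pi>.bounded_convergence[where b=b]) (use b l diag in auto)
    have L2: "(\<lambda>k. \<integral>p. f k (fst p, ?g p) \<partial>(\<pi> \<Otimes>\<^sub>M \<pi>)) \<longlonglongrightarrow> (\<integral>p. g (fst p, ?g p) \<partial>(\<pi> \<Otimes>\<^sub>M \<pi>))"
      by (rule pp.bounded_convergence[where b=b]) (use b l gl sp in auto)
    have J: "(\<lambda>k. ?J (f k) r) \<longlonglongrightarrow> ?J g r" if r: "r \<in> space R" for r
    proof -
      have x: "snd r \<in> space X" using r by (rule snd_R)
      have "(\<lambda>k. second_diff (f k) (snd r) (fst p) (?g p)) \<longlonglongrightarrow> second_diff g (snd r) (fst p) (?g p)"
        if p: "p \<in> space N2" for p
      proof -
        have m: "fst p \<in> space N" "?g p \<in> space N" using gl[OF p] by (auto simp: space_pair_measure)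
        show ?thesis unfolding second_diff_def
          by (intro tendsto_intros l) (auto simp: space_pair_measure m x add_pt_counting)
      qed
      then show ?thesis
        by (intro K.bounded_convergence[where b="4*b"])
          (simp_all add: space_K sd_bd[OF b x] measurable_cong_sets[OF sets_K refl] sd_meas[OF fm x])
    qed
    \<comment> \<open>The dominating function is the constant \<open>4 * b\<close> on the strip over
      \<open>Bn n\<close>. Over the whole space this constant would fail to be integrable for
      infinite intensity.\<close>
    have L3: "(\<lambda>k. \<integral>r. indicator (Bn n) (snd r) * ?J (f k) r \<partial>R) \<longlonglongrightarrow> (\<integral>r. indicator (Bn n) (snd r) * ?J g r \<partial>R)"
    proof (rule integral_dominated_convergence[where w="\<lambda>r. (4 * b) * indicator (UNIV \<times> Bn n) r"])
      show "integrable R (\<lambda>r. (4 * b) * indicator (UNIV \<times> Bn n) r)"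
        using emeasure_R_strip by (intro integrable_mult_right integrable_real_indicator) (auto simp: lam_sets)
      show "AE r in R. (\<lambda>k. indicator (Bn n) (snd r) * ?J (f k) r) \<longlonglongrightarrow> indicator (Bn n) (snd r) * ?J g r"
        by (intro AE_I2 tendsto_mult_left J)
      show "AE r in R. norm (indicator (Bn n) (snd r) * ?J (f k) r) \<le> (4 * b) * indicator (UNIV \<times> Bn n) r" for k
        using J_bd[OF fm b] by (intro AE_I2) (auto simp: indicator_def mem_Times_iff)
      show "(\<lambda>r. indicator (Bn n) (snd r) * ?J g r) \<in> borel_measurable R"
        using J_meas[OF gm] by measurable
      show "(\<lambda>r. indicator (Bn n) (snd r) * ?J (f k) r) \<in> borel_measurable R" for k
        using J_meas[OF fm] by measurable
    qed
    have "(\<lambda>k. (\<integral>\<mu>. f k (\<mu>, \<mu>) \<partial>\<pi>) - (\<integral>p. f k (fst p, ?g p) \<partial>(\<pi> \<Otimes>\<^sub>M \<pi>)))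
        \<longlonglongrightarrow> (\<integral>\<mu>. g (\<mu>, \<mu>) \<partial>\<pi>) - (\<integral>p. g (fst p, ?g p) \<partial>(\<pi> \<Otimes>\<^sub>M \<pi>))"
      by (rule tendsto_diff[OF L1 L2])
    moreover have "(\<integral>\<mu>. f k (\<mu>, \<mu>) \<partial>\<pi>) - (\<integral>p. f k (fst p, ?g p) \<partial>(\<pi> \<Otimes>\<^sub>M \<pi>))
        = (\<integral>r. indicator (Bn n) (snd r) * ?J (f k) r \<partial>R)" for k
      using fQ[of k] unfolding Q_def by blast
    ultimately have "(\<integral>\<mu>. g (\<mu>, \<mu>) \<partial>\<pi>) - (\<integral>p. g (fst p, ?g p) \<partial>(\<pi> \<Otimes>\<^sub>M \<pi>))
        = (\<integral>r. indicator (Bn n) (snd r) * ?J g r \<partial>R)"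
      using L3 by (simp add: LIMSEQ_unique)
    then show "Q g" unfolding Q_def .
  qed
  then show ?thesis unfolding Q_def by blast
qed

end

section \<open>Exhaustion and truncation\<close>

lemma gen_cong: "(\<And>x. x \<in> space \<mu> \<Longrightarrow> z x = w x) \<Longrightarrow> gen z \<mu> = gen w \<mu>"
  unfolding gen_def by (intro arg_cong[where f=exp_neg] nn_integral_cong) simp

lemma measurable_add_cost [measurable (raw)]:
  assumes F: "F \<in> borel_measurable (N_alg X)" and f: "f \<in> S \<rightarrow>\<^sub>M N_alg X" and g: "g \<in> S \<rightarrow>\<^sub>M X"
  shows "(\<lambda>s. add_cost X F (f s) (g s)) \<in> borel_measurable S"
  unfolding add_cost_def
  by (intro borel_measurable_diff measurable_compose[OF _ F] measurable_add_pt f g)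

context coupling_family
begin

section \<open>Convergence of glued configurations\<close>

lemma law_fst: "coupling s P \<Longrightarrow> distr P N fst = \<pi>"
  by (rule poisson_law_unique[OF coupling_fst \<pi>])

lemma law_snd: "coupling s P \<Longrightarrow> distr P N snd = \<pi>"
  by (rule poisson_law_unique[OF coupling_snd \<pi>])

lemma law_glue: "coupling s P \<Longrightarrow> B \<in> sets X \<Longrightarrow> distr P N (\<lambda>p. glue X B (fst p) (snd p)) = \<pi>"
  by (rule poisson_law_unique[OF coupling_glue \<pi>])

text \<open>A merely measurable \<psi> need not be continuous along the glued configurations, so no
  pointwise limit is taken. For generating functionals the difference vanishes exactly once
  \<open>Bn n\<close> contains the supports of the test functions. The general case follows by
  approximation, with an error uniform in \<open>n\<close> because the glued and the second
  configuration both have law \<pi>.\<close>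

lemma glue_tendsto:
  fixes \<psi> :: "'a measure \<Rightarrow> real"
  assumes P: "coupling s P" and \<psi>: "bounded_measurable N b0 \<psi>"
  shows "(\<lambda>n. \<integral>p. \<bar>\<psi> (glue X (Bn n) (fst p) (snd p)) - \<psi> (snd p)\<bar> \<partial>P) \<longlonglongrightarrow> 0"
proof -
  interpret P: prob_space P by (rule couplingD[OF P])
  note sP = couplingD(2)[OF P]
  define g where "g n p = glue X (Bn n) (fst p) (snd p)" for n and p :: "'a measure \<times> 'a measure"
  have g_meas: "g n \<in> P \<rightarrow>\<^sub>M N" for n
    unfolding g_def[abs_def] measurable_cong_sets[OF sP refl]
    by (intro measurable_glue measurable_fst measurable_snd Bn_sets)
  have s_meas: "snd \<in> P \<rightarrow>\<^sub>M N" unfolding measurable_cong_sets[OF sP refl] by (rule measurable_snd)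
  have id_meas: "(\<lambda>\<mu>. \<mu>) \<in> \<pi> \<rightarrow>\<^sub>M N" by (rule measurable_ident_sets[OF sets_\<pi>])
  \<comment> \<open>Functionals of pairs, evaluated on the diagonal, stand for functionals of one
    configuration; this brings the claim into the shape of
    \<open>monotone_class_pair\<close>.\<close>
  define d where "d f n = (\<integral>p. \<bar>f (g n p, g n p) - f (snd p, snd p)\<bar> \<partial>P)"
    for f :: "'a measure \<times> 'a measure \<Rightarrow> real" and n
  have diag: "(\<lambda>x. (u x, u x)) \<in> S \<rightarrow>\<^sub>M N2" if "u \<in> S \<rightarrow>\<^sub>M N" for S and u :: "'c \<Rightarrow> 'a measure"
    by (rule measurable_Pair[OF that that])
  have int: "integrable S (\<lambda>x. \<bar>f (u x, u x) - h (v x, v x)\<bar>)"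
    if f: "bounded_measurable N2 a f" and h: "bounded_measurable N2 b h" and u: "u \<in> S \<rightarrow>\<^sub>M N" and v: "v \<in> S \<rightarrow>\<^sub>M N"
      and S: "prob_space S" for f h and a b and S and u v :: "'c \<Rightarrow> 'a measure"
  proof -
    interpret S: prob_space S by fact
    note [measurable] = measurable_compose[OF diag[OF u] bounded_measurableD(1)[OF f]]
      measurable_compose[OF diag[OF v] bounded_measurableD(1)[OF h]]
    have "\<bar>\<bar>f (u x, u x) - h (v x, v x)\<bar>\<bar> \<le> a + b" if "x \<in> space S" for x
      using bounded_measurableD(2)[OF f measurable_space[OF diag[OF u] that]]
        bounded_measurableD(2)[OF h measurable_space[OF diag[OF v] that]] unfolding abs_idempotent by linarith
    then show ?thesis by (intro S.integrable_bounded[where b="a + b"]) simp_all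
  qed
  have "d (\<lambda>p. \<psi> (fst p)) \<longlonglongrightarrow> 0"
  proof (rule monotone_class_pair[where H="\<lambda>f. d f \<longlonglongrightarrow> 0" and b=b0])
    show "bounded_measurable N2 b0 (\<lambda>p. \<psi> (fst p))"
      using bounded_measurableD[OF \<psi>] measurable_compose[OF measurable_fst bounded_measurableD(1)[OF \<psi>]]
      by (auto simp: bounded_measurable_def space_pair_measure)
  next
    fix z w assume z: "test z" and w: "test w"
    obtain m where m: "\<forall>x\<in>space X - Bn m. z x = 1" using z unfolding test_def by blast
    obtain m' where m': "\<forall>x\<in>space X - Bn m'. w x = 1" using w unfolding test_def by blast
    have gen_g: "gen y (g n p) = gen y (snd p)"
      if p: "p \<in> space P" and y: "test y" and k: "\<forall>x\<in>space X - Bn k. y x = 1" "k \<le> n" for y k n p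
    proof -
      have "p \<in> space N2" using p sets_eq_imp_space_eq[OF sP] by simp
      then have s: "sets (fst p) = sets X" "sets (snd p) = sets X" by (auto simp: space_pair_measure sets_counting)
      have "y x = 1" if "x \<in> space X" "x \<notin> Bn n" for x using k Bn_mono[of k n x] that by blast
      then have "gen (\<lambda>x. if x \<in> Bn n then 1 else y x) (fst p) = gen (\<lambda>_. 1) (fst p)"
        and "gen (\<lambda>x. if x \<in> Bn n then y x else 1) (snd p) = gen y (snd p)"
        using sets_eq_imp_space_eq[OF s(1)] sets_eq_imp_space_eq[OF s(2)]
        by (intro gen_cong; simp)+
      then show ?thesis unfolding g_def gen_glue[OF s testD(2)[OF y] Bn_sets] by simp
    qed
    have zero: "d (\<lambda>p. gen z (fst p) * gen w (snd p)) n = 0" if n: "max m m' \<le> n" for n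
    proof -
      have "d (\<lambda>p. gen z (fst p) * gen w (snd p)) n = (\<integral>p. 0 \<partial>P)"
        unfolding d_def using n
        by (intro Bochner_Integration.integral_cong refl) (simp add: gen_g[OF _ z m] gen_g[OF _ w m'])
      then show ?thesis by simp
    qed
    show "d (\<lambda>p. gen z (fst p) * gen w (snd p)) \<longlonglongrightarrow> 0"
      by (intro tendsto_eventually eventually_sequentiallyI[of "max m m'"] zero)
  next
    fix f h a b and r :: real
    assume lim: "d f \<longlonglongrightarrow> 0" "d h \<longlonglongrightarrow> 0" and f: "bounded_measurable N2 a f" and h: "bounded_measurable N2 b h"
    note i = int[OF f f g_meas s_meas P.prob_space_axioms] int[OF h h g_meas s_meas P.prob_space_axioms]
    have "d (\<lambda>p. f p + r * h p) n \<le> d f n + \<bar>r\<bar> * d h n" for n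
    proof -
      have "d (\<lambda>p. f p + r * h p) n
          \<le> (\<integral>p. \<bar>f (g n p, g n p) - f (snd p, snd p)\<bar> + \<bar>r\<bar> * \<bar>h (g n p, g n p) - h (snd p, snd p)\<bar> \<partial>P)"
        unfolding d_def
      proof (rule integral_mono)
        fix p
        have "(f (g n p, g n p) + r * h (g n p, g n p)) - (f (snd p, snd p) + r * h (snd p, snd p))
            = (f (g n p, g n p) - f (snd p, snd p)) + r * (h (g n p, g n p) - h (snd p, snd p))"
          by (simp add: algebra_simps)
        then show "\<bar>(f (g n p, g n p) + r * h (g n p, g n p)) - (f (snd p, snd p) + r * h (snd p, snd p))\<bar>
            \<le> \<bar>f (g n p, g n p) - f (snd p, snd p)\<bar> + \<bar>r\<bar> * \<bar>h (g n p, g n p) - h (snd p, snd p)\<bar>"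
          by (metis abs_mult abs_triangle_ineq)
      qed (intro int[OF bounded_measurable_lin[OF f h] bounded_measurable_lin[OF f h] g_meas s_meas P.prob_space_axioms]
          Bochner_Integration.integrable_add integrable_mult_right i)+
      also have "\<dots> = d f n + \<bar>r\<bar> * d h n"
        unfolding d_def using i[of n] by simp
      finally show ?thesis .
    qed
    moreover have "(\<lambda>n. d f n + \<bar>r\<bar> * d h n) \<longlonglongrightarrow> 0 + \<bar>r\<bar> * 0"
      by (intro tendsto_add tendsto_mult_left lim)
    moreover have "0 \<le> d (\<lambda>p. f p + r * h p) n" for n unfolding d_def by simp
    ultimately show "d (\<lambda>p. f p + r * h p) \<longlonglongrightarrow> 0"
      by - (rule real_tendsto_sandwich[where f="\<lambda>_. 0" and h="\<lambda>n. d f n + \<bar>r\<bar> * d h n"], simp_all)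
  next
    fix f :: "nat \<Rightarrow> 'a measure \<times> 'a measure \<Rightarrow> real" and h b
    assume lim: "\<And>k. d (f k) \<longlonglongrightarrow> 0" and f: "\<And>k. bounded_measurable N2 b (f k)" and h: "bounded_measurable N2 b h"
      and l: "\<And>p. p \<in> space N2 \<Longrightarrow> (\<lambda>k. f k p) \<longlonglongrightarrow> h p"
    \<comment> \<open>The approximation error under the common law \<pi>. It bounds the error at the
      glued configuration and the error at the second one, both independently of \<open>n\<close>;
      the triangle inequality then has three terms, each below a third of the tolerance.\<close>
    define e where "e k = (\<integral>\<mu>. \<bar>h (\<mu>, \<mu>) - f k (\<mu>, \<mu>)\<bar> \<partial>\<pi>)" for k
    note D = measurable_space[OF diag[OF id_meas]]
    have "e \<longlonglongrightarrow> (\<integral>\<mu>. 0 \<partial>\<pi>)"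
      unfolding e_def
    proof (rule \<pi>.bounded_convergence[where b="b + b"])
      show "(\<lambda>\<mu>. \<bar>h (\<mu>, \<mu>) - f k (\<mu>, \<mu>)\<bar>) \<in> borel_measurable \<pi>" for k
        using int[OF h f id_meas id_meas \<pi>.prob_space_axioms] by (rule borel_measurable_integrable)
    next
      fix k \<mu> assume "\<mu> \<in> space \<pi>"
      then show "\<bar>\<bar>h (\<mu>, \<mu>) - f k (\<mu>, \<mu>)\<bar>\<bar> \<le> b + b"
        using bounded_measurableD(2)[OF h D, of \<mu>] bounded_measurableD(2)[OF f D, of \<mu> k]
        unfolding abs_idempotent by linarith
    next
      fix \<mu> assume "\<mu> \<in> space \<pi>"
      then have "(\<lambda>k. \<bar>h (\<mu>, \<mu>) - f k (\<mu>, \<mu>)\<bar>) \<longlonglongrightarrow> \<bar>h (\<mu>, \<mu>) - h (\<mu>, \<mu>)\<bar>"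
        by (intro tendsto_intros l D)
      then show "(\<lambda>k. \<bar>h (\<mu>, \<mu>) - f k (\<mu>, \<mu>)\<bar>) \<longlonglongrightarrow> 0" by simp
    qed
    then have e: "e \<longlonglongrightarrow> 0" by simp
    have le: "d h n \<le> e k + d (f k) n + e k" for n k
    proof -
      have m: "(\<lambda>\<mu>. \<bar>h (\<mu>, \<mu>) - f k (\<mu>, \<mu>)\<bar>) \<in> borel_measurable N"
        using borel_measurable_integrable[OF int[OF h f id_meas id_meas \<pi>.prob_space_axioms]]
        unfolding measurable_cong_sets[OF sets_\<pi> refl] .
      have eu: "(\<integral>p. \<bar>h (u p, u p) - f k (u p, u p)\<bar> \<partial>P) = e k" if u: "u \<in> P \<rightarrow>\<^sub>M N" "distr P N u = \<pi>" for u
        unfolding e_def u(2)[symmetric] by (rule integral_distr[OF u(1) m, symmetric])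
      note eg = eu[OF g_meas law_glue[OF P Bn_sets, folded g_def], of n] and es = eu[OF s_meas law_snd[OF P]]
      note i = int[OF h f g_meas g_meas P.prob_space_axioms, of n k n] int[OF f f g_meas s_meas P.prob_space_axioms, of k n k]
        int[OF h f s_meas s_meas P.prob_space_axioms, of k]
      have "d h n \<le> (\<integral>p. \<bar>h (g n p, g n p) - f k (g n p, g n p)\<bar> + \<bar>f k (g n p, g n p) - f k (snd p, snd p)\<bar>
             + \<bar>h (snd p, snd p) - f k (snd p, snd p)\<bar> \<partial>P)"
        unfolding d_def
        using i int[OF h h g_meas s_meas P.prob_space_axioms] by (intro integral_mono) auto
      also have "\<dots> = e k + d (f k) n + e k"
        unfolding d_def using i eg es by simp
      finally show ?thesis .
    qed
    show "d h \<longlonglongrightarrow> 0"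
    proof (rule LIMSEQ_I)
      fix \<epsilon> :: real assume "0 < \<epsilon>"
      then obtain k where k: "\<bar>e k\<bar> < \<epsilon> / 3" using LIMSEQ_D[OF e, of "\<epsilon> / 3"] by auto
      obtain n0 where n0: "\<And>n. n0 \<le> n \<Longrightarrow> \<bar>d (f k) n\<bar> < \<epsilon> / 3"
        using LIMSEQ_D[OF lim[of k], of "\<epsilon> / 3"] \<open>0 < \<epsilon>\<close> unfolding real_norm_def diff_0_right by auto
      have "norm (d h n - 0) < \<epsilon>" if "n0 \<le> n" for n
      proof -
        have "0 \<le> d h n" unfolding d_def by simp
        then show ?thesis using le[of n k] n0[OF that] k unfolding real_norm_def by linarith
      qed
      then show "\<exists>n0. \<forall>n\<ge>n0. norm (d h n - 0) < \<epsilon>" by blast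
    qed
  qed
  then show ?thesis unfolding d_def g_def by simp
qed

text \<open>The inequality \<open>2 |a b| <= a^2 + b^2\<close> suffices in place of Cauchy-Schwarz:
  both variables have law \<pi>, so the two halves add up to one second moment.\<close>

lemma L2_bound:
  fixes \<phi> :: "'a measure \<Rightarrow> real"
  assumes a [measurable]: "a \<in> P \<rightarrow>\<^sub>M N" and b [measurable]: "b \<in> P \<rightarrow>\<^sub>M N"
    and la: "distr P N a = \<pi>" and lb: "distr P N b = \<pi>" and \<phi> [measurable]: "\<phi> \<in> borel_measurable N"
  shows "(\<integral>\<^sup>+p. ennreal \<bar>\<phi> (a p) * \<phi> (b p)\<bar> \<partial>P) \<le> (\<integral>\<^sup>+\<mu>. ennreal ((\<phi> \<mu>)\<^sup>2) \<partial>\<pi>)"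
proof -
  have m: "(\<lambda>\<mu>. ennreal ((\<phi> \<mu>)\<^sup>2 / 2)) \<in> borel_measurable N" by measurable
  have "(\<integral>\<^sup>+p. ennreal \<bar>\<phi> (a p) * \<phi> (b p)\<bar> \<partial>P) \<le> (\<integral>\<^sup>+p. ennreal ((\<phi> (a p))\<^sup>2 / 2) + ennreal ((\<phi> (b p))\<^sup>2 / 2) \<partial>P)"
  proof (intro nn_integral_mono)
    fix p
    have "2 * (\<bar>\<phi> (a p)\<bar> * \<bar>\<phi> (b p)\<bar>) \<le> \<bar>\<phi> (a p)\<bar>\<^sup>2 + \<bar>\<phi> (b p)\<bar>\<^sup>2"
      using sum_squares_bound[of "\<bar>\<phi> (a p)\<bar>" "\<bar>\<phi> (b p)\<bar>"] by (simp add: mult.assoc)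
    then have "ennreal \<bar>\<phi> (a p) * \<phi> (b p)\<bar> \<le> ennreal ((\<phi> (a p))\<^sup>2 / 2 + (\<phi> (b p))\<^sup>2 / 2)"
      by (intro ennreal_leI) (simp add: abs_mult)
    also have "\<dots> = ennreal ((\<phi> (a p))\<^sup>2 / 2) + ennreal ((\<phi> (b p))\<^sup>2 / 2)"
      by (rule ennreal_plus; rule divide_nonneg_nonneg; simp)
    finally show "ennreal \<bar>\<phi> (a p) * \<phi> (b p)\<bar> \<le> ennreal ((\<phi> (a p))\<^sup>2 / 2) + ennreal ((\<phi> (b p))\<^sup>2 / 2)" .
  qed
  also have "\<dots> = (\<integral>\<^sup>+p. ennreal ((\<phi> (a p))\<^sup>2 / 2) \<partial>P) + (\<integral>\<^sup>+p. ennreal ((\<phi> (b p))\<^sup>2 / 2) \<partial>P)"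
    by (rule nn_integral_add) measurable
  also have "(\<integral>\<^sup>+p. ennreal ((\<phi> (a p))\<^sup>2 / 2) \<partial>P) = (\<integral>\<^sup>+\<mu>. ennreal ((\<phi> \<mu>)\<^sup>2 / 2) \<partial>\<pi>)"
    unfolding la[symmetric] by (rule nn_integral_distr[OF a, symmetric]) (simp add: m)
  also have "(\<integral>\<^sup>+p. ennreal ((\<phi> (b p))\<^sup>2 / 2) \<partial>P) = (\<integral>\<^sup>+\<mu>. ennreal ((\<phi> \<mu>)\<^sup>2 / 2) \<partial>\<pi>)"
    unfolding lb[symmetric] by (rule nn_integral_distr[OF b, symmetric]) (simp add: m)
  also have "(\<integral>\<^sup>+\<mu>. ennreal ((\<phi> \<mu>)\<^sup>2 / 2) \<partial>\<pi>) + (\<integral>\<^sup>+\<mu>. ennreal ((\<phi> \<mu>)\<^sup>2 / 2) \<partial>\<pi>)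
      = (\<integral>\<^sup>+\<mu>. ennreal ((\<phi> \<mu>)\<^sup>2 / 2) + ennreal ((\<phi> \<mu>)\<^sup>2 / 2) \<partial>\<pi>)"
    by (rule nn_integral_add[symmetric]) (simp_all add: m measurable_cong_sets[OF sets_\<pi> refl])
  also have "\<dots> = (\<integral>\<^sup>+\<mu>. ennreal ((\<phi> \<mu>)\<^sup>2) \<partial>\<pi>)"
    by (intro nn_integral_cong) (simp flip: ennreal_plus)
  finally show ?thesis .
qed

lemma L2_bound_integral:
  fixes \<phi> :: "'a measure \<Rightarrow> real"
  assumes a [measurable]: "a \<in> P \<rightarrow>\<^sub>M N" and b [measurable]: "b \<in> P \<rightarrow>\<^sub>M N"
    and l: "distr P N a = \<pi>" "distr P N b = \<pi>" and \<phi> [measurable]: "\<phi> \<in> borel_measurable N"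
    and i: "integrable \<pi> (\<lambda>\<mu>. (\<phi> \<mu>)\<^sup>2)"
  shows "integrable P (\<lambda>p. \<phi> (a p) * \<phi> (b p))"
    and "\<bar>\<integral>p. \<phi> (a p) * \<phi> (b p) \<partial>P\<bar> \<le> (\<integral>\<mu>. (\<phi> \<mu>)\<^sup>2 \<partial>\<pi>)"
proof -
  have eq: "(\<integral>\<^sup>+\<mu>. ennreal ((\<phi> \<mu>)\<^sup>2) \<partial>\<pi>) = ennreal (\<integral>\<mu>. (\<phi> \<mu>)\<^sup>2 \<partial>\<pi>)"
    using i by (intro nn_integral_eq_integral) auto
  show int: "integrable P (\<lambda>p. \<phi> (a p) * \<phi> (b p))"
  proof (rule integrableI_bounded)
    have "(\<integral>\<^sup>+p. ennreal \<bar>\<phi> (a p) * \<phi> (b p)\<bar> \<partial>P) < \<infinity>"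
      using L2_bound[OF a b l \<phi>] unfolding eq by (auto intro: le_less_trans)
    then show "(\<integral>\<^sup>+p. ennreal (norm (\<phi> (a p) * \<phi> (b p))) \<partial>P) < \<infinity>" by simp
  qed measurable
  have "ennreal \<bar>\<integral>p. \<phi> (a p) * \<phi> (b p) \<partial>P\<bar> \<le> ennreal (\<integral>\<mu>. (\<phi> \<mu>)\<^sup>2 \<partial>\<pi>)"
    using integral_norm_bound_ennreal[OF int] L2_bound[OF a b l \<phi>] unfolding eq real_norm_def
    by (rule order.trans)
  moreover have "0 \<le> (\<integral>\<mu>. (\<phi> \<mu>)\<^sup>2 \<partial>\<pi>)" by (rule integral_nonneg_AE) simp
  ultimately show "\<bar>\<integral>p. \<phi> (a p) * \<phi> (b p) \<partial>P\<bar> \<le> (\<integral>\<mu>. (\<phi> \<mu>)\<^sup>2 \<partial>\<pi>)"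
    by (simp add: ennreal_le_iff)
qed

text \<open>The first factor is bounded, so convergence of the second in mean is enough. It is
  applied to \<open>F\<close> under two independent copies and to the add-one costs under
  \<open>K t\<close>.\<close>

lemma glue_product_tendsto:
  fixes \<phi> :: "'a measure \<Rightarrow> real"
  assumes P: "coupling s P" and \<phi>_bd: "bounded_measurable N b \<phi>"
  shows "(\<lambda>n. \<integral>p. \<phi> (fst p) * \<phi> (glue X (Bn n) (fst p) (snd p)) \<partial>P) \<longlonglongrightarrow> (\<integral>p. \<phi> (fst p) * \<phi> (snd p) \<partial>P)"
proof -
  interpret P: prob_space P by (rule couplingD[OF P])
  note \<phi> = bounded_measurableD[OF \<phi>_bd]
  note sP = couplingD(2)[OF P]
  have sp: "space P = space N2" by (rule sets_eq_imp_space_eq[OF sP])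
  let ?g = "\<lambda>n p. glue X (Bn n) (fst p) (snd p)"
  have mg: "(\<lambda>p. ?g n p) \<in> P \<rightarrow>\<^sub>M N" for n
    unfolding measurable_cong_sets[OF sP refl] by (intro measurable_glue measurable_fst measurable_snd Bn_sets)
  have mf: "fst \<in> P \<rightarrow>\<^sub>M N" and ms: "snd \<in> P \<rightarrow>\<^sub>M N"
    unfolding measurable_cong_sets[OF sP refl] by (rule measurable_fst measurable_snd)+
  note m [measurable] = measurable_compose[OF mg \<phi>(1)] measurable_compose[OF mf \<phi>(1)] measurable_compose[OF ms \<phi>(1)]
  have bd: "\<bar>\<phi> (fst p)\<bar> \<le> b" "\<bar>\<phi> (snd p)\<bar> \<le> b" "\<bar>\<phi> (?g n p)\<bar> \<le> b" if "p \<in> space P" for p n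
    by (intro \<phi>(2) measurable_space[OF mf that] measurable_space[OF ms that] measurable_space[OF mg that])+
  have b: "0 \<le> b"
    using P.not_empty bd(1) by (metis abs_ge_zero all_not_in_conv order.trans)
  have bb: "\<bar>x * y\<bar> \<le> b * b" if "\<bar>x\<bar> \<le> b" "\<bar>y\<bar> \<le> b" for x y :: real
    using that b unfolding abs_mult by (intro mult_mono) auto
  have i1: "integrable P (\<lambda>p. \<phi> (fst p) * \<phi> (?g n p))" for n
    by (rule P.integrable_bounded[where b="b*b"]) (auto intro!: bb bd)
  have i2: "integrable P (\<lambda>p. \<phi> (fst p) * \<phi> (snd p))"
    by (rule P.integrable_bounded[where b="b*b"]) (auto intro!: bb bd)
  have i3: "integrable P (\<lambda>p. \<bar>\<phi> (?g n p) - \<phi> (snd p)\<bar>)" for n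
  proof (rule P.integrable_bounded[where b="b+b"])
    show "\<bar>\<bar>\<phi> (?g n p) - \<phi> (snd p)\<bar>\<bar> \<le> b + b" if "p \<in> space P" for p
      using bd(2)[OF that] bd(3)[OF that, of n] by linarith
  qed measurable
  have "(\<lambda>n. (\<integral>p. \<phi> (fst p) * \<phi> (?g n p) \<partial>P) - (\<integral>p. \<phi> (fst p) * \<phi> (snd p) \<partial>P)) \<longlonglongrightarrow> 0"
  proof (rule Lim_null_comparison)
    show "(\<lambda>n. b * (\<integral>p. \<bar>\<phi> (?g n p) - \<phi> (snd p)\<bar> \<partial>P)) \<longlonglongrightarrow> 0"
      using tendsto_mult_left[OF glue_tendsto[OF P \<phi>_bd], of b] by simp
    show "\<forall>\<^sub>F n in sequentially. norm ((\<integral>p. \<phi> (fst p) * \<phi> (?g n p) \<partial>P) - (\<integral>p. \<phi> (fst p) * \<phi> (snd p) \<partial>P))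
        \<le> b * (\<integral>p. \<bar>\<phi> (?g n p) - \<phi> (snd p)\<bar> \<partial>P)"
    proof (rule always_eventually, rule allI)
      fix n
      have "(\<integral>p. \<phi> (fst p) * \<phi> (?g n p) \<partial>P) - (\<integral>p. \<phi> (fst p) * \<phi> (snd p) \<partial>P)
          = (\<integral>p. \<phi> (fst p) * \<phi> (?g n p) - \<phi> (fst p) * \<phi> (snd p) \<partial>P)"
        by (rule Bochner_Integration.integral_diff[OF i1 i2, symmetric])
      also have "\<bar>\<dots>\<bar> \<le> (\<integral>p. \<bar>\<phi> (fst p) * \<phi> (?g n p) - \<phi> (fst p) * \<phi> (snd p)\<bar> \<partial>P)"
        by (rule integral_abs_bound)
      also have "\<dots> \<le> (\<integral>p. b * \<bar>\<phi> (?g n p) - \<phi> (snd p)\<bar> \<partial>P)"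
      proof (rule integral_mono)
        show "\<bar>\<phi> (fst p) * \<phi> (?g n p) - \<phi> (fst p) * \<phi> (snd p)\<bar> \<le> b * \<bar>\<phi> (?g n p) - \<phi> (snd p)\<bar>" if "p \<in> space P" for p
          unfolding right_diff_distrib[symmetric] abs_mult using bd(1)[OF that] by (intro mult_right_mono) auto
      qed (intro integrable_abs Bochner_Integration.integrable_diff i1 i2 integrable_mult_right i3)+
      finally show "norm ((\<integral>p. \<phi> (fst p) * \<phi> (?g n p) \<partial>P) - (\<integral>p. \<phi> (fst p) * \<phi> (snd p) \<partial>P))
        \<le> b * (\<integral>p. \<bar>\<phi> (?g n p) - \<phi> (snd p)\<bar> \<partial>P)" by simp
    qed
  qed
  then show ?thesis by (simp add: LIM_zero_iff)
qed

end

section \<open>The covariance formula for bounded and for square integrable functionals\<close>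

context coupling_family
begin

lemma second_diff_product:
  "second_diff (\<lambda>p. F (fst p) * F (snd p)) x \<mu> \<nu> = add_cost X F \<mu> x * add_cost X F \<nu> x"
  by (simp add: second_diff_def add_cost_def algebra_simps)

lemma add_cost_measurable_at:
  "F \<in> borel_measurable N \<Longrightarrow> x \<in> space X \<Longrightarrow> (\<lambda>\<mu>. add_cost X F \<mu> x) \<in> borel_measurable N"
  by (intro measurable_add_cost measurable_const measurable_ident_sets refl)

text \<open>Tonelli turns the hypothesis on the add-one costs into integrability of the function
  sending \<open>x\<close> to the second moment of the cost at \<open>x\<close>. This function
  dominates in all later limits, uniformly in time.\<close>

lemma
  assumes F: "F \<in> borel_measurable N"
    and dF: "(\<integral>\<^sup>+\<mu>. (\<integral>\<^sup>+x. ennreal ((add_cost X F \<mu> x)\<^sup>2) \<partial>lam) \<partial>\<pi>) < \<infinity>"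
  shows cost_square_swap: "(\<integral>\<^sup>+x. (\<integral>\<^sup>+\<mu>. ennreal ((add_cost X F \<mu> x)\<^sup>2) \<partial>\<pi>) \<partial>lam)
      = (\<integral>\<^sup>+\<mu>. (\<integral>\<^sup>+x. ennreal ((add_cost X F \<mu> x)\<^sup>2) \<partial>lam) \<partial>\<pi>)"
    and cost_square_AE: "AE x in lam. integrable \<pi> (\<lambda>\<mu>. (add_cost X F \<mu> x)\<^sup>2)"
    and cost_square_integrable: "integrable lam (\<lambda>x. \<integral>\<mu>. (add_cost X F \<mu> x)\<^sup>2 \<partial>\<pi>)"
proof -
  interpret P: pair_sigma_finite lam \<pi> ..
  have s: "sets (lam \<Otimes>\<^sub>M \<pi>) = sets (X \<Otimes>\<^sub>M N)" by (intro sets_pair_measure_cong sets_lam sets_\<pi>)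
  have m: "(\<lambda>p. (add_cost X F (snd p) (fst p))\<^sup>2) \<in> borel_measurable (lam \<Otimes>\<^sub>M \<pi>)"
    unfolding measurable_cong_sets[OF s refl]
    by (intro borel_measurable_power measurable_add_cost F measurable_fst measurable_snd)
  have "(\<integral>\<^sup>+\<mu>. (\<integral>\<^sup>+x. (\<lambda>p. ennreal ((add_cost X F (snd p) (fst p))\<^sup>2)) (x, \<mu>) \<partial>lam) \<partial>\<pi>)
      = (\<integral>\<^sup>+x. (\<integral>\<^sup>+\<mu>. (\<lambda>p. ennreal ((add_cost X F (snd p) (fst p))\<^sup>2)) (x, \<mu>) \<partial>\<pi>) \<partial>lam)"
    by (rule P.Fubini) (use m in measurable)
  then show swap: "(\<integral>\<^sup>+x. (\<integral>\<^sup>+\<mu>. ennreal ((add_cost X F \<mu> x)\<^sup>2) \<partial>\<pi>) \<partial>lam)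
      = (\<integral>\<^sup>+\<mu>. (\<integral>\<^sup>+x. ennreal ((add_cost X F \<mu> x)\<^sup>2) \<partial>lam) \<partial>\<pi>)" by simp
  have int: "integrable (lam \<Otimes>\<^sub>M \<pi>) (\<lambda>p. (add_cost X F (snd p) (fst p))\<^sup>2)"
  proof (rule integrableI_bounded[OF m])
    have "(\<integral>\<^sup>+p. ennreal (norm ((add_cost X F (snd p) (fst p))\<^sup>2)) \<partial>(lam \<Otimes>\<^sub>M \<pi>))
        = (\<integral>\<^sup>+x. (\<integral>\<^sup>+\<mu>. ennreal ((add_cost X F \<mu> x)\<^sup>2) \<partial>\<pi>) \<partial>lam)"
      using m by (subst \<pi>.nn_integral_fst[symmetric]) auto
    then show "(\<integral>\<^sup>+p. ennreal (norm ((add_cost X F (snd p) (fst p))\<^sup>2)) \<partial>(lam \<Otimes>\<^sub>M \<pi>)) < \<infinity>"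
      using swap dF by simp
  qed
  show "AE x in lam. integrable \<pi> (\<lambda>\<mu>. (add_cost X F \<mu> x)\<^sup>2)"
    using P.AE_integrable_fst'[OF int] by simp
  show "integrable lam (\<lambda>x. \<integral>\<mu>. (add_cost X F \<mu> x)\<^sup>2 \<partial>\<pi>)"
    using P.integrable_fst'[OF int] by simp
qed

lemma integrable_R_snd:
  fixes q :: "'a \<Rightarrow> real"
  assumes q: "integrable lam q"
  shows "integrable R (\<lambda>r. q (snd r))"
proof (rule integrableI_bounded)
  have m: "q \<in> borel_measurable lam" using q by auto
  show m': "(\<lambda>r. q (snd r)) \<in> borel_measurable R" by (rule measurable_compose[OF measurable_snd m])
  have "(\<integral>\<^sup>+r. ennreal (norm (q (snd r))) \<partial>R) = (\<integral>\<^sup>+t. (\<integral>\<^sup>+x. ennreal (norm (q x)) \<partial>lam) \<partial>exp_law)"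
    using m' by (subst lam.nn_integral_fst[symmetric]) auto
  also have "\<dots> = (\<integral>\<^sup>+x. ennreal (norm (q x)) \<partial>lam)"
    by (simp only: nn_integral_const T.emeasure_space_1 mult_1_right)
  finally show "(\<integral>\<^sup>+r. ennreal (norm (q (snd r))) \<partial>R) < \<infinity>"
    using q by (simp add: integrable_iff_bounded)
qed

lemma AE_R_snd:
  assumes "AE x in lam. P x"
  shows "AE r in R. P (snd r)"
proof -
  obtain A where A: "{x \<in> space lam. \<not> P x} \<subseteq> A" "emeasure lam A = 0" "A \<in> sets lam"
    using AE_E[OF assms] by blast
  have "UNIV \<times> A \<in> null_sets R"
    using A(2,3) by (intro null_setsI) (simp_all add: lam.emeasure_pair_measure_Times)
  moreover have "{r \<in> space R. \<not> P (snd r)} \<subseteq> UNIV \<times> A"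
    using A(1) by (auto simp: space_pair_measure)
  ultimately show ?thesis by (rule AE_I')
qed

abbreviation "cost_corr F r \<equiv> (\<integral>p. add_cost X F (fst p) (snd r) * add_cost X F (snd p) (snd r) \<partial>K (fst r))"

lemma cost_corr_measurable:
  assumes F: "F \<in> borel_measurable N"
  shows "(\<lambda>r. cost_corr F r) \<in> borel_measurable R"
  by (rule integral_K_measurable)
    (intro borel_measurable_times measurable_add_cost F
      measurable_compose[OF measurable_fst measurable_snd] measurable_compose[OF measurable_snd measurable_fst]
      measurable_compose[OF measurable_snd measurable_snd])

lemma fst_K: "fst \<in> K t \<rightarrow>\<^sub>M N"
  unfolding measurable_cong_sets[OF sets_K refl] by (rule measurable_fst)

lemma snd_K: "snd \<in> K t \<rightarrow>\<^sub>M N"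
  unfolding measurable_cong_sets[OF sets_K refl] by (rule measurable_snd)

lemma glue_K: "(\<lambda>p. glue X (Bn n) (fst p) (snd p)) \<in> K t \<rightarrow>\<^sub>M N"
  unfolding measurable_cong_sets[OF sets_K refl] by (intro measurable_glue measurable_fst measurable_snd Bn_sets)

lemma cost_corr_bound:
  assumes F: "F \<in> borel_measurable N" and x: "x \<in> space X" and i: "integrable \<pi> (\<lambda>\<mu>. (add_cost X F \<mu> x)\<^sup>2)"
  shows "integrable (K t) (\<lambda>p. add_cost X F (fst p) x * add_cost X F (snd p) x)"
    and "\<bar>\<integral>p. add_cost X F (fst p) x * add_cost X F (snd p) x \<partial>K t\<bar> \<le> (\<integral>\<mu>. (add_cost X F \<mu> x)\<^sup>2 \<partial>\<pi>)"
  using L2_bound_integral[OF fst_K snd_K law_fst[OF K] law_snd[OF K] add_cost_measurable_at[OF F x] i]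
  by auto

lemma cost_corr_integrable:
  assumes F: "F \<in> borel_measurable N"
    and dF: "(\<integral>\<^sup>+\<mu>. (\<integral>\<^sup>+x. ennreal ((add_cost X F \<mu> x)\<^sup>2) \<partial>lam) \<partial>\<pi>) < \<infinity>"
  shows "integrable R (\<lambda>r. cost_corr F r)"
proof (rule Bochner_Integration.integrable_bound[OF integrable_R_snd[OF cost_square_integrable[OF F dF]] cost_corr_measurable[OF F]])
  have "AE r in R. r \<in> space R" by simp
  with AE_R_snd[OF cost_square_AE[OF F dF]]
  show "AE r in R. norm (cost_corr F r) \<le> norm (\<integral>\<mu>. (add_cost X F \<mu> (snd r))\<^sup>2 \<partial>\<pi>)"
  proof eventually_elim
    case (elim r)
    show ?case
      using cost_corr_bound(2)[OF F snd_R[OF elim(2)] elim(1), of "fst r"] unfolding real_norm_def by linarith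
  qed
qed

text \<open>The resampling identity is applied to the product functional and the exhaustion is sent
  to the whole space. On the left, two independent copies glued on \<open>Bn n\<close> become fully
  independent, so the second term tends to the squared mean; on the right the second difference
  factors into costs.\<close>

lemma variance_bounded:
  assumes F_bd: "bounded_measurable N b F"
    and dF: "(\<integral>\<^sup>+\<mu>. (\<integral>\<^sup>+x. ennreal ((add_cost X F \<mu> x)\<^sup>2) \<partial>lam) \<partial>\<pi>) < \<infinity>"
  shows "(\<integral>\<mu>. (F \<mu>)\<^sup>2 \<partial>\<pi>) - (\<integral>\<mu>. F \<mu> \<partial>\<pi>)\<^sup>2 = (\<integral>r. cost_corr F r \<partial>R)"
proof -
  interpret pp: pair_prob_space \<pi> \<pi> ..
  note F = bounded_measurableD(1)[OF F_bd] and bd = bounded_measurableD(2)[OF F_bd]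
  let ?g = "\<lambda>n p. glue X (Bn n) (fst p) (snd p)"
  have F\<pi>: "F \<in> borel_measurable \<pi>" unfolding measurable_cong_sets[OF sets_\<pi> refl] by (rule F)
  have b: "0 \<le> b" using bd \<pi>.not_empty space_\<pi> by (metis abs_ge_zero all_not_in_conv order.trans)
  have prod_le: "\<bar>F (fst p) * F (snd p)\<bar> \<le> b * b" if p: "p \<in> space N2" for p
  proof -
    have "\<bar>F (fst p)\<bar> \<le> b" "\<bar>F (snd p)\<bar> \<le> b" using p by (auto intro!: bd simp: space_pair_measure)
    then show ?thesis unfolding abs_mult using b by (intro mult_mono) auto
  qed
  have prod_m: "(\<lambda>p. F (fst p) * F (snd p)) \<in> borel_measurable N2"
    by (intro borel_measurable_times measurable_compose[OF measurable_fst F] measurable_compose[OF measurable_snd F])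
  then have prod_bd: "bounded_measurable N2 (b * b) (\<lambda>p. F (fst p) * F (snd p))"
    using prod_le by (simp add: bounded_measurable_def)
  define k where "k n r = indicator (Bn n) (snd r) *
      (\<integral>p. add_cost X F (fst p) (snd r) * add_cost X F (?g n p) (snd r) \<partial>K (fst r))" for n r
  have id: "(\<integral>\<mu>. F \<mu> * F \<mu> \<partial>\<pi>) - (\<integral>p. F (fst p) * F (?g n p) \<partial>(\<pi> \<Otimes>\<^sub>M \<pi>)) = (\<integral>r. k n r \<partial>R)" for n
    using resampling_identity[OF prod_bd, of n] unfolding second_diff_product k_def by simp
  have "(\<lambda>n. (\<integral>\<mu>. F \<mu> * F \<mu> \<partial>\<pi>) - (\<integral>p. F (fst p) * F (?g n p) \<partial>(\<pi> \<Otimes>\<^sub>M \<pi>)))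
      \<longlonglongrightarrow> (\<integral>\<mu>. F \<mu> * F \<mu> \<partial>\<pi>) - (\<integral>p. F (fst p) * F (snd p) \<partial>(\<pi> \<Otimes>\<^sub>M \<pi>))"
    by (rule tendsto_diff[OF tendsto_const glue_product_tendsto[OF coupling_indep[OF \<pi>] F_bd]])
  then have lim1: "(\<lambda>n. \<integral>r. k n r \<partial>R)
      \<longlonglongrightarrow> (\<integral>\<mu>. F \<mu> * F \<mu> \<partial>\<pi>) - (\<integral>p. F (fst p) * F (snd p) \<partial>(\<pi> \<Otimes>\<^sub>M \<pi>))"
    unfolding id .
  have cost_bd: "\<bar>add_cost X F \<mu> x\<bar> \<le> b + b" if "\<mu> \<in> space N" "x \<in> space X" for \<mu> x
    using bd[OF that(1)] bd[OF add_pt_counting[OF that]] unfolding add_cost_def by linarith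
  have D_bd: "bounded_measurable N (b + b) (\<lambda>\<mu>. add_cost X F \<mu> x)" if "x \<in> space X" for x
    using add_cost_measurable_at[OF F that] cost_bd[OF _ that] by (simp add: bounded_measurable_def)
  have i2: "integrable \<pi> (\<lambda>\<mu>. (add_cost X F \<mu> x)\<^sup>2)" if x: "x \<in> space X" for x
  proof (rule \<pi>.integrable_bounded[where b="(b + b)\<^sup>2"])
    show "(\<lambda>\<mu>. (add_cost X F \<mu> x)\<^sup>2) \<in> borel_measurable \<pi>"
      unfolding measurable_cong_sets[OF sets_\<pi> refl] by (intro borel_measurable_power add_cost_measurable_at F x)
    show "\<bar>(add_cost X F \<mu> x)\<^sup>2\<bar> \<le> (b + b)\<^sup>2" if "\<mu> \<in> space \<pi>" for \<mu>
      using power_mono[OF cost_bd[of \<mu> x], of 2] that x by (simp add: space_\<pi>)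
  qed
  \<comment> \<open>The first and the glued configuration both have law \<pi>, so
    \<open>L2_bound_integral\<close> gives a dominating function independent of the exhaustion index
    and of time.\<close>
  have lim2: "(\<lambda>n. \<integral>r. k n r \<partial>R) \<longlonglongrightarrow> (\<integral>r. cost_corr F r \<partial>R)"
  proof (rule integral_dominated_convergence)
    show "integrable R (\<lambda>r. \<integral>\<mu>. (add_cost X F \<mu> (snd r))\<^sup>2 \<partial>\<pi>)"
      by (rule integrable_R_snd[OF cost_square_integrable[OF F dF]])
    show "(\<lambda>r. cost_corr F r) \<in> borel_measurable R" by (rule cost_corr_measurable[OF F])
    show "k n \<in> borel_measurable R" for n
    proof -
      have "(\<lambda>r. \<integral>p. add_cost X F (fst p) (snd r) * add_cost X F (?g n p) (snd r) \<partial>K (fst r)) \<in> borel_measurable R"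
        by (rule integral_K_measurable)
          (intro borel_measurable_times measurable_add_cost F measurable_glue Bn_sets
            measurable_compose[OF measurable_fst measurable_snd] measurable_compose[OF measurable_snd measurable_fst]
            measurable_compose[OF measurable_snd measurable_snd])
      moreover have "(\<lambda>r. indicator (Bn n) (snd r) :: real) \<in> borel_measurable R"
        by (rule measurable_compose[OF measurable_snd]) (simp add: lam_sets Bn_sets)
      ultimately show ?thesis unfolding k_def by (rule borel_measurable_times[rotated])
    qed
    show "AE r in R. (\<lambda>n. k n r) \<longlonglongrightarrow> cost_corr F r"
    proof (rule AE_I2)
      fix r assume r: "r \<in> space R"
      then have x: "snd r \<in> space X" by (rule snd_R)
      then obtain m where m: "snd r \<in> Bn m" using Bn_UN by blast
      have "\<forall>\<^sub>F n in sequentially. indicator (Bn n) (snd r) = (1 :: real)"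
        using Bn_mono[OF _ m] by (intro eventually_sequentiallyI[of m]) simp
      then have ind: "(\<lambda>n. indicator (Bn n) (snd r) :: real) \<longlonglongrightarrow> 1" by (rule tendsto_eventually)
      have "(\<lambda>n. k n r) \<longlonglongrightarrow> 1 * cost_corr F r"
        unfolding k_def
        by (rule tendsto_mult[OF ind glue_product_tendsto[OF K D_bd[OF x]]])
      then show "(\<lambda>n. k n r) \<longlonglongrightarrow> cost_corr F r" by simp
    qed
    show "AE r in R. norm (k n r) \<le> (\<integral>\<mu>. (add_cost X F \<mu> (snd r))\<^sup>2 \<partial>\<pi>)" for n
    proof (rule AE_I2)
      fix r assume r: "r \<in> space R"
      then have x: "snd r \<in> space X" by (rule snd_R)
      have "\<bar>\<integral>p. add_cost X F (fst p) (snd r) * add_cost X F (?g n p) (snd r) \<partial>K (fst r)\<bar> \<le> (\<integral>\<mu>. (add_cost X F \<mu> (snd r))\<^sup>2 \<partial>\<pi>)"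
        by (rule L2_bound_integral(2)[OF fst_K glue_K law_fst[OF K] law_glue[OF K Bn_sets] add_cost_measurable_at[OF F x] i2[OF x]])
      moreover have "norm (k n r) \<le> \<bar>\<integral>p. add_cost X F (fst p) (snd r) * add_cost X F (?g n p) (snd r) \<partial>K (fst r)\<bar>"
        unfolding k_def by (simp add: abs_mult indicator_def)
      ultimately show "norm (k n r) \<le> (\<integral>\<mu>. (add_cost X F \<mu> (snd r))\<^sup>2 \<partial>\<pi>)" by linarith
    qed
  qed
  have "integrable (\<pi> \<Otimes>\<^sub>M \<pi>) (\<lambda>p. F (fst p) * F (snd p))"
  proof (rule pp.integrable_bounded[where b="b*b"])
    show "(\<lambda>p. F (fst p) * F (snd p)) \<in> borel_measurable (\<pi> \<Otimes>\<^sub>M \<pi>)"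
      by (intro borel_measurable_times measurable_compose[OF measurable_fst F\<pi>] measurable_compose[OF measurable_snd F\<pi>])
    show "\<bar>F (fst p) * F (snd p)\<bar> \<le> b * b" if "p \<in> space (\<pi> \<Otimes>\<^sub>M \<pi>)" for p
      using that by (intro prod_le) (simp add: space_pair_measure space_\<pi>)
  qed
  from pp.integral_fst'[OF this]
  have "(\<integral>p. F (fst p) * F (snd p) \<partial>(\<pi> \<Otimes>\<^sub>M \<pi>)) = (\<integral>\<mu>. F \<mu> \<partial>\<pi>)\<^sup>2"
    by (simp add: power2_eq_square)
  then show ?thesis
    using LIMSEQ_unique[OF lim1 lim2] by (simp add: power2_eq_square)
qed

text \<open>Truncation is 1-Lipschitz, so it cannot increase add-one costs in absolute value; the
  square integrability of the costs survives it.\<close>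

lemma clamp_lipschitz:
  fixes a b c :: real
  shows "0 \<le> c \<Longrightarrow> \<bar>max (- c) (min c a) - max (- c) (min c b)\<bar> \<le> \<bar>a - b\<bar>"
  by (auto simp: max_def min_def abs_if)

text \<open>Truncation at level \<open>n\<close> reduces the claim to bounded functionals. The
  second moments are dominated by \<open>F^2\<close> and the cost correlations by the second moments
  of the costs of \<open>F\<close>, so both sides pass to the limit.\<close>

lemma variance_R:
  assumes F: "F \<in> borel_measurable N" and iF: "integrable \<pi> (\<lambda>\<mu>. (F \<mu>)\<^sup>2)"
    and dF: "(\<integral>\<^sup>+\<mu>. (\<integral>\<^sup>+x. ennreal ((add_cost X F \<mu> x)\<^sup>2) \<partial>lam) \<partial>\<pi>) < \<infinity>"
  shows "(\<integral>\<mu>. (F \<mu>)\<^sup>2 \<partial>\<pi>) - (\<integral>\<mu>. F \<mu> \<partial>\<pi>)\<^sup>2 = (\<integral>r. cost_corr F r \<partial>R)"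
proof -
  have F\<pi> [measurable]: "F \<in> borel_measurable \<pi>" unfolding measurable_cong_sets[OF sets_\<pi> refl] by (rule F)
  define f where "f n \<mu> = max (- real n) (min (real n) (F \<mu>))" for n \<mu>
  have fm: "f n \<in> borel_measurable N" for n unfolding f_def[abs_def] using F by measurable
  have fm\<pi> [measurable]: "f n \<in> borel_measurable \<pi>" for n
    unfolding measurable_cong_sets[OF sets_\<pi> refl] by (rule fm)
  have fb: "\<bar>f n \<mu>\<bar> \<le> real n" for n \<mu> unfolding f_def by linarith
  have fF: "\<bar>f n \<mu>\<bar> \<le> \<bar>F \<mu>\<bar>" for n \<mu> unfolding f_def by linarith
  have fl: "(\<lambda>n. f n \<mu>) \<longlonglongrightarrow> F \<mu>" for \<mu>
  proof -
    obtain m :: nat where m: "\<bar>F \<mu>\<bar> \<le> real m" using real_arch_simple by blast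
    have eq: "f n \<mu> = F \<mu>" if "m \<le> n" for n using m that unfolding f_def by linarith
    show ?thesis by (intro tendsto_eventually eventually_sequentiallyI[of m] eq)
  qed
  have D_le: "\<bar>add_cost X (f n) \<mu> x\<bar> \<le> \<bar>add_cost X F \<mu> x\<bar>" for n \<mu> x
    unfolding add_cost_def f_def by (rule clamp_lipschitz) simp
  have D_lim: "(\<lambda>n. add_cost X (f n) \<mu> x) \<longlonglongrightarrow> add_cost X F \<mu> x" for \<mu> x
    unfolding add_cost_def by (intro tendsto_diff fl)
  have D2_le: "(add_cost X (f n) \<mu> x)\<^sup>2 \<le> (add_cost X F \<mu> x)\<^sup>2" for n \<mu> x
    using D_le by (simp add: abs_le_square_iff)
  have df: "(\<integral>\<^sup>+\<mu>. (\<integral>\<^sup>+x. ennreal ((add_cost X (f n) \<mu> x)\<^sup>2) \<partial>lam) \<partial>\<pi>) < \<infinity>" for n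
    by (rule le_less_trans[OF _ dF]) (intro nn_integral_mono ennreal_leI D2_le)
  have iF1: "integrable \<pi> F"
    by (rule \<pi>.square_integrable_imp_integrable[OF F\<pi> iF])
  have "(\<lambda>n. \<integral>\<mu>. f n \<mu> \<partial>\<pi>) \<longlonglongrightarrow> (\<integral>\<mu>. F \<mu> \<partial>\<pi>)"
    by (rule integral_dominated_convergence[where w="\<lambda>\<mu>. \<bar>F \<mu>\<bar>"]) (use iF1 fl fF in auto)
  moreover have "(\<lambda>n. \<integral>\<mu>. (f n \<mu>)\<^sup>2 \<partial>\<pi>) \<longlonglongrightarrow> (\<integral>\<mu>. (F \<mu>)\<^sup>2 \<partial>\<pi>)"
  proof (rule integral_dominated_convergence[where w="\<lambda>\<mu>. (F \<mu>)\<^sup>2"])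
    show "AE \<mu> in \<pi>. (\<lambda>n. (f n \<mu>)\<^sup>2) \<longlonglongrightarrow> (F \<mu>)\<^sup>2" by (intro AE_I2 tendsto_power fl)
    show "AE \<mu> in \<pi>. norm ((f n \<mu>)\<^sup>2) \<le> (F \<mu>)\<^sup>2" for n using fF by (simp add: abs_le_square_iff)
  qed (use iF in auto)
  ultimately have lim1: "(\<lambda>n. (\<integral>\<mu>. (f n \<mu>)\<^sup>2 \<partial>\<pi>) - (\<integral>\<mu>. f n \<mu> \<partial>\<pi>)\<^sup>2) \<longlonglongrightarrow> (\<integral>\<mu>. (F \<mu>)\<^sup>2 \<partial>\<pi>) - (\<integral>\<mu>. F \<mu> \<partial>\<pi>)\<^sup>2"
    by (intro tendsto_intros)
  \<comment> \<open>For unbounded \<open>F\<close> the cost at \<open>x\<close> is known to be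
    square integrable only for almost every \<open>x\<close>, so the limits inside the integral are
    taken almost everywhere.\<close>
  have AE: "AE r in R. integrable \<pi> (\<lambda>\<mu>. (add_cost X F \<mu> (snd r))\<^sup>2)"
    by (rule AE_R_snd[OF cost_square_AE[OF F dF]])
  have AE_sp: "AE r in R. r \<in> space R" by simp
  have D_int: "integrable \<pi> (\<lambda>\<mu>. (add_cost X (f n) \<mu> x)\<^sup>2)"
    if "integrable \<pi> (\<lambda>\<mu>. (add_cost X F \<mu> x)\<^sup>2)" and x: "x \<in> space X" for x n
  proof (rule Bochner_Integration.integrable_bound[OF that(1)])
    show "(\<lambda>\<mu>. (add_cost X (f n) \<mu> x)\<^sup>2) \<in> borel_measurable \<pi>"
      unfolding measurable_cong_sets[OF sets_\<pi> refl] by (intro borel_measurable_power add_cost_measurable_at fm x)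
  qed (use D2_le in auto)
  have lim2: "(\<lambda>n. \<integral>r. cost_corr (f n) r \<partial>R) \<longlonglongrightarrow> (\<integral>r. cost_corr F r \<partial>R)"
  proof (rule integral_dominated_convergence)
    show "integrable R (\<lambda>r. \<integral>\<mu>. (add_cost X F \<mu> (snd r))\<^sup>2 \<partial>\<pi>)"
      by (rule integrable_R_snd[OF cost_square_integrable[OF F dF]])
    show "(\<lambda>r. cost_corr F r) \<in> borel_measurable R" "(\<lambda>r. cost_corr (f n) r) \<in> borel_measurable R" for n
      by (rule cost_corr_measurable[OF F] cost_corr_measurable[OF fm])+
    show "AE r in R. (\<lambda>n. cost_corr (f n) r) \<longlonglongrightarrow> cost_corr F r"
      using AE AE_sp
    proof eventually_elim
      case (elim r)
      have x: "snd r \<in> space X" by (rule snd_R[OF elim(2)])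
      have meas: "(\<lambda>p. add_cost X G (fst p) (snd r) * add_cost X G (snd p) (snd r)) \<in> borel_measurable (K (fst r))"
        if "G \<in> borel_measurable N" for G :: "'a measure \<Rightarrow> real"
        by (intro borel_measurable_times measurable_compose[OF fst_K add_cost_measurable_at]
            measurable_compose[OF snd_K add_cost_measurable_at] that x)
      show ?case
      proof (rule integral_dominated_convergence)
        show "integrable (K (fst r)) (\<lambda>p. \<bar>add_cost X F (fst p) (snd r) * add_cost X F (snd p) (snd r)\<bar>)"
          by (intro integrable_abs cost_corr_bound(1) F x elim(1))
        show "AE p in K (fst r). (\<lambda>n. add_cost X (f n) (fst p) (snd r) * add_cost X (f n) (snd p) (snd r))
            \<longlonglongrightarrow> add_cost X F (fst p) (snd r) * add_cost X F (snd p) (snd r)"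
          by (intro AE_I2 tendsto_mult D_lim)
        show "AE p in K (fst r). norm (add_cost X (f n) (fst p) (snd r) * add_cost X (f n) (snd p) (snd r))
            \<le> \<bar>add_cost X F (fst p) (snd r) * add_cost X F (snd p) (snd r)\<bar>" for n
          unfolding real_norm_def abs_mult by (intro AE_I2 mult_mono D_le) auto
      qed (intro meas F fm)+
    qed
    show "AE r in R. norm (cost_corr (f n) r) \<le> (\<integral>\<mu>. (add_cost X F \<mu> (snd r))\<^sup>2 \<partial>\<pi>)" for n
      using AE AE_sp
    proof eventually_elim
      case (elim r)
      have x: "snd r \<in> space X" by (rule snd_R[OF elim(2)])
      have "\<bar>cost_corr (f n) r\<bar> \<le> (\<integral>\<mu>. (add_cost X (f n) \<mu> (snd r))\<^sup>2 \<partial>\<pi>)"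
        by (rule cost_corr_bound(2)[OF fm x D_int[OF elim(1) x]])
      also have "\<dots> \<le> (\<integral>\<mu>. (add_cost X F \<mu> (snd r))\<^sup>2 \<partial>\<pi>)"
        by (intro integral_mono D_int elim(1) x D2_le)
      finally show ?case by simp
    qed
  qed
  have "(\<integral>\<mu>. (f n \<mu>)\<^sup>2 \<partial>\<pi>) - (\<integral>\<mu>. f n \<mu> \<partial>\<pi>)\<^sup>2 = (\<integral>r. cost_corr (f n) r \<partial>R)" for n
    by (rule variance_bounded[OF _ df, where b="real n"]) (simp add: bounded_measurable_def fm fb)
  then show ?thesis
    using LIMSEQ_unique[OF lim1] lim2 by simp
qed

theorem variance_formula:
  assumes F: "F \<in> borel_measurable N" and iF: "integrable \<pi> (\<lambda>\<mu>. (F \<mu>)\<^sup>2)"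
    and dF: "(\<integral>\<^sup>+\<mu>. (\<integral>\<^sup>+x. ennreal ((add_cost X F \<mu> x)\<^sup>2) \<partial>lam) \<partial>\<pi>) < \<infinity>"
  shows "(\<integral>\<mu>. (F \<mu>)\<^sup>2 \<partial>\<pi>) - (\<integral>\<mu>. F \<mu> \<partial>\<pi>)\<^sup>2 =
    (\<integral>t. indicator {0..} t * (exp (- t) *
      (\<integral>x. \<integral>p. add_cost X F (fst p) x * add_cost X F (snd p) x \<partial>K t \<partial>lam)) \<partial>lborel)"
proof -
  have m: "(\<lambda>t. \<integral>x. cost_corr F (t, x) \<partial>lam) \<in> borel_measurable borel"
    using lam.borel_measurable_lebesgue_integral[of "\<lambda>t x. cost_corr F (t, x)" exp_law]
      cost_corr_measurable[OF F] by (simp add: case_prod_beta)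
  have "(\<integral>r. cost_corr F r \<partial>R) = (\<integral>t. \<integral>x. cost_corr F (t, x) \<partial>lam \<partial>exp_law)"
    by (rule R.integral_fst'[OF cost_corr_integrable[OF F dF], symmetric])
  also have "\<dots> = (\<integral>t. indicator {0..} t * (exp (- t) * (\<integral>x. cost_corr F (t, x) \<partial>lam)) \<partial>lborel)"
    by (rule integral_exp_law[OF m])
  finally show ?thesis using variance_R[OF F iF dF] by simp
qed

end

section \<open>Thinning\<close>

lemma gen_pts_measure_split:
  assumes xs: "\<And>n. xs n \<in> space X" and z: "z \<in> borel_measurable X"
  shows "gen z (pts_measure X k S xs) =
    gen z (pts_measure X k (\<lambda>n. S n \<and> T n) xs) * gen z (pts_measure X k (\<lambda>n. S n \<and> \<not> T n) xs)"
proof -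
  have m: "(\<lambda>x. ennreal (- ln (z x))) \<in> borel_measurable X" using z by measurable
  have "(\<Sum>n. if enat n < k \<and> S n then ennreal (- ln (z (xs n))) else 0)
      = (\<Sum>n. (if enat n < k \<and> S n \<and> T n then ennreal (- ln (z (xs n))) else 0)
          + (if enat n < k \<and> S n \<and> \<not> T n then ennreal (- ln (z (xs n))) else 0))"
    by (intro arg_cong[where f=suminf] ext) auto
  also have "\<dots> = (\<Sum>n. if enat n < k \<and> S n \<and> T n then ennreal (- ln (z (xs n))) else 0)
      + (\<Sum>n. if enat n < k \<and> S n \<and> \<not> T n then ennreal (- ln (z (xs n))) else 0)"
    by (intro suminf_add[symmetric]) auto
  finally show ?thesis
    unfolding gen_def nn_integral_pts_measure[OF xs m] by (simp add: exp_neg_add)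
qed

text \<open>One time is fixed and \<open>s\<close> is its retention probability. Mutual independence
  is phrased through generated sigma-algebras because the three random objects have different
  types.\<close>

locale thinning = intensity X lam Bn + prob_space M
  for X lam :: "'a measure" and Bn :: "nat \<Rightarrow> 'a set" and M :: "'w measure" +
  fixes \<eta> :: "'w \<Rightarrow> 'a measure" and \<kappa> :: "'w \<Rightarrow> enat" and Xs :: "nat \<Rightarrow> 'w \<Rightarrow> 'a"
    and Y :: "nat \<Rightarrow> 'w \<Rightarrow> bool" and \<eta>' :: "'w \<Rightarrow> 'a measure" and s :: real
  assumes s: "0 \<le> s" "s \<le> 1"
    and PPP: "poisson_process M X lam \<eta>"
    and kappa_meas: "\<kappa> \<in> M \<rightarrow>\<^sub>M count_space UNIV"
    and Xs_meas: "\<And>n. Xs n \<in> M \<rightarrow>\<^sub>M X"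
    and eta_repr: "\<And>\<omega>. \<omega> \<in> space M \<Longrightarrow> \<eta> \<omega> = pts_measure X (\<kappa> \<omega>) (\<lambda>_. True) (\<lambda>n. Xs n \<omega>)"
    and Y_meas: "\<And>n. Y n \<in> M \<rightarrow>\<^sub>M count_space UNIV"
    and Y_bern: "\<And>n. measure M {\<omega> \<in> space M. Y n \<omega>} = s"
    and Y_indep: "indep_vars (\<lambda>_. count_space UNIV) Y UNIV"
    and eta'_PPP: "poisson_process M X (scale_measure (ennreal (1 - s)) lam) \<eta>'"
    and indep: "indep_sets
         (\<lambda>i::nat. if i = 0 then
               sets (vimage_algebra (space M) (\<lambda>\<omega>. (\<kappa> \<omega>, \<lambda>n. Xs n \<omega>))
                       (count_space UNIV \<Otimes>\<^sub>M (\<Pi>\<^sub>M n\<in>UNIV. X)))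
             else if i = 1 then
               sets (vimage_algebra (space M) (\<lambda>\<omega>. \<lambda>n. Y n \<omega>)
                       (\<Pi>\<^sub>M n\<in>UNIV. count_space UNIV))
             else sets (vimage_algebra (space M) \<eta>' (N_alg X)))
         {0, 1, 2}"
begin

lemma eta_meas: "\<eta> \<in> M \<rightarrow>\<^sub>M N"
  using PPP by (simp add: poisson_process_def)

lemma eta'_meas: "\<eta>' \<in> M \<rightarrow>\<^sub>M N"
  using eta'_PPP by (simp add: poisson_process_def)

lemma Xs_space: "\<omega> \<in> space M \<Longrightarrow> Xs n \<omega> \<in> space X"
  by (rule measurable_space[OF Xs_meas])

abbreviation pts :: "('w \<Rightarrow> nat \<Rightarrow> bool) \<Rightarrow> 'w \<Rightarrow> 'a measure" where
  "pts S \<omega> \<equiv> pts_measure X (\<kappa> \<omega>) (S \<omega>) (\<lambda>n. Xs n \<omega>)"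

lemma pts_counting: "\<omega> \<in> space M \<Longrightarrow> pts S \<omega> \<in> counting_measures X"
  by (rule pts_measure_counting_mono[where T="\<lambda>_. True"])
    (use measurable_space[OF eta_meas, of \<omega>] eta_repr[of \<omega>] in \<open>simp_all add: Xs_space space_N_alg\<close>)

lemma index_pred: "Measurable.pred M (\<lambda>\<omega>. enat n < \<kappa> \<omega>)"
  by (rule measurable_compose[OF kappa_meas]) simp

lemma pts_meas:
  assumes S: "\<And>n. Measurable.pred M (\<lambda>\<omega>. S \<omega> n)"
  shows "pts S \<in> M \<rightarrow>\<^sub>M N"
proof (rule measurable_N_algI)
  note [measurable] = S index_pred Xs_meas
  fix A assume [measurable]: "A \<in> sets X"
  have "(\<lambda>\<omega>. \<Sum>n. if enat n < \<kappa> \<omega> \<and> S \<omega> n then indicator A (Xs n \<omega>) else 0 :: ennreal) \<in> borel_measurable M"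
    by measurable
  then show "(\<lambda>\<omega>. emeasure (pts S \<omega>) A) \<in> borel_measurable M"
    by (rule measurable_cong[THEN iffD1, rotated]) (simp add: emeasure_pts_measure Xs_space)
qed (rule pts_counting)

lemma Y_pred: "Measurable.pred M (Y n)"
  by (rule measurable_compose[OF Y_meas, of id, unfolded id_def]) simp

section \<open>Joint law of the points, the marks and the added process\<close>

abbreviation (input) "SW \<equiv> count_space (UNIV :: enat set) \<Otimes>\<^sub>M (\<Pi>\<^sub>M n\<in>(UNIV :: nat set). X)"
abbreviation (input) "SY \<equiv> \<Pi>\<^sub>M n\<in>(UNIV :: nat set). count_space (UNIV :: bool set)"
abbreviation (input) "W \<equiv> \<lambda>\<omega>. (\<kappa> \<omega>, \<lambda>n. Xs n \<omega>)"
abbreviation (input) "YY \<equiv> \<lambda>\<omega> n. Y n \<omega>"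

lemma W_meas: "W \<in> M \<rightarrow>\<^sub>M SW"
  by (intro measurable_Pair kappa_meas measurable_PiM_single' Xs_meas) (auto simp: Xs_space)

lemma YY_meas: "YY \<in> M \<rightarrow>\<^sub>M SY"
  using Y_meas by (intro measurable_PiM_single') auto

lemma indep_W_Y_eta':
  assumes A: "A \<in> sets SW" and B: "B \<in> sets SY" and C: "C \<in> sets N"
  shows "prob ((W -` A \<inter> space M) \<inter> (YY -` B \<inter> space M) \<inter> (\<eta>' -` C \<inter> space M))
    = prob (W -` A \<inter> space M) * prob (YY -` B \<inter> space M) * prob (\<eta>' -` C \<inter> space M)"
proof -
  define E where "E i = (if i = 0 then W -` A \<inter> space M else if i = 1 then YY -` B \<inter> space M else \<eta>' -` C \<inter> space M)"
    for i :: nat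
  have "W -` A \<inter> space M \<in> sets (vimage_algebra (space M) W SW)"
    "YY -` B \<inter> space M \<in> sets (vimage_algebra (space M) YY SY)"
    "\<eta>' -` C \<inter> space M \<in> sets (vimage_algebra (space M) \<eta>' N)"
    using A B C by (auto intro: in_vimage_algebra)
  then have "prob (\<Inter>j\<in>{0, 1, 2}. E j) = (\<Prod>j\<in>{0, 1, 2}. prob (E j))"
    by (intro indep_setsD[OF indep]) (auto simp: E_def)
  then show ?thesis by (simp add: E_def Int_ac mult_ac)
qed

text \<open>Taking the whole configuration space as the event for the added process reduces mutual
  independence to independence of points and marks.\<close>

lemma distr_W_Y: "distr M SW W \<Otimes>\<^sub>M distr M SY YY = distr M (SW \<Otimes>\<^sub>M SY) (\<lambda>\<omega>. (W \<omega>, YY \<omega>))"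
proof (rule pair_measure_eqI)
  interpret DW: prob_space "distr M SW W" by (rule prob_space_distr[OF W_meas])
  interpret DY: prob_space "distr M SY YY" by (rule prob_space_distr[OF YY_meas])
  show "sigma_finite_measure (distr M SW W)" "sigma_finite_measure (distr M SY YY)" ..
  fix A B assume "A \<in> sets (distr M SW W)" "B \<in> sets (distr M SY YY)"
  then have A: "A \<in> sets SW" and B: "B \<in> sets SY" by simp_all
  have "\<eta>' -` space N \<inter> space M = space M" using measurable_space[OF eta'_meas] by auto
  then have "prob ((W -` A \<inter> space M) \<inter> (YY -` B \<inter> space M)) = prob (W -` A \<inter> space M) * prob (YY -` B \<inter> space M)"
    using indep_W_Y_eta'[OF A B sets.top[of N]] by (simp add: prob_space Int_assoc)
  moreover have "(\<lambda>\<omega>. (W \<omega>, YY \<omega>)) -` (A \<times> B) \<inter> space M = (W -` A \<inter> space M) \<inter> (YY -` B \<inter> space M)" by auto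
  ultimately show "emeasure (distr M SW W) A * emeasure (distr M SY YY) B
      = emeasure (distr M (SW \<Otimes>\<^sub>M SY) (\<lambda>\<omega>. (W \<omega>, YY \<omega>))) (A \<times> B)"
    using A B by (simp add: emeasure_distr[OF W_meas A] emeasure_distr[OF YY_meas B]
        emeasure_distr[OF measurable_Pair[OF W_meas YY_meas]] emeasure_eq_measure ennreal_mult'')
qed simp

text \<open>Mutual independence gives the product formula on boxes only. For a fixed event
  \<open>C\<close> of the added process, uniqueness of product measures extends it from boxes in
  points and marks to arbitrary events \<open>E\<close> of the two.\<close>

lemma distr_WY_eta': "distr M (SW \<Otimes>\<^sub>M SY) (\<lambda>\<omega>. (W \<omega>, YY \<omega>)) \<Otimes>\<^sub>M distr M N \<eta>'
    = distr M ((SW \<Otimes>\<^sub>M SY) \<Otimes>\<^sub>M N) (\<lambda>\<omega>. ((W \<omega>, YY \<omega>), \<eta>' \<omega>))"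
proof (rule pair_measure_eqI)
  note WY = measurable_Pair[OF W_meas YY_meas]
  interpret DW: prob_space "distr M SW W" by (rule prob_space_distr[OF W_meas])
  interpret DY: prob_space "distr M SY YY" by (rule prob_space_distr[OF YY_meas])
  interpret DWY: prob_space "distr M (SW \<Otimes>\<^sub>M SY) (\<lambda>\<omega>. (W \<omega>, YY \<omega>))" by (rule prob_space_distr[OF WY])
  interpret De: prob_space "distr M N \<eta>'" by (rule prob_space_distr[OF eta'_meas])
  show "sigma_finite_measure (distr M (SW \<Otimes>\<^sub>M SY) (\<lambda>\<omega>. (W \<omega>, YY \<omega>)))" "sigma_finite_measure (distr M N \<eta>')" ..
  fix E C assume "E \<in> sets (distr M (SW \<Otimes>\<^sub>M SY) (\<lambda>\<omega>. (W \<omega>, YY \<omega>)))" "C \<in> sets (distr M N \<eta>')"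
  then have E: "E \<in> sets (SW \<Otimes>\<^sub>M SY)" and C: "C \<in> sets N" by simp_all
  define c where "c = emeasure M (\<eta>' -` C \<inter> space M)"
  have Cm: "\<eta>' -` C \<inter> space M \<in> sets M" by (rule measurable_sets[OF eta'_meas C])
  have c_fin: "c < \<infinity>" unfolding c_def by (simp add: emeasure_eq_measure)
  \<comment> \<open>The restriction of \<open>M\<close> to the event that the added process lies in
    \<open>C\<close>. Under it, points and marks have \<open>c\<close> times their product
    law.\<close>
  define D where "D = density M (indicator (\<eta>' -` C \<inter> space M))"
  have D: "sets D = sets M" by (simp add: D_def)
  have WYD: "(\<lambda>\<omega>. (W \<omega>, YY \<omega>)) \<in> D \<rightarrow>\<^sub>M SW \<Otimes>\<^sub>M SY"
    unfolding measurable_cong_sets[OF D refl] by (rule WY)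
  have eD: "emeasure D G = emeasure M ((\<eta>' -` C \<inter> space M) \<inter> G)" if "G \<in> sets M" for G
    unfolding D_def using Cm that by (simp add: emeasure_density indicator_inter_arith[symmetric])
  have fin: "finite_measure (density (distr M SW W) (\<lambda>_. c))"
    by (rule finite_measureI) (use c_fin DW.emeasure_space_1 in \<open>simp add: emeasure_density_const ennreal_mult_less_top\<close>)
  have "density (distr M SW W) (\<lambda>_. c) \<Otimes>\<^sub>M distr M SY YY = distr D (SW \<Otimes>\<^sub>M SY) (\<lambda>\<omega>. (W \<omega>, YY \<omega>))"
  proof (rule pair_measure_eqI)
    show "sigma_finite_measure (density (distr M SW W) (\<lambda>_. c))"
      using fin by (rule finite_measure.axioms)
    show "sigma_finite_measure (distr M SY YY)" ..
    fix A B assume "A \<in> sets (density (distr M SW W) (\<lambda>_. c))" "B \<in> sets (distr M SY YY)"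
    then have A: "A \<in> sets SW" and B: "B \<in> sets SY" by simp_all
    have AB: "(W -` A \<inter> space M) \<inter> (YY -` B \<inter> space M) \<in> sets M"
      using measurable_sets[OF W_meas A] measurable_sets[OF YY_meas B] by simp
    have "space D = space M" by (simp add: D_def)
    then have "(\<lambda>\<omega>. (W \<omega>, YY \<omega>)) -` (A \<times> B) \<inter> space D = (W -` A \<inter> space M) \<inter> (YY -` B \<inter> space M)" by auto
    then have "emeasure (distr D (SW \<Otimes>\<^sub>M SY) (\<lambda>\<omega>. (W \<omega>, YY \<omega>))) (A \<times> B)
        = emeasure M ((\<eta>' -` C \<inter> space M) \<inter> ((W -` A \<inter> space M) \<inter> (YY -` B \<inter> space M)))"
      using A B AB by (simp add: emeasure_distr[OF WYD] eD)
    also have "\<dots> = emeasure M ((W -` A \<inter> space M) \<inter> (YY -` B \<inter> space M) \<inter> (\<eta>' -` C \<inter> space M))"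
      by (simp only: Int_commute)
    also have "\<dots> = c * emeasure M (W -` A \<inter> space M) * emeasure M (YY -` B \<inter> space M)"
      unfolding c_def emeasure_eq_measure indep_W_Y_eta'[OF A B C] by (simp add: ennreal_mult' mult_ac)
    finally show "emeasure (density (distr M SW W) (\<lambda>_. c)) A * emeasure (distr M SY YY) B
        = emeasure (distr D (SW \<Otimes>\<^sub>M SY) (\<lambda>\<omega>. (W \<omega>, YY \<omega>))) (A \<times> B)"
      using A B by (simp add: emeasure_density_const emeasure_distr[OF W_meas] emeasure_distr[OF YY_meas])
  qed simp
  moreover have "density (distr M SW W) (\<lambda>_. c) \<Otimes>\<^sub>M distr M SY YY
      = density (distr M SW W \<Otimes>\<^sub>M distr M SY YY) (\<lambda>_. c)"
  proof (rule pair_measure_eqI)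
    show "sigma_finite_measure (density (distr M SW W) (\<lambda>_. c))"
      using fin by (rule finite_measure.axioms)
    show "sigma_finite_measure (distr M SY YY)" ..
    fix A B assume "A \<in> sets (density (distr M SW W) (\<lambda>_. c))" "B \<in> sets (distr M SY YY)"
    then show "emeasure (density (distr M SW W) (\<lambda>_. c)) A * emeasure (distr M SY YY) B
        = emeasure (density (distr M SW W \<Otimes>\<^sub>M distr M SY YY) (\<lambda>_. c)) (A \<times> B)"
      by (simp add: emeasure_density_const DY.emeasure_pair_measure_Times mult.assoc)
  qed simp
  ultimately have eq: "distr D (SW \<Otimes>\<^sub>M SY) (\<lambda>\<omega>. (W \<omega>, YY \<omega>)) = density (distr M (SW \<Otimes>\<^sub>M SY) (\<lambda>\<omega>. (W \<omega>, YY \<omega>))) (\<lambda>_. c)"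
    by (simp only: distr_W_Y)
  have WE: "(\<lambda>\<omega>. (W \<omega>, YY \<omega>)) -` E \<inter> space M \<in> sets M" by (rule measurable_sets[OF WY E])
  have "emeasure (distr M ((SW \<Otimes>\<^sub>M SY) \<Otimes>\<^sub>M N) (\<lambda>\<omega>. ((W \<omega>, YY \<omega>), \<eta>' \<omega>))) (E \<times> C)
      = emeasure M ((\<lambda>\<omega>. ((W \<omega>, YY \<omega>), \<eta>' \<omega>)) -` (E \<times> C) \<inter> space M)"
    using E C by (intro emeasure_distr measurable_Pair W_meas YY_meas eta'_meas) simp
  also have "(\<lambda>\<omega>. ((W \<omega>, YY \<omega>), \<eta>' \<omega>)) -` (E \<times> C) \<inter> space M
      = (\<eta>' -` C \<inter> space M) \<inter> ((\<lambda>\<omega>. (W \<omega>, YY \<omega>)) -` E \<inter> space M)" by auto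
  also have "emeasure M \<dots> = emeasure D ((\<lambda>\<omega>. (W \<omega>, YY \<omega>)) -` E \<inter> space M)"
    by (rule eD[OF WE, symmetric])
  also have "\<dots> = emeasure (distr D (SW \<Otimes>\<^sub>M SY) (\<lambda>\<omega>. (W \<omega>, YY \<omega>))) E"
    using E by (subst emeasure_distr[OF WYD]) (simp_all add: D_def)
  also have "\<dots> = c * emeasure (distr M (SW \<Otimes>\<^sub>M SY) (\<lambda>\<omega>. (W \<omega>, YY \<omega>))) E"
    unfolding eq using E by (simp add: emeasure_density_const)
  finally show "emeasure (distr M (SW \<Otimes>\<^sub>M SY) (\<lambda>\<omega>. (W \<omega>, YY \<omega>))) E * emeasure (distr M N \<eta>') C
      = emeasure (distr M ((SW \<Otimes>\<^sub>M SY) \<Otimes>\<^sub>M N) (\<lambda>\<omega>. ((W \<omega>, YY \<omega>), \<eta>' \<omega>))) (E \<times> C)"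
    using C by (simp add: c_def emeasure_distr[OF eta'_meas] mult.commute)
qed simp

end

lemma (in pair_prob_space) integral_product_bounded:
  fixes f :: "'a \<Rightarrow> real" and g :: "'b \<Rightarrow> real"
  assumes f: "f \<in> borel_measurable M1" "\<And>x. x \<in> space M1 \<Longrightarrow> \<bar>f x\<bar> \<le> 1"
    and g: "g \<in> borel_measurable M2" "\<And>y. y \<in> space M2 \<Longrightarrow> \<bar>g y\<bar> \<le> 1"
  shows "(\<integral>p. f (fst p) * g (snd p) \<partial>(M1 \<Otimes>\<^sub>M M2)) = (\<integral>x. f x \<partial>M1) * (\<integral>y. g y \<partial>M2)"
proof -
  have "integrable (M1 \<Otimes>\<^sub>M M2) (\<lambda>p. f (fst p) * g (snd p))"
  proof (rule integrable_bounded[where b=1])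
    show "(\<lambda>p. f (fst p) * g (snd p)) \<in> borel_measurable (M1 \<Otimes>\<^sub>M M2)"
      by (intro borel_measurable_times measurable_compose[OF measurable_fst f(1)] measurable_compose[OF measurable_snd g(1)])
    show "\<bar>f (fst p) * g (snd p)\<bar> \<le> 1" if "p \<in> space (M1 \<Otimes>\<^sub>M M2)" for p
      using that f(2)[of "fst p"] g(2)[of "snd p"] by (auto simp: space_pair_measure abs_mult intro!: mult_le_one)
  qed
  from integral_fst'[OF this] show ?thesis by simp
qed

section \<open>Joint generating functional of kept, deleted and added points\<close>

context thinning
begin

abbreviation "kept \<equiv> pts (\<lambda>\<omega> n. Y n \<omega>)"
abbreviation "deleted \<equiv> pts (\<lambda>\<omega> n. \<not> Y n \<omega>)"

lemma kept_meas: "kept \<in> M \<rightarrow>\<^sub>M N"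
  by (rule pts_meas[OF Y_pred])

lemma deleted_meas: "deleted \<in> M \<rightarrow>\<^sub>M N"
  by (rule pts_meas) (intro pred_intros_logic Y_pred)

lemma expectation_mark: "(\<integral>\<omega>. (if Y n \<omega> then a else b) \<partial>M) = s * a + (1 - s) * (b :: real)"
proof -
  have m: "{\<omega> \<in> space M. Y n \<omega>} \<in> events" using Y_pred by measurable
  have "(\<integral>\<omega>. (if Y n \<omega> then a else b) \<partial>M) = (\<integral>\<omega>. b + (a - b) * indicator {\<omega> \<in> space M. Y n \<omega>} \<omega> \<partial>M)"
    by (intro Bochner_Integration.integral_cong) (auto simp: indicator_def)
  also have "\<dots> = b + (a - b) * prob {\<omega> \<in> space M. Y n \<omega>}"
    using m by (simp add: prob_space emeasure_eq_measure less_top[symmetric])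
  finally show ?thesis by (simp add: Y_bern algebra_simps)
qed

text \<open>Integrating out the marks first replaces the two weights at each point by their mixture
  \<open>zz\<close>, after which the generating functionals of the original and of the added process
  finish the computation. Only the first \<open>L\<close> indices are treated at once, and
  \<open>L\<close> tends to infinity by bounded convergence.\<close>

lemma expectation_gen_kept_deleted:
  assumes z1: "test z1" and z0: "test z0" and w: "test w"
  shows "(\<integral>\<omega>. gen z1 (kept \<omega>) * gen z0 (deleted \<omega>) * gen w (\<eta>' \<omega>) \<partial>M) =
    exp (s * (\<integral>x. z1 x - 1 \<partial>lam) + (1 - s) * (\<integral>x. z0 x - 1 \<partial>lam) + (1 - s) * (\<integral>x. w x - 1 \<partial>lam))"
proof -
  interpret DW: prob_space "distr M SW W" by (rule prob_space_distr[OF W_meas])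
  interpret DY: prob_space "distr M SY YY" by (rule prob_space_distr[OF YY_meas])
  interpret DWY: prob_space "distr M (SW \<Otimes>\<^sub>M SY) (\<lambda>\<omega>. (W \<omega>, YY \<omega>))"
    by (rule prob_space_distr[OF measurable_Pair[OF W_meas YY_meas]])
  interpret De: prob_space "distr M N \<eta>'" by (rule prob_space_distr[OF eta'_meas])
  interpret WY: pair_prob_space "distr M SW W" "distr M SY YY" ..
  interpret WYe: pair_prob_space "distr M (SW \<Otimes>\<^sub>M SY) (\<lambda>\<omega>. (W \<omega>, YY \<omega>))" "distr M N \<eta>'" ..
  note zm [measurable] = testD(2)[OF z1] testD(2)[OF z0] testD(2)[OF w]
  \<comment> \<open>The factor of one listed point; indices beyond the number of points get the
    neutral factor 1.\<close>
  define \<phi> where "\<phi> k x y = (if k then (if y then z1 x else z0 x) else 1)" for k y :: bool and x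
  have \<phi>01: "0 < \<phi> k x y" "\<phi> k x y \<le> 1" for k x y
    using testD(3,4)[OF z1] testD(3,4)[OF z0] by (auto simp: \<phi>_def)
  define \<Phi> where "\<Phi> L p = (\<Prod>n<L. \<phi> (enat n < fst (fst p)) (snd (fst p) n) (snd p n))" for L p
  have \<Phi>01: "0 \<le> \<Phi> L p" "\<Phi> L p \<le> 1" for L p
    unfolding \<Phi>_def using \<phi>01 by (auto intro!: prod_nonneg prod_le_1 simp: less_imp_le)
  then have \<Phi>_abs: "\<bar>\<Phi> L p\<bar> \<le> 1" for L p by simp
  have \<Phi>_meas: "\<Phi> L \<in> borel_measurable (SW \<Otimes>\<^sub>M SY)" for L
    unfolding \<Phi>_def[abs_def]
  proof (rule borel_measurable_prod)
    fix n
    have k: "Measurable.pred (SW \<Otimes>\<^sub>M SY) (\<lambda>p. enat n < fst (fst p))"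
      by (rule measurable_compose[OF measurable_compose[OF measurable_fst measurable_fst]]) simp
    have x: "(\<lambda>p. snd (fst p) n) \<in> SW \<Otimes>\<^sub>M SY \<rightarrow>\<^sub>M X"
      by (rule measurable_compose[OF measurable_compose[OF measurable_fst measurable_snd] measurable_component_singleton]) simp
    have y: "Measurable.pred (SW \<Otimes>\<^sub>M SY) (\<lambda>p. snd p n)"
      by (rule measurable_compose[OF measurable_snd measurable_component_singleton]) simp
    show "(\<lambda>p. \<phi> (enat n < fst (fst p)) (snd (fst p) n) (snd p n)) \<in> borel_measurable (SW \<Otimes>\<^sub>M SY)"
      unfolding \<phi>_def
      by (intro measurable_If k y measurable_compose[OF x zm(1)] measurable_compose[OF x zm(2)] measurable_const) simp_all
  qed
  define zz where "zz x = s * z1 x + (1 - s) * z0 x" for x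
  have zz: "test zz" unfolding zz_def[abs_def] by (rule test_mix[OF z1 z0 s])
  \<comment> \<open>The points are frozen as \<open>v\<close>, so that independence of the marks
    alone factors the expectation over the indices.\<close>
  have marks: "(\<integral>\<omega>'. \<Phi> L (v, YY \<omega>') \<partial>M) = (\<Prod>n<L. if enat n < fst v then zz (snd v n) else 1)" for L v
  proof -
    have "indep_vars (\<lambda>_. count_space UNIV) Y {..<L}" by (rule indep_vars_subset[OF Y_indep]) simp
    then have ind: "indep_vars (\<lambda>_. borel) (\<lambda>n \<omega>. \<phi> (enat n < fst v) (snd v n) (Y n \<omega>)) {..<L}"
      by (rule indep_vars_compose2) simp
    have "(\<integral>\<omega>'. \<Phi> L (v, YY \<omega>') \<partial>M) = (\<integral>\<omega>'. (\<Prod>n<L. \<phi> (enat n < fst v) (snd v n) (Y n \<omega>')) \<partial>M)"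
      by (simp add: \<Phi>_def)
    also have "\<dots> = (\<Prod>n<L. \<integral>\<omega>'. \<phi> (enat n < fst v) (snd v n) (Y n \<omega>') \<partial>M)"
    proof (rule indep_vars_lebesgue_integral[OF _ ind])
      fix n
      have "(\<lambda>\<omega>'. \<phi> (enat n < fst v) (snd v n) (Y n \<omega>')) \<in> borel_measurable M"
        by (rule measurable_compose[OF Y_meas]) simp
      then show "integrable M (\<lambda>\<omega>'. \<phi> (enat n < fst v) (snd v n) (Y n \<omega>'))"
        by (rule integrable_bounded[where b=1]) (use \<phi>01 in \<open>simp add: less_imp_le\<close>)
    qed simp
    also have "\<dots> = (\<Prod>n<L. if enat n < fst v then zz (snd v n) else 1)"
      by (intro prod.cong refl) (simp add: \<phi>_def expectation_mark zz_def prob_space)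
    finally show ?thesis .
  qed
  have finite_stage: "(\<integral>\<omega>. \<Phi> L (W \<omega>, YY \<omega>) * gen w (\<eta>' \<omega>) \<partial>M)
      = (\<integral>\<omega>. (\<Prod>n<L. if enat n < \<kappa> \<omega> then zz (Xs n \<omega>) else 1) \<partial>M) * exp ((1 - s) * (\<integral>x. w x - 1 \<partial>lam))" for L
  proof -
    have gw: "gen w \<in> borel_measurable N" by (rule measurable_gen_test[OF w])
    have m3: "(\<lambda>\<omega>. ((W \<omega>, YY \<omega>), \<eta>' \<omega>)) \<in> M \<rightarrow>\<^sub>M (SW \<Otimes>\<^sub>M SY) \<Otimes>\<^sub>M N"
      by (intro measurable_Pair W_meas YY_meas eta'_meas)
    have m2: "(\<lambda>\<omega>. (W \<omega>, YY \<omega>)) \<in> M \<rightarrow>\<^sub>M SW \<Otimes>\<^sub>M SY"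
      by (intro measurable_Pair W_meas YY_meas)
    have "(\<integral>\<omega>. \<Phi> L (W \<omega>, YY \<omega>) * gen w (\<eta>' \<omega>) \<partial>M)
        = (\<integral>q. \<Phi> L (fst q) * gen w (snd q) \<partial>distr M ((SW \<Otimes>\<^sub>M SY) \<Otimes>\<^sub>M N) (\<lambda>\<omega>. ((W \<omega>, YY \<omega>), \<eta>' \<omega>)))"
      by (subst integral_distr[OF m3])
        (intro borel_measurable_times measurable_compose[OF measurable_fst \<Phi>_meas] measurable_compose[OF measurable_snd gw], simp)
    also have "\<dots> = (\<integral>p. \<Phi> L p \<partial>distr M (SW \<Otimes>\<^sub>M SY) (\<lambda>\<omega>. (W \<omega>, YY \<omega>))) * (\<integral>\<mu>. gen w \<mu> \<partial>distr M N \<eta>')"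
      unfolding distr_WY_eta'[symmetric]
      by (rule WYe.integral_product_bounded) (simp_all add: \<Phi>_meas gw \<Phi>_abs)
    also have "(\<integral>\<mu>. gen w \<mu> \<partial>distr M N \<eta>') = exp ((1 - s) * (\<integral>x. w x - 1 \<partial>lam))"
      using expectation_gen_poisson_process[OF eta'_PPP _ w] s by (simp add: integral_distr[OF eta'_meas gw])
    also have "(\<integral>p. \<Phi> L p \<partial>distr M (SW \<Otimes>\<^sub>M SY) (\<lambda>\<omega>. (W \<omega>, YY \<omega>)))
        = (\<integral>v. \<integral>y. \<Phi> L (v, y) \<partial>distr M SY YY \<partial>distr M SW W)"
      unfolding distr_W_Y[symmetric]
    proof (rule WY.integral_fst'[symmetric])
      have "\<Phi> L \<in> borel_measurable (distr M SW W \<Otimes>\<^sub>M distr M SY YY)"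
        by (simp add: distr_W_Y \<Phi>_meas)
      then show "integrable (distr M SW W \<Otimes>\<^sub>M distr M SY YY) (\<Phi> L)"
        by (rule WY.integrable_bounded[where b=1]) (rule \<Phi>_abs)
    qed
    also have "\<dots> = (\<integral>v. (\<Prod>n<L. if enat n < fst v then zz (snd v n) else 1) \<partial>distr M SW W)"
    proof (intro Bochner_Integration.integral_cong refl)
      fix v assume "v \<in> space (distr M SW W)"
      then have v: "v \<in> space SW" by simp
      have "(\<integral>y. \<Phi> L (v, y) \<partial>distr M SY YY) = (\<integral>\<omega>'. \<Phi> L (v, YY \<omega>') \<partial>M)"
        by (rule integral_distr[OF YY_meas measurable_compose[OF measurable_Pair1'[OF v] \<Phi>_meas]])
      then show "(\<integral>y. \<Phi> L (v, y) \<partial>distr M SY YY) = (\<Prod>n<L. if enat n < fst v then zz (snd v n) else 1)"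
        by (simp only: marks)
    qed
    also have "\<dots> = (\<integral>\<omega>. (\<Prod>n<L. if enat n < fst (W \<omega>) then zz (snd (W \<omega>) n) else 1) \<partial>M)"
    proof (rule integral_distr[OF W_meas], rule borel_measurable_prod)
      fix n
      have k: "Measurable.pred SW (\<lambda>p. enat n < fst p)"
        by (rule measurable_compose[OF measurable_fst]) simp
      have x: "(\<lambda>p. snd p n) \<in> SW \<rightarrow>\<^sub>M X"
        by (rule measurable_compose[OF measurable_snd measurable_component_singleton]) simp
      show "(\<lambda>v. if enat n < fst v then zz (snd v n) else 1) \<in> borel_measurable SW"
        by (intro measurable_If k measurable_compose[OF x testD(2)[OF zz]] measurable_const) simp_all
    qed
    finally show ?thesis unfolding fst_conv snd_conv .
  qed
  have lim_rhs: "(\<lambda>L. \<integral>\<omega>. (\<Prod>n<L. if enat n < \<kappa> \<omega> then zz (Xs n \<omega>) else 1) \<partial>M) \<longlonglongrightarrow> (\<integral>\<omega>. gen zz (\<eta> \<omega>) \<partial>M)"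
  proof (rule bounded_convergence[where b=1])
    fix L
    show "(\<lambda>\<omega>. \<Prod>n<L. if enat n < \<kappa> \<omega> then zz (Xs n \<omega>) else 1) \<in> borel_measurable M"
      by (intro borel_measurable_prod measurable_If predE[OF index_pred] measurable_compose[OF Xs_meas testD(2)[OF zz]] measurable_const) simp_all
    fix \<omega>
    have "0 \<le> (\<Prod>n<L. if enat n < \<kappa> \<omega> then zz (Xs n \<omega>) else 1)" "(\<Prod>n<L. if enat n < \<kappa> \<omega> then zz (Xs n \<omega>) else 1) \<le> 1"
      using testD(3,4)[OF zz] by (auto intro!: prod_nonneg prod_le_1 simp: less_imp_le)
    then show "\<bar>\<Prod>n<L. if enat n < \<kappa> \<omega> then zz (Xs n \<omega>) else 1\<bar> \<le> 1" by simp
  next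
    fix \<omega> assume \<omega>: "\<omega> \<in> space M"
    show "(\<lambda>L. \<Prod>n<L. if enat n < \<kappa> \<omega> then zz (Xs n \<omega>) else 1) \<longlonglongrightarrow> gen zz (\<eta> \<omega>)"
      using gen_pts_measure[of "\<lambda>n. Xs n \<omega>" X zz "\<kappa> \<omega>" "\<lambda>_. True"] testD[OF zz] Xs_space[OF \<omega>]
      by (simp add: eta_repr[OF \<omega>])
  qed
  have \<Phi>_lim: "(\<lambda>L. \<Phi> L (W \<omega>, YY \<omega>)) \<longlonglongrightarrow> gen z1 (kept \<omega>) * gen z0 (deleted \<omega>)" if \<omega>: "\<omega> \<in> space M" for \<omega>
  proof -
    have "\<Phi> L (W \<omega>, YY \<omega>) = (\<Prod>n<L. if enat n < \<kappa> \<omega> \<and> Y n \<omega> then z1 (Xs n \<omega>) else 1)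
        * (\<Prod>n<L. if enat n < \<kappa> \<omega> \<and> \<not> Y n \<omega> then z0 (Xs n \<omega>) else 1)" for L
      unfolding \<Phi>_def prod.distrib[symmetric] by (intro prod.cong refl) (auto simp: \<phi>_def)
    then show ?thesis
      using tendsto_mult[OF gen_pts_measure[of "\<lambda>n. Xs n \<omega>" X z1 "\<kappa> \<omega>" "\<lambda>n. Y n \<omega>", OF Xs_space[OF \<omega>] zm(1) testD(5)[OF z1]]
          gen_pts_measure[of "\<lambda>n. Xs n \<omega>" X z0 "\<kappa> \<omega>" "\<lambda>n. \<not> Y n \<omega>", OF Xs_space[OF \<omega>] zm(2) testD(5)[OF z0]]]
      by simp
  qed
  have lim_lhs: "(\<lambda>L. \<integral>\<omega>. \<Phi> L (W \<omega>, YY \<omega>) * gen w (\<eta>' \<omega>) \<partial>M)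
      \<longlonglongrightarrow> (\<integral>\<omega>. gen z1 (kept \<omega>) * gen z0 (deleted \<omega>) * gen w (\<eta>' \<omega>) \<partial>M)"
  proof (rule bounded_convergence[where b=1])
    show "(\<lambda>\<omega>. \<Phi> L (W \<omega>, YY \<omega>) * gen w (\<eta>' \<omega>)) \<in> borel_measurable M" for L
      by (intro borel_measurable_times measurable_compose[OF measurable_Pair[OF W_meas YY_meas] \<Phi>_meas]
          measurable_compose[OF eta'_meas measurable_gen_test[OF w]])
    show "\<bar>\<Phi> L (W \<omega>, YY \<omega>) * gen w (\<eta>' \<omega>)\<bar> \<le> 1" for L \<omega>
      unfolding abs_mult by (intro mult_le_one \<Phi>_abs abs_gen_le_1 abs_ge_zero)
    show "(\<lambda>L. \<Phi> L (W \<omega>, YY \<omega>) * gen w (\<eta>' \<omega>)) \<longlonglongrightarrow> gen z1 (kept \<omega>) * gen z0 (deleted \<omega>) * gen w (\<eta>' \<omega>)"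
      if "\<omega> \<in> space M" for \<omega>
      by (intro tendsto_mult \<Phi>_lim that tendsto_const)
  qed
  have "(\<lambda>L. \<integral>\<omega>. \<Phi> L (W \<omega>, YY \<omega>) * gen w (\<eta>' \<omega>) \<partial>M)
      \<longlonglongrightarrow> (\<integral>\<omega>. gen zz (\<eta> \<omega>) \<partial>M) * exp ((1 - s) * (\<integral>x. w x - 1 \<partial>lam))"
    unfolding finite_stage by (rule tendsto_mult[OF lim_rhs tendsto_const])
  then have "(\<integral>\<omega>. gen z1 (kept \<omega>) * gen z0 (deleted \<omega>) * gen w (\<eta>' \<omega>) \<partial>M)
      = (\<integral>\<omega>. gen zz (\<eta> \<omega>) \<partial>M) * exp ((1 - s) * (\<integral>x. w x - 1 \<partial>lam))"
    by (rule LIMSEQ_unique[OF lim_lhs])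
  also have "(\<integral>\<omega>. gen zz (\<eta> \<omega>) \<partial>M) = exp (\<integral>x. zz x - 1 \<partial>lam)"
    using expectation_gen_poisson_process[of M 1 \<eta> zz] PPP zz by simp
  also have "(\<integral>x. zz x - 1 \<partial>lam) = (\<integral>x. s * (z1 x - 1) + (1 - s) * (z0 x - 1) \<partial>lam)"
    by (intro Bochner_Integration.integral_cong refl) (simp add: zz_def algebra_simps)
  also have "\<dots> = s * (\<integral>x. z1 x - 1 \<partial>lam) + (1 - s) * (\<integral>x. z0 x - 1 \<partial>lam)"
    using integrable_mult_right[OF integrable_test[OF z1], of s] integrable_mult_right[OF integrable_test[OF z0], of "1 - s"]
    by (subst Bochner_Integration.integral_add) (simp_all only: integral_mult_right_zero)
  finally show ?thesis by (simp add: exp_add)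
qed

definition resampled :: "'w \<Rightarrow> 'a measure" where
  "resampled \<omega> = sum_msr X (kept \<omega>) (\<eta>' \<omega>)"

lemma sum_msr_meas:
  assumes "f \<in> M \<rightarrow>\<^sub>M N" "g \<in> M \<rightarrow>\<^sub>M N"
  shows "(\<lambda>\<omega>. sum_msr X (f \<omega>) (g \<omega>)) \<in> M \<rightarrow>\<^sub>M N"
  using measurable_compose[OF measurable_Pair[OF assms] measurable_sum_msr] by simp

lemma resampled_meas: "resampled \<in> M \<rightarrow>\<^sub>M N"
  unfolding resampled_def[abs_def] by (rule sum_msr_meas[OF kept_meas eta'_meas])

lemma pair_meas: "(\<lambda>\<omega>. (\<eta> \<omega>, resampled \<omega>)) \<in> M \<rightarrow>\<^sub>M N2"
  by (rule measurable_Pair[OF eta_meas resampled_meas])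

lemma sets_eta': "\<omega> \<in> space M \<Longrightarrow> sets (\<eta>' \<omega>) = sets X"
  by (rule sets_counting[OF measurable_space[OF eta'_meas]])

text \<open>Kept points lie in both configurations and carry the weight \<open>z * w\<close>,
  deleted points only in the first, added points only in the second. Expanding
  \<open>z w - 1\<close> as \<open>(z - 1) + (w - 1) + (z - 1) (w - 1)\<close> leaves the cross term
  with coefficient \<open>s\<close>.\<close>

lemma coupling_law: "coupling s (distr M N2 (\<lambda>\<omega>. (\<eta> \<omega>, resampled \<omega>)))"
  unfolding coupling_def
proof (intro conjI allI impI)
  show "prob_space (distr M N2 (\<lambda>\<omega>. (\<eta> \<omega>, resampled \<omega>)))" by (rule prob_space_distr[OF pair_meas])
  fix z w assume z: "test z" and w: "test w"
  have "(\<integral>p. gen z (fst p) * gen w (snd p) \<partial>distr M N2 (\<lambda>\<omega>. (\<eta> \<omega>, resampled \<omega>)))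
      = (\<integral>\<omega>. gen z (\<eta> \<omega>) * gen w (resampled \<omega>) \<partial>M)"
    by (subst integral_distr[OF pair_meas measurable_gen_fst_snd[OF z w]]) simp
  also have "\<dots> = (\<integral>\<omega>. gen (\<lambda>x. z x * w x) (kept \<omega>) * gen z (deleted \<omega>) * gen w (\<eta>' \<omega>) \<partial>M)"
  proof (intro Bochner_Integration.integral_cong refl)
    fix \<omega> assume \<omega>: "\<omega> \<in> space M"
    have "gen z (\<eta> \<omega>) = gen z (kept \<omega>) * gen z (deleted \<omega>)"
      using gen_pts_measure_split[of "\<lambda>n. Xs n \<omega>" X z "\<kappa> \<omega>" "\<lambda>_. True" "\<lambda>n. Y n \<omega>"] Xs_space[OF \<omega>] testD(2)[OF z]
      by (simp add: eta_repr[OF \<omega>])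
    moreover have "gen w (resampled \<omega>) = gen w (kept \<omega>) * gen w (\<eta>' \<omega>)"
      unfolding resampled_def by (rule gen_sum_msr) (simp_all add: sets_eta'[OF \<omega>] testD(2)[OF w])
    moreover have "gen (\<lambda>x. z x * w x) (kept \<omega>) = gen z (kept \<omega>) * gen w (kept \<omega>)"
      by (rule gen_test_mult[OF z w]) simp
    ultimately show "gen z (\<eta> \<omega>) * gen w (resampled \<omega>) = gen (\<lambda>x. z x * w x) (kept \<omega>) * gen z (deleted \<omega>) * gen w (\<eta>' \<omega>)"
      by simp
  qed
  also have "\<dots> = exp (s * (\<integral>x. z x * w x - 1 \<partial>lam) + (1 - s) * (\<integral>x. z x - 1 \<partial>lam) + (1 - s) * (\<integral>x. w x - 1 \<partial>lam))"
    by (rule expectation_gen_kept_deleted[OF test_mult[OF z w] z w])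
  also have "(\<integral>x. z x * w x - 1 \<partial>lam) = (\<integral>x. (z x - 1) + (w x - 1) + 0 + 1 * ((z x - 1) * (w x - 1)) \<partial>lam)"
    by (intro Bochner_Integration.integral_cong refl) (simp add: algebra_simps)
  also have "\<dots> = (\<integral>x. z x - 1 \<partial>lam) + (\<integral>x. w x - 1 \<partial>lam) + (\<integral>x. 0 \<partial>lam) + 1 * (\<integral>x. (z x - 1) * (w x - 1) \<partial>lam)"
    by (rule integral_combine[OF integrable_test[OF z] integrable_test[OF w] integrable_zero integrable_test2[OF z w]])
  finally show "(\<integral>p. gen z (fst p) * gen w (snd p) \<partial>distr M N2 (\<lambda>\<omega>. (\<eta> \<omega>, resampled \<omega>)))
      = exp ((\<integral>x. z x - 1 \<partial>lam) + (\<integral>x. w x - 1 \<partial>lam) + s * (\<integral>x. (z x - 1) * (w x - 1) \<partial>lam))"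
    by (simp add: algebra_simps)
qed simp

end

section \<open>The reduced Mecke equation\<close>

text \<open>Splitting off one factor writes the slope as \<open>a n\<close> times the slope of the
  remaining product plus that product shifted by the step. Both summands grow as the step shrinks
  while all factors stay nonnegative. Monotone convergence in \<open>mecke_gen\<close> rests on
  this.\<close>

lemma prod_slope_antimono:
  fixes a :: "'i \<Rightarrow> real"
  assumes "finite D" "0 < \<theta>'" "\<theta>' \<le> \<theta>" "\<And>n. n \<in> D \<Longrightarrow> \<theta> \<le> a n"
  shows "((\<Prod>n\<in>D. a n) - (\<Prod>n\<in>D. a n - \<theta>)) / \<theta> \<le> ((\<Prod>n\<in>D. a n) - (\<Prod>n\<in>D. a n - \<theta>')) / \<theta>'"
  using assms(1,4)
proof (induction D rule: finite_induct)
  case (insert n D)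
  define p where "p t = (\<Prod>n\<in>D. a n - t)" for t
  have step: "((\<Prod>n\<in>insert n D. a n) - (\<Prod>n\<in>insert n D. a n - t)) / t = a n * (((\<Prod>n\<in>D. a n) - p t) / t) + p t"
    if "0 < t" for t
    using insert.hyps that by (simp add: p_def field_simps)
  have "p \<theta> \<le> p \<theta>'"
    unfolding p_def using insert.prems assms(2,3) by (intro prod_mono) auto
  moreover have "0 \<le> a n" using insert.prems[of n] assms(2,3) by simp
  then have "a n * (((\<Prod>n\<in>D. a n) - p \<theta>) / \<theta>) \<le> a n * (((\<Prod>n\<in>D. a n) - p \<theta>') / \<theta>')"
    unfolding p_def using insert.IH insert.prems by (intro mult_left_mono) auto
  ultimately show ?case
    using step[of \<theta>] step[of \<theta>'] assms(2,3) by linarith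
qed (use assms in simp)

lemma gen_pts_measure_cong:
  assumes xs: "\<And>n. xs n \<in> space X" and z: "z \<in> borel_measurable X" "w \<in> borel_measurable X"
    and eq: "\<And>n. enat n < k \<Longrightarrow> S n \<Longrightarrow> z (xs n) = w (xs n)"
  shows "gen z (pts_measure X k S xs) = gen w (pts_measure X k S xs)"
proof -
  have m: "(\<lambda>x. ennreal (- ln (z x))) \<in> borel_measurable X" "(\<lambda>x. ennreal (- ln (w x))) \<in> borel_measurable X"
    using z by measurable
  show ?thesis
    unfolding gen_def nn_integral_pts_measure[OF xs m(1)] nn_integral_pts_measure[OF xs m(2)]
    using eq by (intro arg_cong[where f=exp_neg] arg_cong[where f=suminf] ext) simp
qed

text \<open>A perturbation of \<open>z\<close> on a set of finite intensity touches almost surely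
  finitely many points; this isolates them as an honest finite product, to which the product rule
  applies.\<close>

lemma gen_pts_measure_finite:
  assumes xs: "\<And>n. xs n \<in> space X" and z: "z \<in> borel_measurable X" "\<And>x. 0 < z x \<and> z x \<le> 1"
    and D: "finite D" "\<And>n. n \<in> D \<Longrightarrow> enat n < k \<and> S n"
  shows "gen z (pts_measure X k S xs) = (\<Prod>n\<in>D. z (xs n)) * gen z (pts_measure X k (\<lambda>n. S n \<and> n \<notin> D) xs)"
proof -
  have "(\<lambda>L. \<Prod>n<L. if enat n < k \<and> (S n \<and> n \<in> D) then z (xs n) else 1)
      \<longlonglongrightarrow> gen z (pts_measure X k (\<lambda>n. S n \<and> n \<in> D) xs)"
    by (rule gen_pts_measure[OF xs z])
  moreover have "(\<lambda>L. \<Prod>n<L. if enat n < k \<and> (S n \<and> n \<in> D) then z (xs n) else 1) \<longlonglongrightarrow> (\<Prod>n\<in>D. z (xs n))"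
  proof (rule tendsto_eventually, rule eventually_sequentiallyI[of "Suc (Max (insert 0 D))"])
    fix L assume L: "Suc (Max (insert 0 D)) \<le> L"
    have sub: "D \<subseteq> {..<L}"
    proof
      fix n assume "n \<in> D"
      then have "n \<le> Max (insert 0 D)" using D(1) by (intro Max_ge) auto
      then show "n \<in> {..<L}" using L by simp
    qed
    have "(\<Prod>n<L. if enat n < k \<and> (S n \<and> n \<in> D) then z (xs n) else 1)
        = (\<Prod>n\<in>D. if enat n < k \<and> (S n \<and> n \<in> D) then z (xs n) else 1)"
      using sub by (intro prod.mono_neutral_right) auto
    also have "\<dots> = (\<Prod>n\<in>D. z (xs n))" using D(2) by (intro prod.cong) auto
    finally show "(\<Prod>n<L. if enat n < k \<and> (S n \<and> n \<in> D) then z (xs n) else 1) = (\<Prod>n\<in>D. z (xs n))" .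
  qed
  ultimately have "gen z (pts_measure X k (\<lambda>n. S n \<and> n \<in> D) xs) = (\<Prod>n\<in>D. z (xs n))"
    by (rule LIMSEQ_unique)
  then show ?thesis
    using gen_pts_measure_split[OF xs z(1), where k=k and S=S and T="\<lambda>n. n \<in> D"] by simp
qed

context intensity
begin

lemma test_lower_bound:
  assumes z: "test z"
  shows "\<exists>c>0. \<forall>x\<in>space X. c \<le> z x"
proof -
  \<comment> \<open>The extra 1 keeps the set nonempty when \<open>space X\<close> is empty, so that
    its minimum is meaningful.\<close>
  have fin: "finite (insert 1 (z ` space X))" using testD(1)[OF z] by (simp add: simple_function_def)
  have "0 < Min (insert 1 (z ` space X))" using fin testD(3)[OF z] by (subst Min_gr_iff) auto
  moreover have "Min (insert 1 (z ` space X)) \<le> z x" if "x \<in> space X" for x using fin that by (intro Min_le) auto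
  ultimately show ?thesis by blast
qed

lemma test_subtract:
  assumes z: "test z" and A: "A \<in> sets X" "A \<subseteq> Bn m" and \<theta>: "0 \<le> \<theta>" "\<And>x. x \<in> A \<Longrightarrow> \<theta> < z x"
  shows "test (\<lambda>x. z x - \<theta> * indicator A x)"
proof -
  obtain n where n: "\<forall>x\<in>space X - Bn n. z x = 1" using z unfolding test_def by blast
  have "z x - \<theta> * indicator A x = 1" if "x \<in> space X - Bn (max m n)" for x
  proof -
    have "x \<notin> Bn m" "x \<in> space X - Bn n"
      using that Bn_mono[of m "max m n" x] Bn_mono[of n "max m n" x] by auto
    then show ?thesis using A(2) n by (auto simp: indicator_def)
  qed
  moreover have "simple_function X (\<lambda>x. z x - \<theta> * indicator A x)"
    using A testD(1)[OF z]
    by (intro simple_function_diff simple_function_mult simple_function_const simple_function_indicator)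
  moreover have "0 < z x - \<theta> * indicator A x \<and> z x - \<theta> * indicator A x \<le> 1" for x
    using testD(3,4)[OF z, of x] \<theta> by (auto simp: indicator_def)
  ultimately show ?thesis unfolding test_def by (intro conjI allI exI[of _ "max m n"] ballI) simp_all
qed

end

context thinning
begin

text \<open>A point is removed by index and not by location, so at a multiple point exactly one copy
  disappears, as when subtracting a Dirac mass.\<close>

abbreviation "eta_except n \<equiv> pts (\<lambda>\<omega> m. m \<noteq> n)"
abbreviation "kept_except n \<equiv> pts (\<lambda>\<omega> m. m \<noteq> n \<and> Y m \<omega>)"

definition resampled_except :: "nat \<Rightarrow> 'w \<Rightarrow> 'a measure" where
  "resampled_except n \<omega> = sum_msr X (kept_except n \<omega>) (\<eta>' \<omega>)"

lemma eta_except_meas: "eta_except n \<in> M \<rightarrow>\<^sub>M N"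
  by (rule pts_meas) simp

lemma kept_except_meas: "kept_except n \<in> M \<rightarrow>\<^sub>M N"
  by (rule pts_meas) (intro pred_intros_logic Y_pred, simp)

lemma resampled_except_meas: "resampled_except n \<in> M \<rightarrow>\<^sub>M N"
  unfolding resampled_except_def[abs_def] by (rule sum_msr_meas[OF kept_except_meas eta'_meas])

lemma kept_pred: "Measurable.pred M (\<lambda>\<omega>. enat n < \<kappa> \<omega> \<and> Y n \<omega>)"
  by (intro pred_intros_logic index_pred Y_pred)

lemma AE_finite_points:
  assumes A: "A \<in> sets X" and fin: "emeasure lam A < \<infinity>"
  shows "AE \<omega> in M. finite {n. enat n < \<kappa> \<omega> \<and> Xs n \<omega> \<in> A}"
proof -
  have m: "(\<lambda>\<omega>. emeasure (\<eta> \<omega>) A) \<in> borel_measurable M"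
    by (rule measurable_compose[OF eta_meas measurable_emeasure_N_alg[OF A]])
  have "AE \<omega> in M. \<exists>k::nat. emeasure (\<eta> \<omega>) A = of_nat k"
    by (rule AE_poisson_finite[OF prob_space_axioms m])
      (use PPP A fin in \<open>simp add: poisson_process_def\<close>)
  moreover have "AE \<omega> in M. \<omega> \<in> space M" by simp
  ultimately show ?thesis
  proof eventually_elim
    case (elim \<omega>)
    then obtain k :: nat where k: "emeasure (\<eta> \<omega>) A = of_nat k" by blast
    have "emeasure (\<eta> \<omega>) A = (\<Sum>n. indicator {n. enat n < \<kappa> \<omega> \<and> Xs n \<omega> \<in> A} n)"
      unfolding eta_repr[OF elim(2)] emeasure_pts_measure[OF Xs_space[OF elim(2)] A]
      by (intro arg_cong[where f=suminf]) (auto simp: fun_eq_iff indicator_def)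
    also have "\<dots> = (\<integral>\<^sup>+n. indicator {n. enat n < \<kappa> \<omega> \<and> Xs n \<omega> \<in> A} n \<partial>count_space UNIV)"
      by (rule nn_integral_count_space_nat[symmetric])
    also have "\<dots> = emeasure (count_space UNIV) {n. enat n < \<kappa> \<omega> \<and> Xs n \<omega> \<in> A}" by simp
    finally have eq: "emeasure (\<eta> \<omega>) A = emeasure (count_space UNIV) {n. enat n < \<kappa> \<omega> \<and> Xs n \<omega> \<in> A}" .
    have "emeasure (count_space UNIV) {n. enat n < \<kappa> \<omega> \<and> Xs n \<omega> \<in> A} \<noteq> \<infinity>"
      unfolding eq[symmetric] k by simp
    then show ?case by (simp add: emeasure_count_space split: if_splits)
  qed
qed

text \<open>Differentiate the joint generating functional of the retained points, the deleted points and \<open>\<eta>'\<close> in the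
  direction \<open>- indicator A\<close>. Difference quotients are monotone, which yields integrability along the way.\<close>

lemma mecke_gen:
  assumes A: "A \<in> sets X" "A \<subseteq> Bn i" and z: "test z" and w: "test w"
  shows "(\<integral>\<^sup>+\<omega>. (\<Sum>n. ennreal (of_bool (enat n < \<kappa> \<omega> \<and> Y n \<omega>) * indicator A (Xs n \<omega>)
        * (gen z (eta_except n \<omega>) * gen w (resampled_except n \<omega>)))) \<partial>M)
    = ennreal (s * measure lam A
        * exp ((\<integral>x. z x - 1 \<partial>lam) + (\<integral>x. w x - 1 \<partial>lam) + s * (\<integral>x. (z x - 1) * (w x - 1) \<partial>lam)))"
    (is "_ = ennreal (s * ?L * exp ?e)")
proof -
  \<comment> \<open>The weight of a retained point, which belongs to both configurations.\<close>
  define a where "a x = z x * w x" for x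
  have a: "test a" unfolding a_def[abs_def] by (rule test_mult[OF z w])
  obtain c where c: "0 < c" "\<And>x. x \<in> space X \<Longrightarrow> c \<le> a x" using test_lower_bound[OF a] by blast
  \<comment> \<open>Decreasing steps, at most half the lower bound \<open>c\<close> of
    \<open>a\<close>: the perturbed weight stays positive on \<open>A\<close>, and the slopes
    increase with \<open>j\<close>.\<close>
  define \<theta> where "\<theta> j = c / 2 / Suc j" for j :: nat
  have \<theta>: "0 < \<theta> j" "\<theta> j < c" for j
  proof -
    show "0 < \<theta> j" using c(1) by (simp add: \<theta>_def)
    have "\<theta> j \<le> c / 2 / 1" unfolding \<theta>_def using c(1) by (intro divide_left_mono) auto
    then show "\<theta> j < c" using c(1) by simp
  qed
  have \<theta>_dec: "\<theta> k \<le> \<theta> j" if "j \<le> k" for j k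
    unfolding \<theta>_def using that c(1) by (intro divide_left_mono) auto
  have "(\<lambda>j. (c / 2) * inverse (real (Suc j))) \<longlonglongrightarrow> (c / 2) * 0"
    by (intro tendsto_mult_left LIMSEQ_inverse_real_of_nat)
  moreover have "\<theta> = (\<lambda>j. (c / 2) * inverse (real (Suc j)))"
    unfolding \<theta>_def by (simp only: divide_inverse)
  ultimately have "\<theta> \<longlonglongrightarrow> 0" by (simp only: mult_zero_right)
  then have \<theta>_lim: "filterlim \<theta> (at 0) sequentially"
    using \<theta>(1) by (intro filterlim_atI always_eventually allI) (auto simp: less_imp_neq[symmetric])
  have A_sp: "x \<in> space X" if "x \<in> A" for x using sets.sets_into_space[OF A(1)] that by blast
  define b where "b j x = a x - \<theta> j * indicator A x" for j x
  have b: "test (b j)" for j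
    unfolding b_def[abs_def]
  proof (rule test_subtract[OF a A])
    show "\<theta> j < a x" if "x \<in> A" for x using \<theta>(2)[of j] c(2)[OF A_sp[OF that]] by linarith
  qed (use \<theta>(1)[of j] in simp)
  have A_fin: "emeasure lam A < \<infinity>"
    using emeasure_mono[OF A(2), of lam] Bn_fin[of i] lam_sets Bn_sets by (auto intro: le_less_trans)
  define g where "g \<omega> = gen z (deleted \<omega>) * gen w (\<eta>' \<omega>)" for \<omega>
  have g0: "0 \<le> g \<omega>" for \<omega> by (simp add: g_def)
  have g_meas: "g \<in> borel_measurable M"
    unfolding g_def[abs_def]
    by (intro borel_measurable_times measurable_compose[OF deleted_meas measurable_gen_test[OF z]]
      measurable_compose[OF eta'_meas measurable_gen_test[OF w]])
  have E: "(\<integral>\<omega>. gen y (kept \<omega>) * g \<omega> \<partial>M) =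
      exp (s * (\<integral>x. y x - 1 \<partial>lam) + (1 - s) * (\<integral>x. z x - 1 \<partial>lam) + (1 - s) * (\<integral>x. w x - 1 \<partial>lam))"
    if "test y" for y
    using expectation_gen_kept_deleted[OF that z w] by (simp add: g_def mult.assoc)
  have E_int: "integrable M (\<lambda>\<omega>. gen y (kept \<omega>) * g \<omega>)" if "test y" for y
  proof (rule integrable_bounded[where b=1])
    show "(\<lambda>\<omega>. gen y (kept \<omega>) * g \<omega>) \<in> borel_measurable M"
      by (intro borel_measurable_times measurable_compose[OF kept_meas measurable_gen_test[OF that]] g_meas)
    show "\<bar>gen y (kept \<omega>) * g \<omega>\<bar> \<le> 1" for \<omega>
      unfolding g_def abs_mult by (intro mult_le_one abs_gen_le_1 abs_ge_zero mult_nonneg_nonneg)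
  qed
  have "(\<integral>x. z x * w x - 1 \<partial>lam) = (\<integral>x. (z x - 1) + (w x - 1) + 0 + 1 * ((z x - 1) * (w x - 1)) \<partial>lam)"
    by (intro Bochner_Integration.integral_cong refl) (simp add: algebra_simps)
  also have "\<dots> = (\<integral>x. z x - 1 \<partial>lam) + (\<integral>x. w x - 1 \<partial>lam) + (\<integral>x. 0 \<partial>lam) + 1 * (\<integral>x. (z x - 1) * (w x - 1) \<partial>lam)"
    by (rule integral_combine[OF integrable_test[OF z] integrable_test[OF w] integrable_zero integrable_test2[OF z w]])
  finally have Ea: "(\<integral>\<omega>. gen a (kept \<omega>) * g \<omega> \<partial>M) = exp ?e"
    unfolding E[OF a] a_def by (simp add: algebra_simps)
  have Eb: "(\<integral>\<omega>. gen (b j) (kept \<omega>) * g \<omega> \<partial>M) = exp (?e - \<theta> j * (s * ?L))" for j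
  proof -
    have "(\<integral>x. b j x - 1 \<partial>lam) = (\<integral>x. (a x - 1) - \<theta> j * indicator A x \<partial>lam)"
      by (intro Bochner_Integration.integral_cong refl) (simp add: b_def)
    also have "\<dots> = (\<integral>x. a x - 1 \<partial>lam) - \<theta> j * ?L"
      using integrable_test[OF a] A A_fin lam_sets
      by (subst Bochner_Integration.integral_diff) (auto simp: integrable_indicator_iff)
    finally have *: "(\<integral>x. b j x - 1 \<partial>lam) = (\<integral>x. a x - 1 \<partial>lam) - \<theta> j * ?L" .
    have "exp (s * (\<integral>x. a x - 1 \<partial>lam) + (1 - s) * (\<integral>x. z x - 1 \<partial>lam) + (1 - s) * (\<integral>x. w x - 1 \<partial>lam)) = exp ?e"
      using Ea E[OF a] by simp
    then have "s * (\<integral>x. a x - 1 \<partial>lam) + (1 - s) * (\<integral>x. z x - 1 \<partial>lam) + (1 - s) * (\<integral>x. w x - 1 \<partial>lam) = ?e" by simp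
    then show ?thesis unfolding E[OF b] * by (simp add: algebra_simps)
  qed
  define f where "f j \<omega> = (gen a (kept \<omega>) * g \<omega> - gen (b j) (kept \<omega>) * g \<omega>) / \<theta> j" for j \<omega>
  have f_int: "integrable M (f j)" for j
    unfolding f_def by (intro integrable_divide Bochner_Integration.integrable_diff E_int a b)
  have f_val: "(\<integral>\<omega>. f j \<omega> \<partial>M) = (exp ?e - exp (?e - \<theta> j * (s * ?L))) / \<theta> j" for j
    unfolding f_def using E_int[OF a] E_int[OF b[of j]] by (simp add: Ea Eb)
  \<comment> \<open>Since \<open>f\<close> is a reversed difference quotient, the minus sign of this
    derivative cancels in \<open>f_lim\<close>.\<close>
  have "((\<lambda>h. exp (?e - h * (s * ?L))) has_field_derivative (- (s * ?L) * exp ?e)) (at 0)"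
    by (auto intro!: derivative_eq_intros)
  then have "((\<lambda>h. (exp (?e - h * (s * ?L)) - exp ?e) / h) \<longlongrightarrow> - (s * ?L) * exp ?e) (at 0)"
    by (simp add: has_field_derivative_iff)
  from tendsto_minus[OF filterlim_compose[OF this \<theta>_lim]]
  have f_lim: "(\<lambda>j. \<integral>\<omega>. f j \<omega> \<partial>M) \<longlonglongrightarrow> s * ?L * exp ?e"
    unfolding f_val by (simp add: minus_divide_left)
  define t where "t n \<omega> = of_bool (enat n < \<kappa> \<omega> \<and> Y n \<omega>) * indicator A (Xs n \<omega>)
        * (gen z (eta_except n \<omega>) * gen w (resampled_except n \<omega>))" for n \<omega>
  have t0: "0 \<le> t n \<omega>" for n \<omega> by (simp add: t_def)
  have t_meas: "t n \<in> borel_measurable M" for n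
  proof -
    have "(\<lambda>\<omega>. of_bool (enat n < \<kappa> \<omega> \<and> Y n \<omega>) :: real) \<in> borel_measurable M"
      using kept_pred[of n] by measurable
    moreover have "(\<lambda>\<omega>. indicator A (Xs n \<omega>) :: real) \<in> borel_measurable M"
      by (rule measurable_compose[OF Xs_meas borel_measurable_indicator[OF A(1)]])
    ultimately show ?thesis
      unfolding t_def[abs_def]
      by (intro borel_measurable_times measurable_compose[OF eta_except_meas measurable_gen_test[OF z]]
          measurable_compose[OF resampled_except_meas measurable_gen_test[OF w]])
  qed
  have T_meas: "(\<lambda>\<omega>. \<Sum>n. ennreal (t n \<omega>)) \<in> borel_measurable M"
    using t_meas by measurable
  \<comment> \<open>The sum over retained points as a real function. It agrees with the extended sum
    on outcomes with finitely many points in \<open>A\<close>, hence almost surely.\<close>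
  define u where "u \<omega> = enn2real (\<Sum>n. ennreal (t n \<omega>))" for \<omega>
  have u_meas: "u \<in> borel_measurable M" unfolding u_def[abs_def] using T_meas by measurable
  have good: "(\<Sum>n. ennreal (t n \<omega>)) = ennreal (u \<omega>) \<and> (\<lambda>j. f j \<omega>) \<longlonglongrightarrow> u \<omega> \<and> mono (\<lambda>j. f j \<omega>)"
    if \<omega>: "\<omega> \<in> space M" and fin: "finite {n. enat n < \<kappa> \<omega> \<and> Xs n \<omega> \<in> A}" for \<omega>
  proof -
    note xs = Xs_space[OF \<omega>]
    \<comment> \<open>Indices of the retained points in \<open>A\<close>. All other retained points
      have the same weight under \<open>a\<close> and \<open>b j\<close>, so their contribution
      \<open>G\<close> is a common factor.\<close>
    define D where "D = {n. enat n < \<kappa> \<omega> \<and> Y n \<omega> \<and> Xs n \<omega> \<in> A}"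
    have D: "finite D" by (rule finite_subset[OF _ fin]) (auto simp: D_def)
    have Dk: "enat n < \<kappa> \<omega> \<and> Y n \<omega>" if "n \<in> D" for n using that by (simp add: D_def)
    define G where "G = gen a (pts (\<lambda>\<omega> n. Y n \<omega> \<and> n \<notin> D) \<omega>)"
    have G0: "0 \<le> G" by (simp add: G_def)
    have ga: "gen a (kept \<omega>) = (\<Prod>n\<in>D. a (Xs n \<omega>)) * G"
      unfolding G_def by (rule gen_pts_measure_finite[OF xs testD(2,5)[OF a] D Dk])
    have gb: "gen (b j) (kept \<omega>) = (\<Prod>n\<in>D. a (Xs n \<omega>) - \<theta> j) * G" for j
    proof -
      have "gen (b j) (kept \<omega>) = (\<Prod>n\<in>D. b j (Xs n \<omega>)) * gen (b j) (pts (\<lambda>\<omega> n. Y n \<omega> \<and> n \<notin> D) \<omega>)"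
        by (rule gen_pts_measure_finite[OF xs testD(2,5)[OF b] D Dk])
      also have "gen (b j) (pts (\<lambda>\<omega> n. Y n \<omega> \<and> n \<notin> D) \<omega>) = G"
        unfolding G_def
        by (rule gen_pts_measure_cong[OF xs testD(2)[OF b] testD(2)[OF a]]) (auto simp: D_def b_def)
      also have "(\<Prod>n\<in>D. b j (Xs n \<omega>)) = (\<Prod>n\<in>D. a (Xs n \<omega>) - \<theta> j)"
        by (intro prod.cong refl) (simp add: D_def b_def)
      finally show ?thesis .
    qed
    have f_eq: "f j \<omega> = (G * g \<omega>) * (((\<Prod>n\<in>D. a (Xs n \<omega>)) - (\<Prod>n\<in>D. a (Xs n \<omega>) - \<theta> j)) / \<theta> j)" for j
      unfolding f_def ga gb by (simp add: algebra_simps)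
    \<comment> \<open>Removing a retained index leaves the deleted points unchanged. What remains is
      the product without the factor \<open>n\<close>, that is, the term of the product rule
      belonging to \<open>n\<close>.\<close>
    have tD: "t n \<omega> = (G * g \<omega>) * (\<Prod>m\<in>D - {n}. a (Xs m \<omega>))" if n: "n \<in> D" for n
    proof -
      have nY: "Y n \<omega>" "enat n < \<kappa> \<omega>" "Xs n \<omega> \<in> A" using n by (auto simp: D_def)
      have del: "(\<lambda>m. m \<noteq> n \<and> \<not> Y m \<omega>) = (\<lambda>m. \<not> Y m \<omega>)" using nY(1) by auto
      have "gen z (eta_except n \<omega>) = gen z (kept_except n \<omega>) * gen z (deleted \<omega>)"
        using gen_pts_measure_split[OF xs testD(2)[OF z], where k="\<kappa> \<omega>" and S="\<lambda>m. m \<noteq> n" and T="\<lambda>m. Y m \<omega>"] unfolding del .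
      moreover have "gen w (resampled_except n \<omega>) = gen w (kept_except n \<omega>) * gen w (\<eta>' \<omega>)"
        unfolding resampled_except_def by (rule gen_sum_msr) (simp_all add: sets_eta'[OF \<omega>] testD(2)[OF w])
      moreover have "gen a (kept_except n \<omega>) = gen z (kept_except n \<omega>) * gen w (kept_except n \<omega>)"
        unfolding a_def by (rule gen_test_mult[OF z w]) simp
      ultimately have 1: "gen z (eta_except n \<omega>) * gen w (resampled_except n \<omega>) = gen a (kept_except n \<omega>) * g \<omega>"
        by (simp add: g_def)
      have 2: "(\<lambda>m. (m \<noteq> n \<and> Y m \<omega>) \<and> m \<notin> D - {n}) = (\<lambda>m. Y m \<omega> \<and> m \<notin> D)" using n by auto
      have "gen a (kept_except n \<omega>) = (\<Prod>m\<in>D - {n}. a (Xs m \<omega>)) * gen a (pts (\<lambda>\<omega> m. (m \<noteq> n \<and> Y m \<omega>) \<and> m \<notin> D - {n}) \<omega>)"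
        by (rule gen_pts_measure_finite[OF xs testD(2,5)[OF a]]) (use D Dk in auto)
      then have "gen a (kept_except n \<omega>) = (\<Prod>m\<in>D - {n}. a (Xs m \<omega>)) * G" unfolding 2 G_def .
      then show ?thesis unfolding t_def 1 using nY by simp
    qed
    have t_off: "t n \<omega> = 0" if "n \<notin> D" for n using that by (auto simp: t_def D_def)
    define u' where "u' = (G * g \<omega>) * (\<Sum>n\<in>D. \<Prod>m\<in>D - {n}. a (Xs m \<omega>))"
    have "(\<Sum>n. ennreal (t n \<omega>)) = (\<Sum>n\<in>D. ennreal (t n \<omega>))"
      using t_off by (intro suminf_finite D) simp
    also have "\<dots> = ennreal (\<Sum>n\<in>D. t n \<omega>)" by (rule sum_ennreal) (rule t0)
    also have "(\<Sum>n\<in>D. t n \<omega>) = u'" unfolding u'_def sum_distrib_left by (intro sum.cong refl tD)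
    finally have T: "(\<Sum>n. ennreal (t n \<omega>)) = ennreal u'" .
    have u'0: "0 \<le> u'"
      unfolding u'_def using testD(3)[OF a] G0 g0[of \<omega>]
      by (intro mult_nonneg_nonneg sum_nonneg prod_nonneg) (auto simp: less_imp_le)
    then have uu': "u \<omega> = u'" unfolding u_def T by simp
    have "((\<lambda>h. \<Prod>n\<in>D. a (Xs n \<omega>) - h) has_field_derivative (\<Sum>n\<in>D. (- 1) * (\<Prod>m\<in>D - {n}. a (Xs m \<omega>) - 0))) (at 0)"
      by (rule has_field_derivative_prod) (auto intro!: derivative_eq_intros)
    then have "((\<lambda>h. ((\<Prod>n\<in>D. a (Xs n \<omega>) - h) - (\<Prod>n\<in>D. a (Xs n \<omega>))) / h) \<longlongrightarrow> - (\<Sum>n\<in>D. \<Prod>m\<in>D - {n}. a (Xs m \<omega>))) (at 0)"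
      by (simp add: has_field_derivative_iff sum_negf)
    from tendsto_minus[OF filterlim_compose[OF this \<theta>_lim]]
    have "(\<lambda>j. ((\<Prod>n\<in>D. a (Xs n \<omega>)) - (\<Prod>n\<in>D. a (Xs n \<omega>) - \<theta> j)) / \<theta> j) \<longlonglongrightarrow> (\<Sum>n\<in>D. \<Prod>m\<in>D - {n}. a (Xs m \<omega>))"
      by (simp add: minus_divide_left)
    then have "(\<lambda>j. f j \<omega>) \<longlonglongrightarrow> u'"
      unfolding f_eq u'_def by (rule tendsto_mult_left)
    moreover have "mono (\<lambda>j. f j \<omega>)"
    proof (rule monoI)
      fix j k :: nat assume jk: "j \<le> k"
      have "((\<Prod>n\<in>D. a (Xs n \<omega>)) - (\<Prod>n\<in>D. a (Xs n \<omega>) - \<theta> j)) / \<theta> j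
          \<le> ((\<Prod>n\<in>D. a (Xs n \<omega>)) - (\<Prod>n\<in>D. a (Xs n \<omega>) - \<theta> k)) / \<theta> k"
      proof (rule prod_slope_antimono[OF D \<theta>(1) \<theta>_dec[OF jk]])
        show "\<theta> j \<le> a (Xs n \<omega>)" for n using \<theta>(2)[of j] c(2)[OF xs[of n]] by linarith
      qed
      then show "f j \<omega> \<le> f k \<omega>"
        unfolding f_eq using G0 g0[of \<omega>] by (intro mult_left_mono) auto
    qed
    ultimately show ?thesis using T uu' by simp
  qed
  have AE_fin: "AE \<omega> in M. finite {n. enat n < \<kappa> \<omega> \<and> Xs n \<omega> \<in> A}"
    by (rule AE_finite_points[OF A(1) A_fin])
  have AE_sp: "AE \<omega> in M. \<omega> \<in> space M" by simp
  have AE_mono: "AE \<omega> in M. mono (\<lambda>j. f j \<omega>)" and AE_lim: "AE \<omega> in M. (\<lambda>j. f j \<omega>) \<longlonglongrightarrow> u \<omega>"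
    and AE_sum: "AE \<omega> in M. (\<Sum>n. ennreal (t n \<omega>)) = ennreal (u \<omega>)"
    using AE_fin AE_sp by (eventually_elim, use good in blast)+
  \<comment> \<open>Convergence of the integrals \<open>f_lim\<close> is part of monotone
    convergence here, so integrability of the sum is a conclusion.\<close>
  have u_int: "integrable M u"
    by (rule integrable_monotone_convergence[OF f_int AE_mono AE_lim f_lim u_meas])
  have u_val: "integral\<^sup>L M u = s * ?L * exp ?e"
    by (rule integral_monotone_convergence[OF f_int AE_mono AE_lim f_lim u_meas])
  have "(\<integral>\<^sup>+\<omega>. (\<Sum>n. ennreal (t n \<omega>)) \<partial>M) = (\<integral>\<^sup>+\<omega>. ennreal (u \<omega>) \<partial>M)"
    by (rule nn_integral_cong_AE[OF AE_sum])
  also have "\<dots> = ennreal (integral\<^sup>L M u)"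
    by (rule nn_integral_eq_integral[OF u_int]) (simp add: u_def)
  finally show ?thesis unfolding u_val t_def .
qed

end

text \<open>No summability is assumed: both sides are \<open>0\<close> if it fails.\<close>

lemma infsum_eq_integral_count_space:
  fixes f :: "nat \<Rightarrow> real"
  shows "infsum f S = (\<integral>n. indicator S n * f n \<partial>count_space UNIV)"
proof -
  have eq: "f summable_on S \<longleftrightarrow> integrable (count_space UNIV) (\<lambda>n. indicator S n * f n)"
    using summable_on_iff_abs_summable_on_real[of f S] abs_summable_equivalent[of f S]
    unfolding abs_summable_on_altdef set_integrable_def by simp
  show ?thesis
  proof (cases "f summable_on S")
    case True
    then have "Infinite_Set_Sum.abs_summable_on f S"
      using summable_on_iff_abs_summable_on_real[of f S] abs_summable_equivalent[of f S] by simp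
    then have "infsum f S = infsetsum f S" by (rule infsetsum_infsum[symmetric])
    then show ?thesis by (simp add: infsetsum_altdef set_lebesgue_integral_def)
  next
    case False
    then show ?thesis using eq by (simp add: infsum_not_exists not_integrable_integral_eq)
  qed
qed

section \<open>The Mecke equation as an identity of measures\<close>

context thinning
begin

abbreviation "K0 \<equiv> distr M N2 (\<lambda>\<omega>. (\<eta> \<omega>, resampled \<omega>))"
text \<open>Pairs of an index and an outcome: sums over points become integrals, to which
  push-forwards, densities and Fubini apply.\<close>

abbreviation "CM \<equiv> count_space (UNIV :: nat set) \<Otimes>\<^sub>M M"

definition reduced :: "nat \<times> 'w \<Rightarrow> 'a measure \<times> 'a measure" where
  "reduced p = (eta_except (fst p) (snd p), resampled_except (fst p) (snd p))"

definition retained :: "nat \<times> 'w \<Rightarrow> real" where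
  "retained p = of_bool (enat (fst p) < \<kappa> (snd p) \<and> Y (fst p) (snd p))"

lemma measurable_CM:
  assumes "\<And>n. (\<lambda>\<omega>. f (n, \<omega>)) \<in> M \<rightarrow>\<^sub>M L"
  shows "f \<in> CM \<rightarrow>\<^sub>M L"
  by (rule measurable_pair_measure_countable1) (use assms in auto)

lemma reduced_meas: "reduced \<in> CM \<rightarrow>\<^sub>M N2"
  by (rule measurable_CM) (unfold reduced_def fst_conv snd_conv, rule measurable_Pair[OF eta_except_meas resampled_except_meas])

lemma retained_meas: "retained \<in> borel_measurable CM"
  by (rule measurable_CM) (unfold retained_def fst_conv snd_conv, use kept_pred in measurable)

lemma point_meas: "(\<lambda>p. Xs (fst p) (snd p)) \<in> CM \<rightarrow>\<^sub>M X"
  by (rule measurable_CM) (simp add: Xs_meas)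

lemma retained_nonneg: "0 \<le> retained p"
  by (simp add: retained_def)

lemma nn_integral_CM:
  assumes "f \<in> borel_measurable CM"
  shows "(\<integral>\<^sup>+p. f p \<partial>CM) = (\<integral>\<^sup>+\<omega>. (\<Sum>n. f (n, \<omega>)) \<partial>M)"
proof -
  interpret C: sigma_finite_measure "count_space (UNIV :: nat set)"
    by (rule sigma_finite_measure_count_space_countable) simp
  interpret P: pair_sigma_finite "count_space (UNIV :: nat set)" M ..
  show ?thesis
    using P.nn_integral_snd[of f] assms by (simp add: nn_integral_count_space_nat)
qed

text \<open>As functions of \<open>E\<close>, both sides are measures with finite mass
  \<open>s * measure lam A\<close>, since \<open>A\<close> has finite intensity; they agree on
  generating functionals by \<open>mecke_gen\<close>, hence everywhere.\<close>

lemma mecke_local: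
  assumes A: "A \<in> sets X" "A \<subseteq> Bn i" and E: "E \<in> sets N2"
  shows "(\<integral>\<^sup>+p. ennreal (retained p * indicator A (Xs (fst p) (snd p))) * indicator E (reduced p) \<partial>CM)
    = ennreal (s * measure lam A) * emeasure K0 E"
proof -
  interpret K0: prob_space K0 by (rule prob_space_distr[OF pair_meas])
  define h where "h p = retained p * indicator A (Xs (fst p) (snd p))" for p
  have h0: "0 \<le> h p" for p by (simp add: h_def retained_nonneg)
  have h_meas: "h \<in> borel_measurable CM"
    unfolding h_def[abs_def]
    by (intro borel_measurable_times retained_meas measurable_compose[OF point_meas borel_measurable_indicator[OF A(1)]])
  have key: "(\<integral>\<^sup>+p. ennreal (h p * (gen z (fst (reduced p)) * gen w (snd (reduced p)))) \<partial>CM)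
      = ennreal (s * measure lam A * (\<integral>p. gen z (fst p) * gen w (snd p) \<partial>K0))"
    if z: "test z" and w: "test w" for z w
  proof -
    have "(\<lambda>p. gen z (fst (reduced p)) * gen w (snd (reduced p))) \<in> borel_measurable CM"
      using measurable_compose[OF reduced_meas measurable_gen_fst_snd[OF z w]] .
    then have m: "(\<lambda>p. ennreal (h p * (gen z (fst (reduced p)) * gen w (snd (reduced p))))) \<in> borel_measurable CM"
      using h_meas by measurable
    show ?thesis
      unfolding nn_integral_CM[OF m] couplingD(3)[OF coupling_law z w]
      using mecke_gen[OF A z w] by (simp add: h_def retained_def reduced_def)
  qed
  let ?P = "density CM (\<lambda>p. ennreal (h p))"
  let ?Q = "density K0 (\<lambda>_. ennreal (s * measure lam A))"
  \<comment> \<open>The total mass is the case of the constant test functions 1.\<close>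
  have "emeasure ?P (space ?P) = ennreal (s * measure lam A)"
    using key[OF test_one test_one] h_meas K0.prob_space[unfolded space_distr]
    by (simp add: emeasure_density cong: nn_integral_cong_simp)
  then have P_fin: "finite_measure ?P" by (intro finite_measureI) simp
  have Q_fin: "finite_measure ?Q"
    by (rule finite_measureI) (simp add: emeasure_density_const ennreal_mult_eq_top_iff)
  have pP: "reduced \<in> ?P \<rightarrow>\<^sub>M N2" using reduced_meas by simp
  have pQ: "(\<lambda>p. p) \<in> ?Q \<rightarrow>\<^sub>M N2" by (rule measurable_ident_sets) simp
  have "distr ?P N2 reduced = distr ?Q N2 (\<lambda>p. p)"
  proof (rule distr_pair_eqI[OF P_fin Q_fin pP pQ])
    fix z w assume z: "test z" and w: "test w"
    have gm: "(\<lambda>p. gen z (fst (reduced p)) * gen w (snd (reduced p))) \<in> borel_measurable CM"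
      using measurable_compose[OF reduced_meas measurable_gen_fst_snd[OF z w]] .
    have "(\<integral>p. gen z (fst (reduced p)) * gen w (snd (reduced p)) \<partial>?P)
        = (\<integral>p. h p *\<^sub>R (gen z (fst (reduced p)) * gen w (snd (reduced p))) \<partial>CM)"
      by (rule integral_density[OF gm h_meas]) (simp add: h0)
    also have "\<dots> = (\<integral>p. h p * (gen z (fst (reduced p)) * gen w (snd (reduced p))) \<partial>CM)" by simp
    also have "\<dots> = enn2real (\<integral>\<^sup>+p. ennreal (h p * (gen z (fst (reduced p)) * gen w (snd (reduced p)))) \<partial>CM)"
      by (rule integral_eq_nn_integral) (use h_meas gm h0 in auto)
    also have "\<dots> = s * measure lam A * (\<integral>p. gen z (fst p) * gen w (snd p) \<partial>K0)"
      unfolding key[OF z w] couplingD(3)[OF coupling_law z w] using s by (intro enn2real_ennreal) simp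
    also have "\<dots> = (\<integral>p. (s * measure lam A) *\<^sub>R (gen z (fst p) * gen w (snd p)) \<partial>K0)" by simp
    also have "\<dots> = (\<integral>p. gen z (fst p) * gen w (snd p) \<partial>?Q)"
      by (rule integral_density[symmetric]) (use s measurable_gen_fst_snd[OF z w] in auto)
    finally show "(\<integral>p. gen z (fst (reduced p)) * gen w (snd (reduced p)) \<partial>?P) = (\<integral>p. gen z (fst p) * gen w (snd p) \<partial>?Q)" .
  qed
  then have "emeasure (distr ?P N2 reduced) E = emeasure (distr ?Q N2 (\<lambda>p. p)) E" by simp
  moreover have "emeasure (distr ?Q N2 (\<lambda>p. p)) E = ennreal (s * measure lam A) * emeasure K0 E"
  proof -
    have "(\<lambda>p. p) -` E \<inter> space ?Q = E" using sets.sets_into_space[OF E] by auto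
    then show ?thesis using E by (simp only: emeasure_distr[OF pQ E]) (simp add: emeasure_density_const)
  qed
  moreover have "emeasure (distr ?P N2 reduced) E = (\<integral>\<^sup>+p. ennreal (h p) * indicator E (reduced p) \<partial>CM)"
  proof -
    have "emeasure (distr ?P N2 reduced) E = emeasure ?P (reduced -` E \<inter> space CM)"
      by (subst emeasure_distr[OF pP E]) simp
    also have "\<dots> = (\<integral>\<^sup>+p. ennreal (h p) * indicator (reduced -` E \<inter> space CM) p \<partial>CM)"
      using h_meas measurable_sets[OF reduced_meas E] by (intro emeasure_density) simp_all
    also have "\<dots> = (\<integral>\<^sup>+p. ennreal (h p) * indicator E (reduced p) \<partial>CM)"
      by (intro nn_integral_cong) (simp add: indicator_def)
    finally show ?thesis .
  qed
  ultimately show ?thesis by (simp add: h_def)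
qed

text \<open>The reduced Campbell measure of the retained points: the position of such a point
  together with both configurations deprived of it.\<close>

abbreviation "retained_points \<equiv> distr (density CM (\<lambda>p. ennreal (retained p))) (X \<Otimes>\<^sub>M N2) (\<lambda>p. (Xs (fst p) (snd p), reduced p))"

lemma marked_meas: "(\<lambda>p. (Xs (fst p) (snd p), reduced p)) \<in> CM \<rightarrow>\<^sub>M X \<Otimes>\<^sub>M N2"
  by (rule measurable_Pair[OF point_meas reduced_meas])

lemma emeasure_retained_points:
  assumes A: "A \<in> sets X" and E: "E \<in> sets N2"
  shows "emeasure retained_points (A \<times> E)
    = (\<integral>\<^sup>+p. ennreal (retained p * indicator A (Xs (fst p) (snd p))) * indicator E (reduced p) \<partial>CM)"
proof -
  have AE: "A \<times> E \<in> sets (X \<Otimes>\<^sub>M N2)" using A E by simp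
  have "emeasure retained_points (A \<times> E)
      = emeasure (density CM (\<lambda>p. ennreal (retained p))) ((\<lambda>p. (Xs (fst p) (snd p), reduced p)) -` (A \<times> E) \<inter> space CM)"
    using marked_meas by (subst emeasure_distr[OF _ AE]) simp_all
  also have "\<dots> = (\<integral>\<^sup>+p. ennreal (retained p) * indicator ((\<lambda>p. (Xs (fst p) (snd p), reduced p)) -` (A \<times> E) \<inter> space CM) p \<partial>CM)"
    using retained_meas measurable_sets[OF marked_meas AE] by (intro emeasure_density) simp_all
  also have "\<dots> = (\<integral>\<^sup>+p. ennreal (retained p * indicator A (Xs (fst p) (snd p))) * indicator E (reduced p) \<partial>CM)"
    by (intro nn_integral_cong) (simp add: indicator_def)
  finally show ?thesis .
qed

text \<open>By uniqueness of sigma-finite product measures, rectangles suffice. There the local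
  version holds with \<open>A\<close> cut down to \<open>Bn i\<close>, and both sides increase to
  their values at \<open>A\<close>.\<close>

lemma mecke_measure: "lam \<Otimes>\<^sub>M density K0 (\<lambda>_. ennreal s) = retained_points"
proof (rule pair_measure_eqI)
  interpret K0: prob_space K0 by (rule prob_space_distr[OF pair_meas])
  show "sigma_finite_measure lam" ..
  have "finite_measure (density K0 (\<lambda>_. ennreal s))"
    by (rule finite_measureI) (simp add: emeasure_density_const ennreal_mult_eq_top_iff)
  then show "sigma_finite_measure (density K0 (\<lambda>_. ennreal s))" by (rule finite_measure.axioms)
  show "sets (lam \<Otimes>\<^sub>M density K0 (\<lambda>_. ennreal s)) = sets retained_points"
    unfolding sets_distr by (intro sets_pair_measure_cong) (simp_all add: lam_sets)
  fix A E assume "A \<in> sets lam" "E \<in> sets (density K0 (\<lambda>_. ennreal s))"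
  then have A: "A \<in> sets X" and E: "E \<in> sets N2" by (simp_all add: lam_sets)
  have loc: "emeasure lam (A \<inter> Bn i) * (ennreal s * emeasure K0 E) = emeasure retained_points ((A \<inter> Bn i) \<times> E)" for i
  proof -
    have Ai: "A \<inter> Bn i \<in> sets X" using A Bn_sets by simp
    have "emeasure lam (A \<inter> Bn i) \<noteq> \<infinity>"
      using emeasure_mono[of "A \<inter> Bn i" "Bn i" lam] Bn_fin[of i] lam_sets Bn_sets by auto
    then have "emeasure lam (A \<inter> Bn i) = ennreal (measure lam (A \<inter> Bn i))" by (rule emeasure_eq_ennreal_measure[unfolded infinity_ennreal_def[symmetric]])
    then show ?thesis
      unfolding emeasure_retained_points[OF Ai E] mecke_local[OF Ai Int_lower2 E]
      using s by (simp add: ennreal_mult mult_ac)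
  qed
  have "(\<Union>i. A \<inter> Bn i) = A" using Bn_UN sets.sets_into_space[OF A] by auto
  have "emeasure lam A * (ennreal s * emeasure K0 E) = (SUP i. emeasure lam (A \<inter> Bn i)) * (ennreal s * emeasure K0 E)"
    using A lam_sets Bn_sets Bn_inc \<open>(\<Union>i. A \<inter> Bn i) = A\<close>
    by (subst SUP_emeasure_incseq) (auto simp: incseq_def)
  also have "\<dots> = (SUP i. emeasure lam (A \<inter> Bn i) * (ennreal s * emeasure K0 E))"
    by (rule SUP_mult_right_ennreal)
  also have "\<dots> = (SUP i. emeasure retained_points ((A \<inter> Bn i) \<times> E))" unfolding loc ..
  also have "\<dots> = emeasure retained_points (\<Union>i. (A \<inter> Bn i) \<times> E)"
    using A E Bn_sets Bn_inc by (intro SUP_emeasure_incseq) (auto simp: incseq_def)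
  also have "(\<Union>i. (A \<inter> Bn i) \<times> E) = A \<times> E" using \<open>(\<Union>i. A \<inter> Bn i) = A\<close> by auto
  finally show "emeasure lam A * emeasure (density K0 (\<lambda>_. ennreal s)) E = emeasure retained_points (A \<times> E)"
    using E by (simp add: emeasure_density_const)
qed

text \<open>The finiteness assumption makes the signed integrand integrable on the Campbell side;
  through the equality of measures it is then integrable over indices and outcomes, so Fubini
  exchanges the sum and the expectation.\<close>

theorem mecke_integral:
  fixes \<Phi> :: "'a \<times> 'a measure \<times> 'a measure \<Rightarrow> real"
  assumes \<Phi>: "\<Phi> \<in> borel_measurable (X \<Otimes>\<^sub>M N2)"
    and fin: "(\<integral>\<^sup>+x. (\<integral>\<^sup>+p. ennreal \<bar>\<Phi> (x, p)\<bar> \<partial>K0) \<partial>lam) < \<infinity>"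
  shows "(\<integral>\<omega>. infsum (\<lambda>n. \<Phi> (Xs n \<omega>, eta_except n \<omega>, resampled_except n \<omega>)) {n. enat n < \<kappa> \<omega> \<and> Y n \<omega>} \<partial>M)
    = s * (\<integral>x. \<integral>p. \<Phi> (x, p) \<partial>K0 \<partial>lam)"
proof -
  interpret K0: prob_space K0 by (rule prob_space_distr[OF pair_meas])
  interpret Ks: finite_measure "density K0 (\<lambda>_. ennreal s)"
    by (rule finite_measureI) (simp add: emeasure_density_const ennreal_mult_eq_top_iff)
  interpret LK: pair_sigma_finite lam "density K0 (\<lambda>_. ennreal s)" ..
  interpret C: sigma_finite_measure "count_space (UNIV :: nat set)"
    by (rule sigma_finite_measure_count_space_countable) simp
  interpret CP: pair_sigma_finite "count_space (UNIV :: nat set)" M ..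
  have sets_LK: "sets (lam \<Otimes>\<^sub>M density K0 (\<lambda>_. ennreal s)) = sets (X \<Otimes>\<^sub>M N2)"
    by (intro sets_pair_measure_cong) (simp_all add: lam_sets)
  have \<Phi>': "\<Phi> \<in> borel_measurable (lam \<Otimes>\<^sub>M density K0 (\<lambda>_. ennreal s))"
    unfolding measurable_cong_sets[OF sets_LK refl] by (rule \<Phi>)
  have \<Phi>x: "(\<lambda>p. \<Phi> (x, p)) \<in> borel_measurable N2" if "x \<in> space X" for x
    by (rule measurable_compose[OF measurable_Pair1'[OF that] \<Phi>])
  have "(\<integral>\<^sup>+q. ennreal (norm (\<Phi> q)) \<partial>(lam \<Otimes>\<^sub>M density K0 (\<lambda>_. ennreal s)))
      = (\<integral>\<^sup>+x. \<integral>\<^sup>+p. ennreal (norm (\<Phi> (x, p))) \<partial>density K0 (\<lambda>_. ennreal s) \<partial>lam)"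
    using \<Phi>' by (subst Ks.nn_integral_fst[symmetric]) auto
  \<comment> \<open>The density \<open>s\<close> is at most 1, so the bound assumed under
    \<open>K0\<close> itself suffices.\<close>
  also have "\<dots> \<le> (\<integral>\<^sup>+x. \<integral>\<^sup>+p. ennreal \<bar>\<Phi> (x, p)\<bar> \<partial>K0 \<partial>lam)"
  proof (intro nn_integral_mono)
    fix x assume "x \<in> space lam"
    then have x: "x \<in> space X" by (simp add: lam_space)
    have "(\<integral>\<^sup>+p. ennreal (norm (\<Phi> (x, p))) \<partial>density K0 (\<lambda>_. ennreal s)) = (\<integral>\<^sup>+p. ennreal s * ennreal (norm (\<Phi> (x, p))) \<partial>K0)"
      using \<Phi>x[OF x] by (intro nn_integral_density) auto
    also have "\<dots> \<le> (\<integral>\<^sup>+p. ennreal \<bar>\<Phi> (x, p)\<bar> \<partial>K0)"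
      using s by (intro nn_integral_mono) (simp add: ennreal_mult[symmetric] mult_left_le_one_le ennreal_leI)
    finally show "(\<integral>\<^sup>+p. ennreal (norm (\<Phi> (x, p))) \<partial>density K0 (\<lambda>_. ennreal s)) \<le> (\<integral>\<^sup>+p. ennreal \<bar>\<Phi> (x, p)\<bar> \<partial>K0)" .
  qed
  finally have "(\<integral>\<^sup>+q. ennreal (norm (\<Phi> q)) \<partial>(lam \<Otimes>\<^sub>M density K0 (\<lambda>_. ennreal s))) < \<infinity>"
    using fin by (rule le_less_trans)
  then have int_LK: "integrable (lam \<Otimes>\<^sub>M density K0 (\<lambda>_. ennreal s)) \<Phi>"
    using \<Phi>' by (intro integrableI_bounded)
  then have int_rp: "integrable retained_points \<Phi>" unfolding mecke_measure .
  let ?m = "\<lambda>p. (Xs (fst p) (snd p), reduced p)"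
  have \<Phi>m: "(\<lambda>p. \<Phi> (?m p)) \<in> borel_measurable CM" by (rule measurable_compose[OF marked_meas \<Phi>])
  have md: "?m \<in> density CM (\<lambda>p. ennreal (retained p)) \<rightarrow>\<^sub>M X \<Otimes>\<^sub>M N2" using marked_meas by simp
  have int_CM: "integrable CM (\<lambda>p. retained p * \<Phi> (?m p))"
  proof -
    have "integrable (density CM (\<lambda>p. ennreal (retained p))) (\<lambda>p. \<Phi> (?m p))"
      using int_rp by (rule integrable_distr[OF md])
    then show ?thesis
      using integrable_density[OF \<Phi>m retained_meas] retained_nonneg by simp
  qed
  have "(\<integral>\<omega>. infsum (\<lambda>n. \<Phi> (Xs n \<omega>, eta_except n \<omega>, resampled_except n \<omega>)) {n. enat n < \<kappa> \<omega> \<and> Y n \<omega>} \<partial>M)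
      = (\<integral>\<omega>. \<integral>n. retained (n, \<omega>) * \<Phi> (?m (n, \<omega>)) \<partial>count_space UNIV \<partial>M)"
    unfolding infsum_eq_integral_count_space
    by (intro Bochner_Integration.integral_cong refl) (simp add: retained_def reduced_def indicator_def)
  also have "\<dots> = (\<integral>p. retained p * \<Phi> (?m p) \<partial>CM)"
  proof -
    have "(\<lambda>(n, \<omega>). retained (n, \<omega>) * \<Phi> (?m (n, \<omega>))) = (\<lambda>p. retained p * \<Phi> (?m p))"
      by (simp add: fun_eq_iff)
    then show ?thesis
      using CP.integral_snd[of "\<lambda>n \<omega>. retained (n, \<omega>) * \<Phi> (?m (n, \<omega>))"] int_CM by (simp only:)
  qed
  also have "\<dots> = (\<integral>p. \<Phi> (?m p) \<partial>density CM (\<lambda>p. ennreal (retained p)))"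
    using integral_density[OF \<Phi>m retained_meas] retained_nonneg by simp
  also have "\<dots> = (\<integral>q. \<Phi> q \<partial>retained_points)"
    by (rule integral_distr[OF md \<Phi>, symmetric])
  also have "\<dots> = (\<integral>x. \<integral>p. \<Phi> (x, p) \<partial>density K0 (\<lambda>_. ennreal s) \<partial>lam)"
    unfolding mecke_measure[symmetric] by (rule LK.integral_fst'[OF int_LK, symmetric])
  also have "\<dots> = (\<integral>x. s * (\<integral>p. \<Phi> (x, p) \<partial>K0) \<partial>lam)"
  proof (intro Bochner_Integration.integral_cong refl)
    fix x assume "x \<in> space lam"
    then have x: "x \<in> space X" by (simp add: lam_space)
    have "(\<integral>p. \<Phi> (x, p) \<partial>density K0 (\<lambda>_. ennreal s)) = (\<integral>p. s *\<^sub>R \<Phi> (x, p) \<partial>K0)"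
      using \<Phi>x[OF x] s by (intro integral_density) auto
    then show "(\<integral>p. \<Phi> (x, p) \<partial>density K0 (\<lambda>_. ennreal s)) = s * (\<integral>p. \<Phi> (x, p) \<partial>K0)" by simp
  qed
  also have "\<dots> = s * (\<integral>x. \<integral>p. \<Phi> (x, p) \<partial>K0 \<partial>lam)" by simp
  finally show ?thesis .
qed

lemma indicator_except_sum:
  assumes n: "enat n < k" "S n" and xs: "\<And>n. xs n \<in> space X" and A: "A \<in> sets X"
  shows "emeasure (pts_measure X k S xs) A = emeasure (pts_measure X k (\<lambda>m. m \<noteq> n \<and> S m) xs) A + indicator A (xs n)"
proof -
  have "emeasure (pts_measure X k S xs) A
      = (\<Sum>m. (if enat m < k \<and> m \<noteq> n \<and> S m then indicator A (xs m) else 0) + (if m = n then indicator A (xs n) else 0))"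
    unfolding emeasure_pts_measure[OF xs A] using n by (intro arg_cong[where f=suminf] ext) auto
  also have "\<dots> = (\<Sum>m. if enat m < k \<and> m \<noteq> n \<and> S m then indicator A (xs m) else 0) + (\<Sum>m. if m = n then indicator A (xs n) else 0)"
    by (intro suminf_add[symmetric]) auto
  also have "(\<Sum>m. if m = n then indicator A (xs n) else 0) = (indicator A (xs n) :: ennreal)"
    by (subst suminf_finite[of "{n}"]) auto
  finally show ?thesis unfolding emeasure_pts_measure[OF xs A] .
qed

end

text \<open>In \<open>ennreal\<close> a finite summand can be subtracted back even when the other
  summand is infinite. Hence removing the point from \<mu> gives exactly \<nu>, also on sets of
  infinite mass.\<close>

lemma rem_cost_eq_add_cost:
  assumes \<nu>: "sets \<nu> = sets X" and \<mu>: "sets \<mu> = sets X"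
    and eq: "\<And>A. A \<in> sets X \<Longrightarrow> emeasure \<mu> A = emeasure \<nu> A + indicator A x"
  shows "rem_cost X F \<mu> x = add_cost X F \<nu> x"
proof -
  have "rem_pt X \<mu> x = \<nu>"
    unfolding rem_pt_def
    by (rule measure_of_sets_eqI[OF \<nu>]) (simp add: eq indicator_def)
  moreover have "add_pt X \<nu> x = \<mu>"
    unfolding add_pt_def by (rule measure_of_sets_eqI[OF \<mu>]) (simp add: eq)
  ultimately show ?thesis by (simp add: rem_cost_def add_cost_def)
qed

text \<open>The absolute integrability needed by \<open>mecke_integral\<close>, at every single
  time; the bound by the second moments of the costs does not depend on \<open>t\<close>.\<close>

lemma (in coupling_family) cost_corr_nn_finite:
  assumes F: "F \<in> borel_measurable N"
    and dF: "(\<integral>\<^sup>+\<mu>. (\<integral>\<^sup>+x. ennreal ((add_cost X F \<mu> x)\<^sup>2) \<partial>lam) \<partial>\<pi>) < \<infinity>"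
  shows "(\<integral>\<^sup>+x. (\<integral>\<^sup>+p. ennreal \<bar>add_cost X F (fst p) x * add_cost X F (snd p) x\<bar> \<partial>K t) \<partial>lam) < \<infinity>"
proof -
  have "(\<integral>\<^sup>+x. (\<integral>\<^sup>+p. ennreal \<bar>add_cost X F (fst p) x * add_cost X F (snd p) x\<bar> \<partial>K t) \<partial>lam)
      \<le> (\<integral>\<^sup>+x. (\<integral>\<^sup>+\<mu>. ennreal ((add_cost X F \<mu> x)\<^sup>2) \<partial>\<pi>) \<partial>lam)"
  proof (intro nn_integral_mono)
    fix x assume "x \<in> space lam"
    then have x: "x \<in> space X" by (simp add: lam_space)
    show "(\<integral>\<^sup>+p. ennreal \<bar>add_cost X F (fst p) x * add_cost X F (snd p) x\<bar> \<partial>K t) \<le> (\<integral>\<^sup>+\<mu>. ennreal ((add_cost X F \<mu> x)\<^sup>2) \<partial>\<pi>)"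
      by (rule L2_bound[OF fst_K snd_K law_fst[OF K] law_snd[OF K] add_cost_measurable_at[OF F x]])
  qed
  also have "\<dots> < \<infinity>" unfolding cost_square_swap[OF F dF] by (rule dF)
  finally show ?thesis .
qed

section \<open>The variance formula for a Poisson process and its thinned copies\<close>

theorem theorem2p2:
  fixes M :: "'w measure" and X :: "'a measure" and lam :: "'a measure"
    and \<eta> :: "'w \<Rightarrow> 'a measure" and F :: "'a measure \<Rightarrow> real"
    and \<kappa> :: "'w \<Rightarrow> enat" and Xs :: "nat \<Rightarrow> 'w \<Rightarrow> 'a"
    and Y :: "real \<Rightarrow> nat \<Rightarrow> 'w \<Rightarrow> bool" and \<eta>' :: "real \<Rightarrow> 'w \<Rightarrow> 'a measure"
  assumes lam_sets: "sets lam = sets X"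
    and lam_sf: "sigma_finite_measure lam"
    and PPP: "poisson_process M X lam \<eta>"
    \<comment> \<open>a point representation of eta, used to define the thinning\<close>
    and kappa_meas: "\<kappa> \<in> measurable M (count_space UNIV)"
    and Xs_meas: "\<And>n. Xs n \<in> measurable M X"
    and eta_repr: "\<And>\<omega>. \<omega> \<in> space M \<Longrightarrow>
                     \<eta> \<omega> = pts_measure X (\<kappa> \<omega>) (\<lambda>_. True) (\<lambda>n. Xs n \<omega>)"
    \<comment> \<open>retention marks: i.i.d. Bernoulli(exp(-t))\<close>
    and Y_meas: "\<And>t n. t \<ge> 0 \<Longrightarrow> Y t n \<in> measurable M (count_space UNIV)"
    and Y_bern: "\<And>t n. t \<ge> 0 \<Longrightarrow> measure M {\<omega>\<in>space M. Y t n \<omega>} = exp (- t)"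
    and Y_indep: "\<And>t. t \<ge> 0 \<Longrightarrow>
                    prob_space.indep_vars M (\<lambda>_. count_space UNIV) (Y t) UNIV"
    \<comment> \<open>independent Poisson process with intensity (1 - exp(-t)) lam\<close>
    and eta'_PPP: "\<And>t. t \<ge> 0 \<Longrightarrow>
                     poisson_process M X (scale_measure (ennreal (1 - exp (- t))) lam) (\<eta>' t)"
    \<comment> \<open>(kappa, Xs), the marks Y t, and eta' t are mutually independent\<close>
    and indep: "\<And>t. t \<ge> 0 \<Longrightarrow>
       prob_space.indep_sets M
         (\<lambda>i::nat. if i = 0 then
               sets (vimage_algebra (space M) (\<lambda>\<omega>. (\<kappa> \<omega>, \<lambda>n. Xs n \<omega>))
                       (count_space UNIV \<Otimes>\<^sub>M (\<Pi>\<^sub>M n\<in>UNIV. X)))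
             else if i = 1 then
               sets (vimage_algebra (space M) (\<lambda>\<omega>. \<lambda>n. Y t n \<omega>)
                       (\<Pi>\<^sub>M n\<in>UNIV. count_space UNIV))
             else sets (vimage_algebra (space M) (\<eta>' t) (N_alg X)))
         {0, 1, 2}"
    and F_meas: "F \<in> borel_measurable (N_alg X)"
    and F_sq: "integrable M (\<lambda>\<omega>. (F (\<eta> \<omega>))\<^sup>2)"
    and DF_sq: "(\<integral>\<^sup>+\<omega>. (\<integral>\<^sup>+x. ennreal ((add_cost X F (\<eta> \<omega>) x)\<^sup>2) \<partial>lam) \<partial>M) < \<infinity>"
  shows
    "(\<integral>\<omega>. (F (\<eta> \<omega>) - (\<integral>\<omega>'. F (\<eta> \<omega>') \<partial>M))\<^sup>2 \<partial>M) =
     (\<integral>t\<in>{0..}.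
        (\<integral>\<omega>. (let \<eta>t = sum_msr X (pts_measure X (\<kappa> \<omega>) (\<lambda>n. Y t n \<omega>) (\<lambda>n. Xs n \<omega>)) (\<eta>' t \<omega>)
              in infsum (\<lambda>n. rem_cost X F (\<eta> \<omega>) (Xs n \<omega>) * rem_cost X F \<eta>t (Xs n \<omega>))
                        {n. enat n < \<kappa> \<omega> \<and> Y t n \<omega>}) \<partial>M)
      \<partial>lborel)"
proof -
  interpret M: prob_space M using PPP by (simp add: poisson_process_def)
  obtain Bn where Bn: "range Bn \<subseteq> sets lam" "(\<Union>i. Bn i) = space lam" "\<And>i. emeasure lam (Bn i) \<noteq> \<infinity>" "incseq Bn"
    using sigma_finite_measure.sigma_finite_incseq[OF lam_sf] by metis
  interpret intensity X lam Bn
  proof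
    show "sets lam = sets X" by (rule lam_sets)
    show "Bn n \<in> sets X" for n using Bn(1) lam_sets by auto
    show "incseq Bn" by (rule Bn(4))
    show "(\<Union>n. Bn n) = space X" using Bn(2) sets_eq_imp_space_eq[OF lam_sets] by simp
    show "emeasure lam (Bn n) < \<infinity>" for n using Bn(3)[of n] by (simp add: less_top)
  qed
  have thin: "thinning X lam Bn M \<eta> \<kappa> Xs (Y t) (\<eta>' t) (exp (- t))" if t: "0 \<le> t" for t
  proof (intro thinning.intro thinning_axioms.intro)
    show "intensity X lam Bn" by (rule intensity_axioms)
    show "prob_space M" by (rule M.prob_space_axioms)
    show "0 \<le> exp (- t)" "exp (- t) \<le> 1" using t by simp_all
  qed (fact PPP kappa_meas Xs_meas eta_repr Y_meas[OF t] Y_bern[OF t] Y_indep[OF t] eta'_PPP[OF t] indep[OF t])+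
  have eta: "\<eta> \<in> M \<rightarrow>\<^sub>M N" using PPP by (simp add: poisson_process_def)
  define \<pi> where "\<pi> = distr M N \<eta>"
  define \<eta>t where "\<eta>t t \<omega> = sum_msr X (pts_measure X (\<kappa> \<omega>) (\<lambda>n. Y t n \<omega>) (\<lambda>n. Xs n \<omega>)) (\<eta>' t \<omega>)" for t \<omega>
  \<comment> \<open>Nothing is known about the marks at negative times, so the pair at time 0 is
    used there.\<close>
  define K where "K t = distr M N2 (\<lambda>\<omega>. (\<eta> \<omega>, \<eta>t (max 0 t) \<omega>))" for t
  have resampled_eq: "thinning.resampled X \<kappa> Xs (Y t) (\<eta>' t) = \<eta>t t" if "0 \<le> t" for t
    unfolding thinning.resampled_def[OF thin[OF that]] \<eta>t_def ..
  interpret CF: coupling_family X lam Bn \<pi> K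
  proof
    show "poisson_law \<pi>"
      unfolding \<pi>_def
    proof (rule poisson_law_distr[OF M.prob_space_axioms eta])
      show "(\<integral>\<omega>. gen z (\<eta> \<omega>) \<partial>M) = exp (\<integral>x. z x - 1 \<partial>lam)" if "test z" for z
        using expectation_gen_poisson_process[of M 1 \<eta> z] PPP that by simp
    qed
    show "coupling (exp (- max 0 t)) (K t)" for t
      using thinning.coupling_law[OF thin[of "max 0 t"]] resampled_eq[of "max 0 t"] by (simp add: K_def)
  qed
  have iF: "integrable \<pi> (\<lambda>\<mu>. (F \<mu>)\<^sup>2)"
    unfolding \<pi>_def using F_sq F_meas by (subst integrable_distr_eq[OF eta]) auto
  have dF_meas: "(\<lambda>\<mu>. \<integral>\<^sup>+x. ennreal ((add_cost X F \<mu> x)\<^sup>2) \<partial>lam) \<in> borel_measurable N"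
  proof -
    have s: "sets (N \<Otimes>\<^sub>M lam) = sets (N \<Otimes>\<^sub>M X)" by (intro sets_pair_measure_cong lam_sets refl)
    have "(\<lambda>p. (add_cost X F (fst p) (snd p))\<^sup>2) \<in> borel_measurable (N \<Otimes>\<^sub>M lam)"
      unfolding measurable_cong_sets[OF s refl]
      by (intro borel_measurable_power measurable_add_cost F_meas measurable_fst measurable_snd)
    then have "(\<lambda>p. ennreal ((add_cost X F (fst p) (snd p))\<^sup>2)) \<in> borel_measurable (N \<Otimes>\<^sub>M lam)" by measurable
    from lam.borel_measurable_nn_integral_fst[OF this] show ?thesis by simp
  qed
  have dF: "(\<integral>\<^sup>+\<mu>. (\<integral>\<^sup>+x. ennreal ((add_cost X F \<mu> x)\<^sup>2) \<partial>lam) \<partial>\<pi>) < \<infinity>"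
    unfolding \<pi>_def using DF_sq dF_meas by (subst nn_integral_distr[OF eta]) simp_all
  have F\<eta>: "(\<lambda>\<omega>. F (\<eta> \<omega>)) \<in> borel_measurable M" by (rule measurable_compose[OF eta F_meas])
  have "integrable M (\<lambda>\<omega>. F (\<eta> \<omega>))"
    by (rule M.square_integrable_imp_integrable[OF F\<eta> F_sq])
  then have "(\<integral>\<omega>. (F (\<eta> \<omega>) - (\<integral>\<omega>'. F (\<eta> \<omega>') \<partial>M))\<^sup>2 \<partial>M) = (\<integral>\<omega>. (F (\<eta> \<omega>))\<^sup>2 \<partial>M) - (\<integral>\<omega>. F (\<eta> \<omega>) \<partial>M)\<^sup>2"
    using F_sq by (rule M.variance_eq)
  also have "\<dots> = (\<integral>\<mu>. (F \<mu>)\<^sup>2 \<partial>\<pi>) - (\<integral>\<mu>. F \<mu> \<partial>\<pi>)\<^sup>2"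
    unfolding \<pi>_def integral_distr[OF eta F_meas] integral_distr[OF eta borel_measurable_power[OF F_meas]] ..
  also have "(\<integral>\<mu>. (F \<mu>)\<^sup>2 \<partial>\<pi>) - (\<integral>\<mu>. F \<mu> \<partial>\<pi>)\<^sup>2 =
    (\<integral>t. indicator {0..} t * (exp (- t) *
      (\<integral>x. \<integral>p. add_cost X F (fst p) x * add_cost X F (snd p) x \<partial>K t \<partial>lam)) \<partial>lborel)"
    by (rule CF.variance_formula[OF F_meas iF dF])
  \<comment> \<open>The two sides agree time by time: \<open>exp (- t)\<close> is the retention
    probability, so the Mecke equation absorbs it into the sum over retained points.\<close>
  also have "\<dots> = (\<integral>t\<in>{0..}.
        (\<integral>\<omega>. (let \<eta>t = sum_msr X (pts_measure X (\<kappa> \<omega>) (\<lambda>n. Y t n \<omega>) (\<lambda>n. Xs n \<omega>)) (\<eta>' t \<omega>)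
              in infsum (\<lambda>n. rem_cost X F (\<eta> \<omega>) (Xs n \<omega>) * rem_cost X F \<eta>t (Xs n \<omega>))
                        {n. enat n < \<kappa> \<omega> \<and> Y t n \<omega>}) \<partial>M)
      \<partial>lborel)"
    unfolding set_lebesgue_integral_def Let_def \<eta>t_def[symmetric]
  proof (intro Bochner_Integration.integral_cong refl)
    fix t :: real
    show "indicator {0..} t * (exp (- t) * (\<integral>x. \<integral>p. add_cost X F (fst p) x * add_cost X F (snd p) x \<partial>K t \<partial>lam))
      = indicator {0..} t *\<^sub>R (\<integral>\<omega>. infsum (\<lambda>n. rem_cost X F (\<eta> \<omega>) (Xs n \<omega>) * rem_cost X F (\<eta>t t \<omega>) (Xs n \<omega>))
          {n. enat n < \<kappa> \<omega> \<and> Y t n \<omega>} \<partial>M)"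
    proof (cases "0 \<le> t")
      case True
      interpret T: thinning X lam Bn M \<eta> \<kappa> Xs "Y t" "\<eta>' t" "exp (- t)" by (rule thin[OF True])
      have K0: "K t = T.K0" using True resampled_eq[OF True] by (simp add: K_def)
      define \<Phi> where "\<Phi> q = add_cost X F (fst (snd q)) (fst q) * add_cost X F (snd (snd q)) (fst q)" for q
      have \<Phi>: "\<Phi> \<in> borel_measurable (X \<Otimes>\<^sub>M N2)"
        unfolding \<Phi>_def[abs_def]
        by (intro borel_measurable_times measurable_add_cost F_meas measurable_fst
            measurable_compose[OF measurable_snd measurable_fst] measurable_compose[OF measurable_snd measurable_snd])
      have "(\<integral>\<^sup>+x. (\<integral>\<^sup>+p. ennreal \<bar>\<Phi> (x, p)\<bar> \<partial>T.K0) \<partial>lam) < \<infinity>"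
        using CF.cost_corr_nn_finite[OF F_meas dF, of t] unfolding K0 \<Phi>_def by simp
      from T.mecke_integral[OF \<Phi> this]
      have M: "(\<integral>\<omega>. infsum (\<lambda>n. \<Phi> (Xs n \<omega>, T.eta_except n \<omega>, T.resampled_except n \<omega>)) {n. enat n < \<kappa> \<omega> \<and> Y t n \<omega>} \<partial>M)
        = exp (- t) * (\<integral>x. \<integral>p. add_cost X F (fst p) x * add_cost X F (snd p) x \<partial>K t \<partial>lam)"
        unfolding K0 by (simp add: \<Phi>_def)
      have "(\<integral>\<omega>. infsum (\<lambda>n. rem_cost X F (\<eta> \<omega>) (Xs n \<omega>) * rem_cost X F (\<eta>t t \<omega>) (Xs n \<omega>)) {n. enat n < \<kappa> \<omega> \<and> Y t n \<omega>} \<partial>M)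
        = (\<integral>\<omega>. infsum (\<lambda>n. \<Phi> (Xs n \<omega>, T.eta_except n \<omega>, T.resampled_except n \<omega>)) {n. enat n < \<kappa> \<omega> \<and> Y t n \<omega>} \<partial>M)"
      proof (intro Bochner_Integration.integral_cong refl infsum_cong)
        fix \<omega> n assume \<omega>: "\<omega> \<in> space M" and n: "n \<in> {n. enat n < \<kappa> \<omega> \<and> Y t n \<omega>}"
        note xs = T.Xs_space[OF \<omega>]
        \<comment> \<open>The index is retained, so both configurations arise from their reduced
          versions by adding the same point, and each remove-one cost is an add-one cost of the
          reduced configuration.\<close>
        have "rem_cost X F (\<eta> \<omega>) (Xs n \<omega>) = add_cost X F (T.eta_except n \<omega>) (Xs n \<omega>)"
        proof (rule rem_cost_eq_add_cost)
          show "emeasure (\<eta> \<omega>) A = emeasure (T.eta_except n \<omega>) A + indicator A (Xs n \<omega>)" if "A \<in> sets X" for A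
            using T.indicator_except_sum[of n "\<kappa> \<omega>" "\<lambda>_. True" "\<lambda>n. Xs n \<omega>", OF _ _ xs that] n
            by (simp add: eta_repr[OF \<omega>])
        qed (simp_all add: eta_repr[OF \<omega>])
        moreover have "rem_cost X F (\<eta>t t \<omega>) (Xs n \<omega>) = add_cost X F (T.resampled_except n \<omega>) (Xs n \<omega>)"
        proof (rule rem_cost_eq_add_cost)
          show "emeasure (\<eta>t t \<omega>) A = emeasure (T.resampled_except n \<omega>) A + indicator A (Xs n \<omega>)" if A: "A \<in> sets X" for A
            using T.indicator_except_sum[of n "\<kappa> \<omega>" "\<lambda>n. Y t n \<omega>" "\<lambda>n. Xs n \<omega>", OF _ _ xs A] n
            unfolding \<eta>t_def T.resampled_except_def
            by (simp add: emeasure_sum_msr T.sets_eta'[OF \<omega>] A ac_simps)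
        qed (simp_all add: \<eta>t_def T.resampled_except_def)
        ultimately show "rem_cost X F (\<eta> \<omega>) (Xs n \<omega>) * rem_cost X F (\<eta>t t \<omega>) (Xs n \<omega>)
            = \<Phi> (Xs n \<omega>, T.eta_except n \<omega>, T.resampled_except n \<omega>)"
          by (simp add: \<Phi>_def)
      qed
      then show ?thesis unfolding M by simp
    qed simp
  qed
  finally show ?thesis .
qed

end
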